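(* Fix non-collinear $z_1,z_2,z_3\in\mathbb C$ and let $z_4,\dots,z_{N+3}$ be points in the open triangle $z_1z_2z_3$ with all $N+3$ points pairwise distinct and with a unique Delaunay triangulation $T$ (whose convex hull is the triangle $z_1z_2z_3$). Regard $T$ as a triangulation of the sphere by adding the exterior face $f_0$ with vertices $v_1,v_2,v_3$, oriented so that interior faces are counterclockwise and $f_0$ is listed clockwise. Let $\mathcal E_0$ be a set of $2N$ edges whose complement in $\mathcal E(T)$ is a cycle-rooted spanning tree with odd cycle, let $J'$ be the $2N\times2N$ matrix with rows indexed by $z_v$ and $\bar z_v$, $v\in\{4,\dots,N+3\}$, columns indexed by $\mathcal E_0$, entries $\partial\theta_e/\partial z_v$ and $\partial\theta_e/\partial\bar z_v$, and $\mathcal D_T(z)_{\setminus\{1,2,3\}}=|(2/\mathrm i)^N\det J'|$. Let $\mathcal A_T=-\sum_{f\neq f_0}\mathrm{Vol}(f)+\mathrm{Vol}(z_1,z_2,z_3)$ (interior faces listed counterclockwise, the last term with the counterclockwise listing) and $D_{u\bar v}=\partial^2\mathcal A_T/\partial z_u\partial\bar z_v$. Then $$\mathcal D_T(z)_{\setminus\{1,2,3\}}=2^N\det\big(D_{u\bar v}\big)_{u,v\in\{4,\dots,N+3\}}.$$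
   Context: For each edge $e=\{a,b\}$ with adjacent faces $(a,b,c)$ and $(b,a,d)$ listed in positive cyclic order for the sphere orientation, $\theta_e=\pi-\mathrm{Arg}\frac{z_b-z_c}{z_a-z_c}-\mathrm{Arg}\frac{z_a-z_d}{z_b-z_d}$ (any local continuous branch; for interior edges this is $\pi$ minus the two angles opposite $e$, i.e. the Delaunay edge angle). For a triangle listed $(z_a,z_b,z_c)$, $\mathrm{Vol}=\mathrm{Im}\,\mathrm{Li}_2(w)+\ln|w|\,\mathrm{Arg}(1-w)$, $w=\frac{z_c-z_a}{z_b-z_a}$ (Bloch–Wigner function; the hyperbolic volume of the ideal tetrahedron $(z_a,z_b,z_c,\infty)$ when counterclockwise). A cycle-rooted spanning tree is a connected spanning subgraph with as many edges as vertices. Derivatives are Wirtinger derivatives. *)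

theory Defs
  imports "HOL-Complex_Analysis.Complex_Analysis" "Jordan_Normal_Form.Determinant"
begin

section \<open>Dilogarithm and Bloch--Wigner function\<close>

text \<open>Principal branch of the dilogarithm on the plane slit along [1,inf):
  Li2(w) = - integral from 0 to w (straight segment) of Log(1-t)/t dt.\<close>
definition Li2 :: "complex \<Rightarrow> complex" where
  "Li2 w = - contour_integral (linepath 0 w) (\<lambda>t. Ln (1 - t) / t)"

definition bloch_wigner :: "complex \<Rightarrow> real" where
  "bloch_wigner w = Im (Li2 w) + ln (cmod w) * Arg (1 - w)"

text \<open>Vol of a triangle listed (za,zb,zc).\<close>
definition Vol :: "complex \<Rightarrow> complex \<Rightarrow> complex \<Rightarrow> real" where
  "Vol za zb zc = bloch_wigner ((zc - za) / (zb - za))"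

section \<open>Orientation, triangulations, Delaunay\<close>

definition ccw :: "complex \<Rightarrow> complex \<Rightarrow> complex \<Rightarrow> bool" where
  "ccw a b c \<longleftrightarrow> Im (cnj (b - a) * (c - a)) > 0"

definition cw :: "complex \<Rightarrow> complex \<Rightarrow> complex \<Rightarrow> bool" where
  "cw a b c \<longleftrightarrow> Im (cnj (b - a) * (c - a)) < 0"

text \<open>A triangulation of the point set z`V: a set T of 3-subsets of V (triangles, given by
  their vertex indices), non-degenerate, covering the convex hull, using every point as a
  vertex, and meeting face-to-face.\<close>
definition is_triangulation :: "(nat \<Rightarrow> complex) \<Rightarrow> nat set \<Rightarrow> nat set set \<Rightarrow> bool" where
  "is_triangulation z V T \<longleftrightarrow>
     finite T \<and>
     (\<forall>t\<in>T. t \<subseteq> V \<and> card t = 3 \<and> \<not> collinear (z ` t)) \<and>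
     \<Union>T = V \<and>
     (\<Union>t\<in>T. convex hull (z ` t)) = convex hull (z ` V) \<and>
     (\<forall>t\<in>T. \<forall>s\<in>T. convex hull (z ` t) \<inter> convex hull (z ` s) = convex hull (z ` (t \<inter> s)))"

text \<open>Delaunay: no point of the set lies in the open circumdisk of any triangle.\<close>
definition is_delaunay :: "(nat \<Rightarrow> complex) \<Rightarrow> nat set \<Rightarrow> nat set set \<Rightarrow> bool" where
  "is_delaunay z V T \<longleftrightarrow>
     (\<forall>t\<in>T. \<forall>c r. (\<forall>i\<in>t. dist (z i) c = r) \<longrightarrow> (\<forall>j\<in>V. dist (z j) c \<ge> r))"

definition edges :: "nat set set \<Rightarrow> nat set set" where
  "edges T = {e. card e = 2 \<and> (\<exists>t\<in>T. e \<subseteq> t)}"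

section \<open>Sphere triangulation: third vertex of the face to the left of an oriented edge\<close>

text \<open>For the oriented edge (a,b), the vertex c such that (a,b,c) is a face listed in positive
  cyclic order on the sphere: either an interior face (counterclockwise), or the exterior
  face f0 on vertices 1,2,3 (listed clockwise). Orientations are those of the configuration z.\<close>
definition thirdv :: "(nat \<Rightarrow> complex) \<Rightarrow> nat set set \<Rightarrow> nat \<Rightarrow> nat \<Rightarrow> nat" where
  "thirdv z T a b = (THE c. ({a, b, c} \<in> T \<and> ccw (z a) (z b) (z c)) \<or>
                           ({a, b, c} = {1, 2, 3} \<and> cw (z a) (z b) (z c)))"

text \<open>theta_e as a function of the point positions w (combinatorics fixed by z and T),
  using the principal branch of Arg (smooth near w = z).\<close>
definition theta :: "(nat \<Rightarrow> complex) \<Rightarrow> nat set set \<Rightarrow> nat set \<Rightarrow> (nat \<Rightarrow> complex) \<Rightarrow> real" where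
  "theta z T e w = (let a = Min e; b = Max e; c = thirdv z T a b; d = thirdv z T b a in
      pi - Arg ((w b - w c) / (w a - w c)) - Arg ((w a - w d) / (w b - w d)))"

text \<open>Volume of a face t (3-set of indices) with its counterclockwise listing (w.r.t. z),
  started at its smallest index, evaluated at positions w.\<close>
definition face_vol :: "(nat \<Rightarrow> complex) \<Rightarrow> nat set \<Rightarrow> (nat \<Rightarrow> complex) \<Rightarrow> real" where
  "face_vol z t w = (let a = Min t; b1 = Min (t - {a}); c1 = Max (t - {a}) in
      if ccw (z a) (z b1) (z c1) then Vol (w a) (w b1) (w c1) else Vol (w a) (w c1) (w b1))"

definition A_T :: "(nat \<Rightarrow> complex) \<Rightarrow> nat set set \<Rightarrow> (nat \<Rightarrow> complex) \<Rightarrow> real" where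
  "A_T z T w = - (\<Sum>f\<in>T. face_vol z f w) + face_vol z {1, 2, 3} w"

section \<open>Wirtinger derivatives in the coordinate z_v\<close>

definition pdiff :: "((nat \<Rightarrow> complex) \<Rightarrow> complex) \<Rightarrow> (nat \<Rightarrow> complex) \<Rightarrow> nat \<Rightarrow> complex \<Rightarrow> complex" where
  "pdiff f w v h = vector_derivative (\<lambda>t::real. f (w(v := w v + of_real t * h))) (at 0)"

definition wirt_z :: "((nat \<Rightarrow> complex) \<Rightarrow> complex) \<Rightarrow> (nat \<Rightarrow> complex) \<Rightarrow> nat \<Rightarrow> complex" where
  "wirt_z f w v = (pdiff f w v 1 - \<i> * pdiff f w v \<i>) / 2"

definition wirt_zbar :: "((nat \<Rightarrow> complex) \<Rightarrow> complex) \<Rightarrow> (nat \<Rightarrow> complex) \<Rightarrow> nat \<Rightarrow> complex" where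
  "wirt_zbar f w v = (pdiff f w v 1 + \<i> * pdiff f w v \<i>) / 2"

section \<open>Graph notions\<close>

definition adj_rel :: "nat set set \<Rightarrow> (nat \<times> nat) set" where
  "adj_rel F = {(a, b). {a, b} \<in> F}"

text \<open>Cycle-rooted spanning tree of the graph (V, E): connected spanning subgraph F of E
  with as many edges as vertices.\<close>
definition is_crst :: "nat set \<Rightarrow> nat set set \<Rightarrow> nat set set \<Rightarrow> bool" where
  "is_crst V E F \<longleftrightarrow> F \<subseteq> E \<and> (\<forall>a\<in>V. \<forall>b\<in>V. (a, b) \<in> (adj_rel F)\<^sup>*) \<and> card F = card V"

text \<open>A (simple) cycle in F: distinct vertices v_0..v_{k-1}, k >= 3, consecutive ones
  (cyclically) joined by edges of F.\<close>
definition is_cycle :: "nat set set \<Rightarrow> nat list \<Rightarrow> bool" where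
  "is_cycle F vs \<longleftrightarrow> length vs \<ge> 3 \<and> distinct vs \<and>
     (\<forall>i < length vs. {vs ! i, vs ! ((i + 1) mod length vs)} \<in> F)"

definition has_odd_cycle :: "nat set set \<Rightarrow> bool" where
  "has_odd_cycle F \<longleftrightarrow> (\<exists>vs. is_cycle F vs \<and> odd (length vs))"

section \<open>The determinants\<close>

text \<open>J': rows 0..N-1 are d/dz_v, rows N..2N-1 are d/dzbar_v (v = 4..N+3); columns are
  the edges of E0 in some enumeration (the absolute value of det does not depend on it).\<close>
definition Jprime :: "nat \<Rightarrow> (nat \<Rightarrow> complex) \<Rightarrow> nat set set \<Rightarrow> nat set set \<Rightarrow> complex mat" where
  "Jprime N z T E0 = (let es = (SOME es. bij_betw es {..<2*N} E0) in
     mat (2*N) (2*N) (\<lambda>(i, j).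
       if i < N then wirt_z (\<lambda>w. complex_of_real (theta z T (es j) w)) z (i + 4)
       else wirt_zbar (\<lambda>w. complex_of_real (theta z T (es j) w)) z (i - N + 4)))"

definition D_T_red :: "nat \<Rightarrow> (nat \<Rightarrow> complex) \<Rightarrow> nat set set \<Rightarrow> nat set set \<Rightarrow> real" where
  "D_T_red N z T E0 = cmod ((2 / \<i>) ^ N * det (Jprime N z T E0))"

definition hess_AT :: "nat \<Rightarrow> (nat \<Rightarrow> complex) \<Rightarrow> nat set set \<Rightarrow> complex mat" where
  "hess_AT N z T = mat N N (\<lambda>(i, j).
     wirt_z (\<lambda>w. wirt_zbar (\<lambda>w'. complex_of_real (A_T z T w')) w (j + 4)) z (i + 4))"

end

theory Submission
  imports Defs "Jordan_Normal_Form.Char_Poly"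
begin

text \<open>The edge angles are controlled by the logarithmic edge derivatives
  $L_v(ab) = \partial \log (z_a - z_b) / \partial z_v$ and the skew-symmetric adjacency operator
  $\varepsilon$ of the edges of the sphere triangulation:
  $\partial\theta/\partial z_v = (i/2)\, \varepsilon L_v$. Summing over faces,
  $L_u^T \varepsilon L_v = 0$ and $L_u^T \varepsilon \overline{L_v} = -4 i D_{u \bar v}$, while
  $D$ is a sum of positive semidefinite forms of rank one, so that $\det D \ge 0$.

  The operator $\varepsilon$ vanishes on functions $\zeta_a + \zeta_b$ and maps onto the integral
  edge functions with vanishing vertex sums (this is where Euler's formula and the vanishing of
  $H^1(S^2)$ enter). A cycle-rooted spanning tree with odd cycle has an incidence matrix invertible
  over the rationals whose inverse has integral pair sums; hence the $L_v$ may be normalised to be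
  supported on the complementary edges $E_0$, and the principal minor of $\varepsilon$ on $E_0$ is
  unimodular. Then $J'^T = \varepsilon_0 G$ and $G^T \varepsilon_0 G$ has the antidiagonal blocks
  $-i D$ and its conjugate, which gives $|\det J'| = |\det D| = \det D$.\<close>

text \<open>A cross ratio does not change when every z_a - z_b is multiplied by a weight at a and a
  weight at b. This is the source of the kernel of \<epsilon>, and the freedom that moves L_v off
  the spanning subgraph. Unimodularity of the minor is essential: det J' contains the minor once,
  while the Gram identity contains it next to the square of det G, so a minor of modulus m would
  leave a factor sqrt m. The obstacle is therefore denominators. The incidence matrix of the
  spanning subgraph has only a half-integral inverse, and solving \<epsilon> y = x face by face
  divides by 3; both denominators disappear only by comparing values along the whole graph or over
  the whole sphere. The topology is cheap. The hypotheses prescribe 2N + (N + 3) edges, exactly the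
  number in Euler's formula, and vertices are connected through the spanning subgraph. Geometry
  supplies that every oriented edge has exactly one face on its left and that the faces are
  connected across edges.\<close>

unbundle no fps_syntax
unbundle no vec_syntax

section \<open>Square linear systems over finite index sets\<close>

text \<open>Edge weights with prescribed vertex sums form a right inverse of the incidence matrix of
  the spanning subgraph, whereas normalising edge functions needs the left inverse; having as many
  edges as vertices links the two.\<close>

lemma right_inverse_imp_left_inverse_on:
  fixes A :: "'j \<Rightarrow> 'i \<Rightarrow> 'a::field"
  assumes fin: "finite I" "finite J" and card: "card I = card J"
    and right: "\<And>j j'. j \<in> J \<Longrightarrow> j' \<in> J \<Longrightarrow> (\<Sum>i\<in>I. A j i * X i j') = (if j = j' then 1 else 0)"
    and "i \<in> I" "i' \<in> I"
  shows "(\<Sum>j\<in>J. X i j * A j i') = (if i = i' then 1 else 0)"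
proof -
  define n where "n = card I"
  obtain f g where f: "bij_betw f {..<n} I" and g: "bij_betw g {..<n} J"
    using fin card unfolding n_def by (metis bij_betw_from_nat_into_finite)
  define MA where "MA = mat n n (\<lambda>(k,l). A (g k) (f l))"
  define MX where "MX = mat n n (\<lambda>(k,l). X (f k) (g l))"
  have fI: "f l \<in> I" and gJ: "g l \<in> J" if "l < n" for l
    using f g that by (auto simp: bij_betw_def)
  have inj: "f k = f l \<longleftrightarrow> k = l" "g k = g l \<longleftrightarrow> k = l" if "k < n" "l < n" for k l
    using f g that by (auto simp: bij_betw_def inj_on_def)
  have sI: "(\<Sum>l<n. h (f l)) = (\<Sum>i\<in>I. h i)" for h :: "'i \<Rightarrow> 'a"
    using f by (rule sum.reindex_bij_betw)
  have sJ: "(\<Sum>l<n. h (g l)) = (\<Sum>i\<in>J. h i)" for h :: "'j \<Rightarrow> 'a"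
    using g by (rule sum.reindex_bij_betw)
  have "MA * MX = 1\<^sub>m n"
    by (rule eq_matI)
       (auto simp: MA_def MX_def scalar_prod_def lessThan_atLeast0[symmetric] inj fI gJ
          sI[of "\<lambda>i. A (g _) i * X i (g _)"] right)
  then have XA: "MX * MA = 1\<^sub>m n"
    using mat_mult_left_right_inverse[of MA n MX] by (auto simp: MA_def MX_def)
  obtain k l where kl: "k < n" "l < n" "i = f k" "i' = f l"
    using f assms(5,6) by (auto simp: bij_betw_def)
  have "(\<Sum>j\<in>J. X i j * A j i') = (MX * MA) $$ (k,l)"
    using kl by (simp add: MA_def MX_def scalar_prod_def lessThan_atLeast0[symmetric] flip: sJ)
  then show ?thesis using kl by (simp add: XA inj)
qed

text \<open>A trivial kernel gives a nonzero determinant. The intended unknowns are indexed by faces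
  and vertices, the equations by edges.\<close>

lemma injective_imp_solvable_on:
  fixes A :: "'j \<Rightarrow> 'i \<Rightarrow> 'a::field"
  assumes fin: "finite I" "finite J" and card: "card I = card J"
    and inj: "\<And>x. (\<And>j. j \<in> J \<Longrightarrow> (\<Sum>i\<in>I. A j i * x i) = 0) \<Longrightarrow> \<forall>i\<in>I. x i = 0"
  shows "\<exists>x. \<forall>j\<in>J. (\<Sum>i\<in>I. A j i * x i) = b j"
proof -
  define n where "n = card I"
  obtain f g where f: "bij_betw f {..<n} I" and g: "bij_betw g {..<n} J"
    using fin card unfolding n_def by (metis bij_betw_from_nat_into_finite)
  define f' where "f' = inv_into {..<n} f"
  define MA where "MA = mat n n (\<lambda>(k,l). A (g k) (f l))"
  have cA: "MA \<in> carrier_mat n n" by (simp add: MA_def)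
  have f'f: "f' (f l) = l" if "l < n" for l
    using f that by (simp add: f'_def bij_betw_def inv_into_f_f)
  have row: "(\<Sum>i\<in>I. A (g k) i * v $ f' i) = (MA *\<^sub>v v) $ k" if "k < n" "v \<in> carrier_vec n" for k v
  proof -
    have "(\<Sum>i\<in>I. A (g k) i * v $ f' i) = (\<Sum>l<n. A (g k) (f l) * v $ f' (f l))"
      using sum.reindex_bij_betw[OF f, of "\<lambda>i. A (g k) i * v $ f' i"] by simp
    also have "\<dots> = (\<Sum>l<n. A (g k) (f l) * v $ l)" by (intro sum.cong) (auto simp: f'f)
    also have "\<dots> = (MA *\<^sub>v v) $ k"
      using that by (simp add: MA_def scalar_prod_def lessThan_atLeast0)
    finally show ?thesis .
  qed
  have "det MA \<noteq> 0"
  proof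
    assume "det MA = 0"
    then obtain v where v: "v \<in> carrier_vec n" "v \<noteq> 0\<^sub>v n" "MA *\<^sub>v v = 0\<^sub>v n"
      using det_0_iff_vec_prod_zero_field[OF cA] by auto
    have "\<forall>i\<in>I. v $ f' i = 0"
    proof (rule inj)
      fix j assume "j \<in> J"
      then obtain k where "k < n" "j = g k" using g by (auto simp: bij_betw_def)
      then show "(\<Sum>i\<in>I. A j i * v $ f' i) = 0" using row v by simp
    qed
    then have "v $ l = 0" if "l < n" for l
      using f that f'f[OF that] by (metis bij_betwE lessThan_iff)
    then have "v = 0\<^sub>v n" using v(1) by (intro eq_vecI) auto
    with v(2) show False by simp
  qed
  then obtain B where B: "B \<in> carrier_mat n n" "MA * B = 1\<^sub>m n"
    using det_non_zero_imp_unit[OF cA] by (auto simp: Units_def ring_mat_def)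
  define w where "w = B *\<^sub>v vec n (\<lambda>k. b (g k))"
  have w: "w \<in> carrier_vec n" using B by (simp add: w_def)
  have "MA *\<^sub>v w = vec n (\<lambda>k. b (g k))"
    unfolding w_def using B cA by (simp flip: assoc_mult_mat_vec)
  then have "(\<Sum>i\<in>I. A (g k) i * w $ f' i) = b (g k)" if "k < n" for k
    using row[OF that w] that by simp
  then show ?thesis
    using g by (intro exI[of _ "\<lambda>i. w $ f' i"]) (auto simp: bij_betw_def)
qed

section \<open>Darts of a triangulated sphere\<close>

text \<open>A dart is an oriented edge and \<open>th a b\<close> the third vertex of the face on its
  left; turning this face takes \<open>(a, b)\<close> to \<open>(b, th a b)\<close>, and
  \<open>th_th\<close> makes the turn of order three. Since 3F = 2E, the axiom \<open>euler\<close>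
  is V - E + F = 2 with the faces eliminated.\<close>

locale dart_map =
  fixes V :: "nat set" and D :: "(nat \<times> nat) set" and th :: "nat \<Rightarrow> nat \<Rightarrow> nat"
  assumes finite_V: "finite V" and D_V: "D \<subseteq> V \<times> V"
    and irrefl_D: "(a, b) \<in> D \<Longrightarrow> a \<noteq> b"
    and sym_D: "(a, b) \<in> D \<Longrightarrow> (b, a) \<in> D"
    and th_D: "(a, b) \<in> D \<Longrightarrow> (b, th a b) \<in> D"
    and th_th: "(a, b) \<in> D \<Longrightarrow> th b (th a b) = a"
    and vertex_connected: "\<And>S. S \<subseteq> V \<Longrightarrow> S \<noteq> {} \<Longrightarrow> (\<And>a b. a \<in> S \<Longrightarrow> (a, b) \<in> D \<Longrightarrow> b \<in> S) \<Longrightarrow> S = V"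
    and face_connected: "\<And>S. S \<subseteq> D \<Longrightarrow> S \<noteq> {} \<Longrightarrow> (\<And>a b. (a, b) \<in> S \<Longrightarrow> (b, a) \<in> S)
          \<Longrightarrow> (\<And>a b. (a, b) \<in> S \<Longrightarrow> (b, th a b) \<in> S) \<Longrightarrow> S = D"
    and nonempty_D: "D \<noteq> {}"
    and euler: "card {(a, b) \<in> D. a < b} + 6 = 3 * card V"
begin

text \<open>An orbit of darts and not a set of vertices: two faces may have the same three vertices,
  as happens when the triangulation is a single triangle and the exterior face is added.\<close>

definition face :: "nat \<times> nat \<Rightarrow> (nat \<times> nat) set" where
  "face h = (case h of (a, b) \<Rightarrow> {(a, b), (b, th a b), (th a b, a)})"

definition nbs :: "nat \<Rightarrow> nat set" where
  "nbs v = {b. (v, b) \<in> D}"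

definition edge_set :: "nat set set" where
  "edge_set = {{a, b} | a b. (a, b) \<in> D}"

lemma finite_D: "finite D"
  using finite_subset[OF D_V] finite_V by simp

lemma finite_nbs: "finite (nbs v)"
  by (rule finite_subset[of _ "snd ` D"]) (force simp: nbs_def finite_D)+

lemma th_D': "(a, b) \<in> D \<Longrightarrow> (th a b, a) \<in> D"
  using th_D th_th by metis

lemma th_th': "(a, b) \<in> D \<Longrightarrow> th (th a b) a = b"
  using th_D th_th by metis

lemma th_neq: "(a, b) \<in> D \<Longrightarrow> th a b \<noteq> a" "(a, b) \<in> D \<Longrightarrow> th a b \<noteq> b"
  using th_D th_D' irrefl_D by metis+

lemma sum_D_reverse: "(\<Sum>(a,b)\<in>D. f b a) = (\<Sum>(a,b)\<in>D. f a b)"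
  by (rule sum.reindex_bij_witness[of _ "\<lambda>(a,b). (b,a)" "\<lambda>(a,b). (b,a)"]) (auto intro: sym_D)

lemma sum_D_next: "(\<Sum>(a,b)\<in>D. f b (th a b)) = (\<Sum>(a,b)\<in>D. f a b)"
  by (rule sum.reindex_bij_witness[of _ "\<lambda>(a,b). (th a b,a)" "\<lambda>(a,b). (b,th a b)"])
     (auto simp: th_th th_th' intro: th_D th_D')

text \<open>Turning about \<open>v\<close> permutes its neighbours: \<open>th v b\<close> is the
  next one after \<open>b\<close>, and \<open>th b v\<close> the previous one.\<close>

lemma sum_nbs_next: "(\<Sum>b\<in>nbs v. f (th v b) ) = (\<Sum>b\<in>nbs v. f b)"
proof (rule sum.reindex_bij_witness[of _ "\<lambda>b. th b v" "\<lambda>b. th v b"])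
  fix b assume "b \<in> nbs v"
  then have *: "(v, b) \<in> D" "(b, v) \<in> D" by (auto simp: nbs_def intro: sym_D)
  show "th (th v b) v = b" "th v (th b v) = b" using * th_th th_th' by auto
  show "th v b \<in> nbs v" "th b v \<in> nbs v"
    using * th_D th_D' sym_D by (auto simp: nbs_def)
qed auto

lemma sum_D_nbs: "(\<Sum>(a,b)\<in>D. f a b) = (\<Sum>a\<in>V. \<Sum>b\<in>nbs a. f a b)"
proof -
  have "D = Sigma V nbs" using D_V by (auto simp: nbs_def)
  then show ?thesis by (simp add: sum.Sigma finite_V finite_nbs)
qed

lemma face_eq: "(a, b) \<in> D \<Longrightarrow> face (b, th a b) = face (a, b)"
  by (auto simp: face_def th_th)

lemma face_subset: "h \<in> D \<Longrightarrow> face h \<subseteq> D"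
  by (cases h) (auto simp: face_def intro: th_D th_D')

lemma face_self: "h \<in> face h"
  by (cases h) (auto simp: face_def)

lemma card_face: "h \<in> D \<Longrightarrow> card (face h) = 3"
  by (cases h) (use irrefl_D th_neq in \<open>auto simp: face_def card_insert_if\<close>)

lemma mem_face_iff: "h \<in> D \<Longrightarrow> h' \<in> D \<Longrightarrow> h' \<in> face h \<longleftrightarrow> face h' = face h"
proof
  assume h: "h \<in> D" "h' \<in> face h"
  then show "face h' = face h"
    by (cases h) (auto simp: face_def th_th th_th')
next
  assume "face h' = face h" then show "h' \<in> face h" using face_self by metis
qed

lemma face_disjoint:
  assumes "f \<in> face ` D" "f' \<in> face ` D" "f \<noteq> f'" shows "f \<inter> f' = {}"
proof -
  obtain h h' where h: "h \<in> D" "f = face h" "h' \<in> D" "f' = face h'" using assms by auto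
  have "face k = f \<and> face k = f'" if "k \<in> f" "k \<in> f'" for k
    using that h mem_face_iff[of h k] mem_face_iff[of h' k] face_subset[of h] by auto
  with assms(3) show ?thesis by blast
qed

lemma Union_faces: "\<Union>(face ` D) = D"
  using face_subset face_self by blast

lemma finite_face: "finite (face h)" by (cases h) (auto simp: face_def)

lemma sum_D_faces: "(\<Sum>h\<in>D. g h) = (\<Sum>f\<in>face ` D. \<Sum>h\<in>f. g h)"
proof -
  have "(\<Sum>h\<in>\<Union>(face ` D). g h) = (\<Sum>f\<in>face ` D. \<Sum>h\<in>f. g h)"
    using face_disjoint by (subst sum.Union_disjoint) (auto simp: finite_face)
  then show ?thesis by (simp only: Union_faces)
qed

lemma card_faces: "card D = 3 * card (face ` D)"
proof -
  have "card D = (\<Sum>h\<in>D. 1)" by simp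
  also have "\<dots> = (\<Sum>f\<in>face ` D. \<Sum>h\<in>f. 1)" by (rule sum_D_faces)
  also have "\<dots> = (\<Sum>f\<in>face ` D. 3)" by (intro sum.cong) (auto simp: card_face)
  finally show ?thesis by simp
qed

lemma card_positive_darts: "card D = 2 * card {(a,b)\<in>D. a < b}"
proof -
  have "D = {(a,b)\<in>D. a < b} \<union> {(a,b)\<in>D. b < a}" using irrefl_D by fastforce
  moreover have "card ({(a,b)\<in>D. a < b} \<union> {(a,b)\<in>D. b < a}) = card {(a,b)\<in>D. a < b} + card {(a,b)\<in>D. b < a}"
    by (rule card_Un_disjoint) (auto intro: finite_subset[OF _ finite_D])
  ultimately have "card D = card {(a,b)\<in>D. a < b} + card {(a,b)\<in>D. b < a}" by simp
  moreover have "card {(a,b)\<in>D. b < a} = card {(a,b)\<in>D. a < b}"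
    by (rule bij_betw_same_card[of "\<lambda>(a,b). (b,a)"])
       (force simp: bij_betw_def inj_on_def intro: sym_D)
  ultimately show ?thesis by simp
qed

lemma vertex_constant:
  assumes "\<And>a b. (a, b) \<in> D \<Longrightarrow> \<zeta> a = \<zeta> b" "v \<in> V" "w \<in> V"
  shows "\<zeta> v = \<zeta> w"
proof -
  have "{u \<in> V. \<zeta> u = \<zeta> v} = V"
  proof (rule vertex_connected)
    show "{u \<in> V. \<zeta> u = \<zeta> v} \<noteq> {}" using assms(2) by blast
    show "b \<in> {u \<in> V. \<zeta> u = \<zeta> v}" if "a \<in> {u \<in> V. \<zeta> u = \<zeta> v}" "(a, b) \<in> D" for a b
      using that assms(1)[OF that(2)] D_V by auto
  qed auto
  then have "w \<in> {u \<in> V. \<zeta> u = \<zeta> v}" using assms(3) by (simp only:)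
  then show ?thesis by simp
qed

lemma face_constant:
  assumes "\<And>a b. (a, b) \<in> D \<Longrightarrow> r (a, b) = r (b, a)"
    "\<And>a b. (a, b) \<in> D \<Longrightarrow> r (b, th a b) = r (a, b)" "h \<in> D" "h' \<in> D"
  shows "r h = r h'"
proof -
  have "{k \<in> D. r k = r h} = D"
  proof (rule face_connected)
    show "{k \<in> D. r k = r h} \<noteq> {}" using assms(3) by blast
    show "(b, a) \<in> {k \<in> D. r k = r h}" if "(a, b) \<in> {k \<in> D. r k = r h}" for a b
      using that assms(1)[of a b] sym_D[of a b] by auto
    show "(b, th a b) \<in> {k \<in> D. r k = r h}" if "(a, b) \<in> {k \<in> D. r k = r h}" for a b
      using that assms(2)[of a b] th_D[of a b] by auto
  qed auto
  then have "h' \<in> {k \<in> D. r k = r h}" using assms(4) by (simp only:)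
  then show ?thesis by simp
qed

section \<open>Face potentials, vertex potentials and the first cohomology of the sphere\<close>

text \<open>Exactness at the middle of \<open>faces \<rightarrow> edges \<rightarrow> vertices\<close>: the cohomology of the sphere in
  degree one vanishes. Vertex potentials and face potentials are orthogonal, so the map from
  normalised pairs of potentials to edge functions is injective, and Euler's formula makes it square.\<close>

lemma orthogonal_potentials:
  assumes "\<And>a b. (a, b) \<in> D \<Longrightarrow> r (b, th a b) = (r (a, b) :: real)"
  shows "(\<Sum>(a,b)\<in>D. r (a,b) * (\<zeta> a - \<zeta> b)) = 0"
proof -
  have "(\<Sum>(a,b)\<in>D. r (a,b) * \<zeta> a) = (\<Sum>(a,b)\<in>D. r (b, th a b) * \<zeta> b)"
    using sum_D_next[of "\<lambda>a b. r (a,b) * \<zeta> a"] by simp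
  also have "\<dots> = (\<Sum>(a,b)\<in>D. r (a,b) * \<zeta> b)"
    by (rule sum.cong) (auto simp: assms)
  finally show ?thesis by (simp add: right_diff_distrib sum_subtractf split_def)
qed

lemma gradient_zero:
  assumes "(\<Sum>(a,b)\<in>D. (\<zeta> a - \<zeta> b) * (\<zeta> a - \<zeta> b)) = (0::real)" "(a, b) \<in> D"
  shows "\<zeta> a = \<zeta> b"
proof -
  have "\<forall>h\<in>D. (case h of (a,b) \<Rightarrow> (\<zeta> a - \<zeta> b) * (\<zeta> a - \<zeta> b)) = 0"
    using assms(1) by (subst sum_nonneg_eq_0_iff[symmetric]) (auto simp: finite_D)
  then show ?thesis using assms(2) by auto
qed

lemma face_potential_exists:
  fixes m :: "nat \<Rightarrow> nat \<Rightarrow> real"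
  assumes anti: "\<And>a b. (a, b) \<in> D \<Longrightarrow> m b a = - m a b"
    and coclosed: "\<And>v. v \<in> V \<Longrightarrow> (\<Sum>b\<in>nbs v. m v b) = 0"
  shows "\<exists>r. \<forall>(a,b)\<in>D. r (b, th a b) = r (a, b) \<and> m a b = r (a, b) - r (b, a)"
proof -
  obtain h0 where h0: "h0 \<in> D" using nonempty_D by blast
  define v0 where "v0 = fst h0"
  have v0: "v0 \<in> V" using h0 D_V by (auto simp: v0_def)
  define P where "P = {(a,b)\<in>D. a < b}"
  \<comment> \<open>Potentials are normalised to vanish on the face of \<open>h0\<close> and at
    \<open>v0\<close>. This removes the constants from the kernel and leaves (F - 1) + (V - 1) = E
    unknowns.\<close>
  define F where "F = face ` D - {face h0}"
  define W where "W = V - {v0}"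
  have fin: "finite F" "finite W" "finite P"
    using finite_D finite_V by (auto simp: F_def W_def P_def intro: finite_subset)
  define I where "I = F <+> W"
  have fI: "finite I" using fin by (simp add: I_def)
  have "card I = card F + card W" using fin by (simp add: I_def card_Plus)
  also have "card F = card (face ` D) - 1" using h0 finite_D by (simp add: F_def)
  also have "card W = card V - 1" using v0 finite_V by (simp add: W_def)
  finally have cI: "card I = card P"
  proof -
    assume "card I = card (face ` D) - 1 + (card V - 1)"
    moreover have "card (face ` D) \<ge> 1" "card V \<ge> 1"
      using h0 v0 finite_D finite_V by (auto simp: Suc_le_eq card_gt_0_iff)
    ultimately show ?thesis
      using euler card_faces card_positive_darts unfolding P_def by linarith
  qed
  define A :: "nat \<times> nat \<Rightarrow> (nat \<times> nat) set + nat \<Rightarrow> real" where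
    "A h i = (case i of Inl f \<Rightarrow> of_bool (face h = f) - of_bool (face (snd h, fst h) = f)
              | Inr v \<Rightarrow> of_bool (fst h = v) - of_bool (snd h = v))" for h i
  define rr where "rr x h = (if face h = face h0 then 0 else x (Inl (face h)))"
    for x :: "(nat \<times> nat) set + nat \<Rightarrow> real" and h
  define zz where "zz x v = (if v = v0 then 0 else x (Inr v))"
    for x :: "(nat \<times> nat) set + nat \<Rightarrow> real" and v
  have A_eq: "(\<Sum>i\<in>I. A (a,b) i * x i) = rr x (a,b) - rr x (b,a) + (zz x a - zz x b)"
    if "(a, b) \<in> D" for a b x
  proof -
    have *: "(b, a) \<in> D" "a \<in> V" "b \<in> V" using that sym_D D_V by auto
    have "(\<Sum>i\<in>I. A (a,b) i * x i)
      = (\<Sum>f\<in>F. (of_bool (face (a,b) = f) - of_bool (face (b,a) = f)) * x (Inl f))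
        + (\<Sum>v\<in>W. (of_bool (a = v) - of_bool (b = v)) * x (Inr v))"
      using fin by (simp add: I_def sum.Plus A_def)
    also have "(\<Sum>f\<in>F. (of_bool (face (a,b) = f) - of_bool (face (b,a) = f)) * x (Inl f))
      = rr x (a,b) - rr x (b,a)"
      using that * fin by (auto simp: left_diff_distrib sum_subtractf rr_def F_def of_bool_def if_distrib[of "\<lambda>u. u * _"] cong: if_cong)
    also have "(\<Sum>v\<in>W. (of_bool (a = v) - of_bool (b = v)) * x (Inr v)) = zz x a - zz x b"
      using * fin by (auto simp: left_diff_distrib sum_subtractf zz_def W_def of_bool_def if_distrib[of "\<lambda>u. u * _"] cong: if_cong)
    finally show ?thesis .
  qed
  have rr_next: "rr x (b, th a b) = rr x (a, b)" if "(a, b) \<in> D" for x a b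
    using face_eq[OF that] by (simp add: rr_def)
  have orth: "(\<Sum>(a,b)\<in>D. (rr x (a,b) - rr x (b,a)) * (\<zeta> a - \<zeta> b)) = 0" for x \<zeta>
  proof -
    have "(\<Sum>(a,b)\<in>D. rr x (b,a) * (\<zeta> a - \<zeta> b)) = (\<Sum>(a,b)\<in>D. rr x (a,b) * (\<zeta> b - \<zeta> a))"
      using sum_D_reverse[of "\<lambda>a b. rr x (a,b) * (\<zeta> b - \<zeta> a)"] by simp
    then show ?thesis
      using orthogonal_potentials[of "rr x" \<zeta>, OF rr_next] orthogonal_potentials[of "rr x" "\<lambda>a. - \<zeta> a", OF rr_next]
      by (simp add: left_diff_distrib sum_subtractf split_def)
  qed
  have inj: "\<forall>i\<in>I. x i = 0" if x: "\<And>h. h \<in> P \<Longrightarrow> (\<Sum>i\<in>I. A h i * x i) = 0" for x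
  proof -
    have eq0: "rr x (a,b) - rr x (b,a) + (zz x a - zz x b) = 0" if ab: "(a, b) \<in> D" for a b
    proof (cases "a < b")
      case True then show ?thesis using x[of "(a,b)"] ab A_eq[OF ab] by (simp add: P_def)
    next
      case False
      then have "b < a" using irrefl_D[OF ab] by simp
      then show ?thesis using x[of "(b,a)"] sym_D[OF ab] A_eq[OF sym_D[OF ab], of x] by (simp add: P_def)
    qed
    \<comment> \<open>The equation replaces one factor of the squared gradient by a face difference,
      and face differences are orthogonal to gradients; so the gradient of the vertex part is
      zero.\<close>
    have "(\<Sum>(a,b)\<in>D. (zz x a - zz x b) * (zz x a - zz x b)) =
          (\<Sum>(a,b)\<in>D. - ((rr x (a,b) - rr x (b,a)) * (zz x a - zz x b)))"
    proof (rule sum.cong)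
      fix h assume "h \<in> D"
      then obtain a b where h: "h = (a, b)" "(a, b) \<in> D" by (cases h) auto
      have e: "zz x a - zz x b = - (rr x (a,b) - rr x (b,a))" using eq0[OF h(2)] by simp
      then show "(case h of (a,b) \<Rightarrow> (zz x a - zz x b) * (zz x a - zz x b)) =
          (case h of (a,b) \<Rightarrow> - ((rr x (a,b) - rr x (b,a)) * (zz x a - zz x b)))"
        unfolding h by (simp del: minus_diff_eq add: e)
    qed simp
    also have "\<dots> = 0" using orth[of x "zz x"] by (simp add: sum_negf split_def)
    finally have z: "zz x a = zz x b" if "(a, b) \<in> D" for a b using gradient_zero that by blast
    then have "zz x v = 0" if "v \<in> V" for v
      using vertex_constant[of "zz x", OF z that v0] by (simp add: zz_def[of x v0])
    moreover have "rr x h = 0" if "h \<in> D" for h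
    proof -
      have "rr x h = rr x h0"
        using that h0
      proof (rule face_constant[rotated 2])
        show "rr x (a, b) = rr x (b, a)" if "(a, b) \<in> D" for a b
          using eq0[OF that] z[OF that] by simp
      qed (rule rr_next)
      then show ?thesis by (simp add: rr_def[of x h0])
    qed
    ultimately show ?thesis
      by (force simp: I_def F_def W_def zz_def rr_def split: if_splits)
  qed
  obtain x where x: "\<forall>h\<in>P. (\<Sum>i\<in>I. A h i * x i) = m (fst h) (snd h)"
    using injective_imp_solvable_on[OF fI fin(3) cI, of A "\<lambda>h. m (fst h) (snd h)"] inj by blast
  have meq: "m a b = rr x (a,b) - rr x (b,a) + (zz x a - zz x b)" if ab: "(a, b) \<in> D" for a b
  proof (cases "a < b")
    case True then show ?thesis using x ab A_eq[OF ab] by (force simp: P_def)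
  next
    case False
    then have "(b,a) \<in> P" using irrefl_D[OF ab] sym_D[OF ab] by (simp add: P_def)
    then show ?thesis using x A_eq[OF sym_D[OF ab], of x] anti[OF ab] by force
  qed
  \<comment> \<open>Having zero vertex sums, \<open>m\<close> is orthogonal to gradients too. The
    gradient part of the solution is then orthogonal to itself, and only the face part
    remains.\<close>
  have "(\<Sum>(a,b)\<in>D. m a b * zz x a) = 0"
    unfolding sum_D_nbs using coclosed by (simp flip: sum_distrib_right)
  moreover have "(\<Sum>(a,b)\<in>D. m a b * zz x b) = (\<Sum>(a,b)\<in>D. m b a * zz x a)"
    using sum_D_reverse[of "\<lambda>a b. m b a * zz x a"] by simp
  moreover have "(\<Sum>(a,b)\<in>D. m b a * zz x a) = (\<Sum>(a,b)\<in>D. - (m a b * zz x a))"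
    by (rule sum.cong) (auto simp: anti)
  ultimately have "(\<Sum>(a,b)\<in>D. m a b * (zz x a - zz x b)) = 0"
    by (simp add: right_diff_distrib sum_subtractf split_def sum_negf)
  moreover have "(\<Sum>(a,b)\<in>D. m a b * (zz x a - zz x b)) = (\<Sum>(a,b)\<in>D. (rr x (a,b) - rr x (b,a)) * (zz x a - zz x b))
     + (\<Sum>(a,b)\<in>D. (zz x a - zz x b) * (zz x a - zz x b))"
    unfolding sum.distrib[symmetric] by (rule sum.cong) (auto simp: meq algebra_simps)
  ultimately have "(\<Sum>(a,b)\<in>D. (zz x a - zz x b) * (zz x a - zz x b)) = 0" using orth by simp
  then have z: "zz x a = zz x b" if "(a, b) \<in> D" for a b using gradient_zero that by blast
  then show ?thesis using meq rr_next by (intro exI[of _ "rr x"]) auto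
qed


section \<open>Integral edge flows and their circulations around faces\<close>

definition circulation :: "(nat \<Rightarrow> nat \<Rightarrow> 'a::comm_ring_1) \<Rightarrow> nat \<Rightarrow> nat \<Rightarrow> 'a" where
  "circulation u a b = u a b + u b (th a b) + u (th a b) a"

text \<open>The face function written on darts as \<open>\<kappa>\<close> is the coboundary of an
  antisymmetric edge flow. The type \<open>int\<close> carries the integrality on which the
  unimodularity rests.\<close>

definition is_circulation :: "(nat \<times> nat \<Rightarrow> int) \<Rightarrow> bool" where
  "is_circulation \<kappa> \<longleftrightarrow> (\<exists>u. (\<forall>a b. u b a = - u a b) \<and> (\<forall>(a,b)\<in>D. circulation u a b = \<kappa> (a,b)))"

lemma circulation_next: "(a, b) \<in> D \<Longrightarrow> circulation u b (th a b) = circulation u a b"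
  by (simp add: circulation_def th_th th_th' add_ac)

lemma is_circulationI:
  assumes "\<And>a b. u b a = - u a b" "\<And>a b. (a,b) \<in> D \<Longrightarrow> circulation u a b = \<kappa> (a,b)"
  shows "is_circulation \<kappa>"
  unfolding is_circulation_def using assms by blast

lemma is_circulation_cong:
  assumes "is_circulation \<kappa>" "\<And>h. h \<in> D \<Longrightarrow> \<kappa> h = \<kappa>' h"
  shows "is_circulation \<kappa>'"
proof -
  obtain u where u: "\<And>a b. u b a = - u a b" "\<And>a b. (a,b) \<in> D \<Longrightarrow> circulation u a b = \<kappa> (a,b)"
    using assms(1) unfolding is_circulation_def by blast
  show ?thesis
    by (rule is_circulationI[of u]) (rule u(1), simp add: u(2) assms(2))
qed

lemma is_circulation_zero: "is_circulation (\<lambda>_. 0)"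
  by (rule is_circulationI[of "\<lambda>_ _. 0"]) (simp_all add: circulation_def)

lemma is_circulation_add:
  assumes "is_circulation \<kappa>" "is_circulation \<kappa>'"
  shows "is_circulation (\<lambda>h. \<kappa> h + \<kappa>' h)"
proof -
  obtain u where u: "\<And>a b. u b a = - u a b" "\<And>a b. (a,b) \<in> D \<Longrightarrow> circulation u a b = \<kappa> (a,b)"
    using assms(1) unfolding is_circulation_def by blast
  obtain u' where u': "\<And>a b. u' b a = - u' a b" "\<And>a b. (a,b) \<in> D \<Longrightarrow> circulation u' a b = \<kappa>' (a,b)"
    using assms(2) unfolding is_circulation_def by blast
  show ?thesis
  proof (rule is_circulationI[of "\<lambda>a b. u a b + u' a b"])
    show "u b a + u' b a = - (u a b + u' a b)" for a b
      using u(1)[of a b] u'(1)[of a b] by simp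
    show "circulation (\<lambda>a b. u a b + u' a b) a b = \<kappa> (a, b) + \<kappa>' (a, b)" if "(a,b) \<in> D" for a b
      using u(2)[OF that] u'(2)[OF that] by (simp add: circulation_def)
  qed
qed

lemma is_circulation_scale:
  assumes "is_circulation \<kappa>"
  shows "is_circulation (\<lambda>h. c * \<kappa> h)"
proof -
  obtain u where u: "\<And>a b. u b a = - u a b" "\<And>a b. (a,b) \<in> D \<Longrightarrow> circulation u a b = \<kappa> (a,b)"
    using assms unfolding is_circulation_def by blast
  show ?thesis
  proof (rule is_circulationI[of "\<lambda>a b. c * u a b"])
    show "c * u b a = - (c * u a b)" for a b
      using u(1)[of a b] by simp
    show "circulation (\<lambda>a b. c * u a b) a b = c * \<kappa> (a, b)" if "(a,b) \<in> D" for a b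
      using u(2)[OF that, symmetric] by (simp add: circulation_def distrib_left)
  qed
qed

lemma is_circulation_sum:
  "(\<And>i. i \<in> I \<Longrightarrow> is_circulation (\<kappa> i)) \<Longrightarrow> is_circulation (\<lambda>h. \<Sum>i\<in>I. \<kappa> i h)"
  by (induction I rule: infinite_finite_induct)
     (auto intro: is_circulation_zero is_circulation_add)

text \<open>A unit flow along the edge works: the three darts of a face are distinct, so the face of
  \<open>(a, b)\<close> sees the flow with +1 and the face of \<open>(b, a)\<close> sees it with
  -1.\<close>

lemma is_circulation_adjacent:
  assumes "(a, b) \<in> D"
  shows "is_circulation (\<lambda>h. of_bool (face (a,b) = face h) - of_bool (face (b,a) = face h))"
proof -
  define u :: "nat \<Rightarrow> nat \<Rightarrow> int" where
    "u c d = of_bool ((c,d) = (a,b)) - of_bool ((c,d) = (b,a))" for c d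
  have *: "of_bool ((c,d) = h) + of_bool ((d, th c d) = h) + of_bool ((th c d, c) = h)
      = (of_bool (face h = face (c,d)) :: int)" if "(c,d) \<in> D" "h \<in> D" for c d h
  proof -
    have "face h = face (c,d) \<longleftrightarrow> h = (c,d) \<or> h = (d, th c d) \<or> h = (th c d, c)"
      using mem_face_iff[OF that] by (simp add: face_def)
    moreover have "c \<noteq> d" "th c d \<noteq> c" "th c d \<noteq> d"
      using irrefl_D[OF that(1)] th_neq[OF that(1)] by auto
    ultimately show ?thesis by (cases h) (simp add: of_bool_def, blast)
  qed
  have "circulation u c d = of_bool (face (a,b) = face (c,d)) - of_bool (face (b,a) = face (c,d))"
    if "(c,d) \<in> D" for c d
    using *[OF that assms] *[OF that sym_D[OF assms]] unfolding circulation_def u_def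
    by linarith
  moreover have "u d c = - u c d" for c d by (simp add: u_def conj_commute)
  ultimately show ?thesis by (rule is_circulationI[rotated])
qed

text \<open>Unit flows across the successive edges of a path in the dual graph telescope, so a unit
  can be carried from one face to any other.\<close>

lemma is_circulation_two_faces:
  assumes "h0 \<in> D" "k \<in> D"
  shows "is_circulation (\<lambda>h. of_bool (face k = face h) - of_bool (face h0 = face h))"
proof -
  let ?R = "\<lambda>k. is_circulation (\<lambda>h. of_bool (face k = face h) - of_bool (face h0 = face h))"
  have "{k \<in> D. ?R k} = D"
  proof (rule face_connected)
    have "h0 \<in> {k \<in> D. ?R k}" using assms(1) is_circulation_zero by simp
    then show "{k \<in> D. ?R k} \<noteq> {}" by blast
    show "(b, a) \<in> {k \<in> D. ?R k}" if "(a, b) \<in> {k \<in> D. ?R k}" for a b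
      using that sym_D is_circulation_add[OF is_circulation_adjacent[of b a], of "\<lambda>h. of_bool (face (a,b) = face h) - of_bool (face h0 = face h)"]
      by simp
    show "(b, th a b) \<in> {k \<in> D. ?R k}" if "(a, b) \<in> {k \<in> D. ?R k}" for a b
      using that th_D face_eq by simp
  qed auto
  then have "k \<in> {k \<in> D. ?R k}" using assms(2) by (simp only:)
  then show ?thesis by simp
qed

text \<open>The total is the only obstruction: with total zero, \<open>\<kappa>\<close> is an
  integral combination of differences with the fixed face of \<open>h0\<close>.\<close>

lemma is_circulation_iff_sum_zero:
  assumes inv: "\<And>a b. (a, b) \<in> D \<Longrightarrow> \<kappa> (b, th a b) = \<kappa> (a, b)"
    and sum0: "(\<Sum>h\<in>D. \<kappa> h) = 0"
  shows "is_circulation \<kappa>"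
proof -
  obtain h0 where h0: "h0 \<in> D" using nonempty_D by blast
  have const: "\<kappa> k = \<kappa> h" if "h \<in> D" "k \<in> face h" for h k
    using that inv[of "fst h" "snd h"] inv[of "snd h" "th (fst h) (snd h)"] th_D th_th
    by (cases h) (auto simp: face_def)
  \<comment> \<open>\<open>\<kappa>\<close> is constant on faces, so every representative dart gives
    the same value.\<close>
  define \<kappa>' where "\<kappa>' f = \<kappa> (SOME h. h \<in> D \<and> face h = f)" for f
  have \<kappa>': "\<kappa>' (face h) = \<kappa> h" if "h \<in> D" for h
  proof -
    define k where "k = (SOME k. k \<in> D \<and> face k = face h)"
    have "k \<in> D \<and> face k = face h" unfolding k_def by (rule someI[of _ h]) (use that in simp)
    then have "k \<in> face h" using mem_face_iff that by simp
    then show ?thesis using const[OF that] unfolding \<kappa>'_def k_def by simp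
  qed
  have "(\<Sum>h\<in>D. \<kappa> h) = (\<Sum>f\<in>face ` D. 3 * \<kappa>' f)"
    unfolding sum_D_faces
  proof (rule sum.cong)
    fix f assume "f \<in> face ` D"
    then obtain h where h: "h \<in> D" "f = face h" by auto
    have "(\<Sum>k\<in>f. \<kappa> k) = (\<Sum>k\<in>f. \<kappa> h)" unfolding h(2) by (rule sum.cong) (auto simp: const[OF h(1)])
    then show "(\<Sum>k\<in>f. \<kappa> k) = 3 * \<kappa>' f" by (simp add: h card_face \<kappa>')
  qed simp
  then have s0: "(\<Sum>f\<in>face ` D. \<kappa>' f) = 0" unfolding sum0 using sum_distrib_left[of 3 \<kappa>' "face ` D"] by simp
  have circ: "is_circulation (\<lambda>h. \<Sum>f\<in>face ` D. \<kappa>' f * (of_bool (f = face h) - of_bool (face h0 = face h)))"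
    by (intro is_circulation_sum is_circulation_scale) (auto intro: is_circulation_two_faces[OF h0])
  have eq: "(\<Sum>f\<in>face ` D. \<kappa>' f * (of_bool (f = face h) - of_bool (face h0 = face h))) = \<kappa> h" if "h \<in> D" for h
  proof -
    have e1: "(\<Sum>f\<in>face ` D. \<kappa>' f * of_bool (f = face h)) = \<kappa> h"
    proof -
      have "(\<Sum>f\<in>face ` D. \<kappa>' f * of_bool (f = face h)) = (\<Sum>f\<in>face ` D. if f = face h then \<kappa>' f else 0)"
        by (rule sum.cong) auto
      also have "\<dots> = \<kappa>' (face h)" using that finite_D by simp
      finally show ?thesis using \<kappa>'[OF that] by simp
    qed
    have e2: "(\<Sum>f\<in>face ` D. \<kappa>' f * of_bool (face h0 = face h)) = 0"
      using sum_distrib_right[of \<kappa>' "face ` D" "of_bool (face h0 = face h)"] s0 by simp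
    show ?thesis unfolding right_diff_distrib sum_subtractf e1 e2 by simp
  qed
  show ?thesis by (rule is_circulation_cong[OF circ]) (rule eq)
qed

section \<open>The shear operator on edge functions\<close>

text \<open>Applied to the logarithmic edge lengths, this operator yields the logarithmic cross ratios
  (shear coordinates).\<close>

definition shear :: "(nat set \<Rightarrow> 'a::comm_ring_1) \<Rightarrow> nat \<Rightarrow> nat \<Rightarrow> 'a" where
  "shear y a b = y {b, th a b} - y {th a b, a} + y {a, th b a} - y {th b a, b}"

lemma shear_commute: "shear y b a = shear y a b"
  unfolding shear_def by (simp only: algebra_simps)

text \<open>An edge function \<open>x\<close> with vanishing vertex sums is distributed on the corners as \<open>g\<close> with
  vanishing face sums; each \<open>g\<close> is a difference of dart functions, and a face potential makes
  the latter a function of the edges.\<close>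

lemma shear_surjective:
  fixes x :: "nat set \<Rightarrow> int"
  assumes vsum: "\<And>v. v \<in> V \<Longrightarrow> (\<Sum>b\<in>nbs v. x {v,b}) = 0"
  shows "\<exists>y. \<forall>(a,b)\<in>D. shear y a b = x {a,b}"
proof -
  \<comment> \<open>The whole value of an edge is put on one of its two darts, because an even split
    would need halves.\<close>
  define k :: "nat \<Rightarrow> nat \<Rightarrow> int" where "k a b = (if a < b then x {a,b} else 0)" for a b
  have k: "k a b + k b a = x {a,b}" if "(a, b) \<in> D" for a b
    using irrefl_D[OF that] by (cases "a < b") (simp_all add: k_def insert_commute[of b a])
  have ksum: "(\<Sum>(a,b)\<in>D. k a b) = 0"
  proof -
    have "(\<Sum>(a,b)\<in>D. k a b) + (\<Sum>(a,b)\<in>D. k b a) = (\<Sum>(a,b)\<in>D. x {a,b})"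
      unfolding sum.distrib[symmetric] using k by (intro sum.cong) auto
    also have "\<dots> = 0" unfolding sum_D_nbs using vsum by simp
    finally show ?thesis using sum_D_reverse[of k] by simp
  qed
  \<comment> \<open>An antisymmetric \<open>u\<close> does not affect the edge sums of
    \<open>k\<close> and can be chosen to cancel its face sums; their total vanishes since the total
    of \<open>x\<close> over the darts does.\<close>
  have "is_circulation (\<lambda>(a,b). - circulation k a b)"
  proof (rule is_circulation_iff_sum_zero)
    have "(\<Sum>(a,b)\<in>D. circulation k a b) = (\<Sum>(a,b)\<in>D. k a b) + (\<Sum>(a,b)\<in>D. k b (th a b))
       + (\<Sum>(a,b)\<in>D. k (th a b) a)"
      by (simp add: circulation_def sum.distrib split_def)
    moreover have "(\<Sum>(a,b)\<in>D. k (th a b) a) = (\<Sum>(a,b)\<in>D. k (th b (th a b)) b)"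
      using sum_D_next[of "\<lambda>a b. k (th a b) a"] by simp
    moreover have "\<dots> = (\<Sum>(a,b)\<in>D. k a b)" by (rule sum.cong) (auto simp: th_th)
    ultimately have "(\<Sum>(a,b)\<in>D. circulation k a b) = 0"
      using sum_D_next[of k] ksum by linarith
    then show "(\<Sum>h\<in>D. case h of (a, b) \<Rightarrow> - circulation k a b) = 0"
      by (simp add: split_def sum_negf)
  qed (simp add: circulation_next)
  then obtain u where u1: "\<forall>a b. u b a = - u a b"
    and u2: "\<forall>(a,b)\<in>D. circulation u a b = (\<lambda>(a,b). - circulation k a b) (a,b)"
    unfolding is_circulation_def by blast
  have u: "u b a = - u a b" "(a, b) \<in> D \<Longrightarrow> circulation u a b = - circulation k a b" for a b
    using u1 bspec[OF u2, of "(a,b)"] by (blast, simp)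
  define g where "g a b = real_of_int (k a b + u a b)" for a b
  have g1: "g a b + g b a = of_int (x {a,b})" if "(a, b) \<in> D" for a b
    unfolding g_def k[OF that, symmetric] using u(1)[of a b] by simp
  have g2: "g a b + g b (th a b) + g (th a b) a = 0" if "(a, b) \<in> D" for a b
    unfolding g_def using u(2)[OF that] unfolding circulation_def by linarith
  \<comment> \<open>The solution of the difference equations on one face whose three values sum to
    zero. Division by 3 loses integrality, which \<open>y1_Ints\<close> recovers.\<close>
  define y0 where "y0 a b = (g (th a b) a - g b (th a b)) / 3" for a b
  have y0: "g a b = y0 b (th a b) - y0 (th a b) a" if "(a, b) \<in> D" for a b
  proof -
    have "y0 b (th a b) = (g a b - g (th a b) a) / 3" "y0 (th a b) a = (g b (th a b) - g a b) / 3"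
      by (simp_all add: y0_def th_th[OF that] th_th'[OF that])
    moreover have "g b (th a b) = - g a b - g (th a b) a" using g2[OF that] by simp
    ultimately show ?thesis by (simp add: field_simps)
  qed
  \<comment> \<open>The asymmetry of \<open>y0\<close> has zero vertex sums, hence is a difference
    of face potentials. Adding the potential makes \<open>y0\<close> symmetric and keeps the
    differences inside each face.\<close>
  have co: "(\<Sum>b\<in>nbs v. y0 b v - y0 v b) = 0" if v: "v \<in> V" for v
  proof -
    have "(\<Sum>b\<in>nbs v. y0 b v - y0 v b) = (\<Sum>b\<in>nbs v. y0 b v) - (\<Sum>b\<in>nbs v. y0 v b)"
      by (simp add: sum_subtractf)
    also have "(\<Sum>b\<in>nbs v. y0 b v) = (\<Sum>b\<in>nbs v. y0 (th v b) v)"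
      using sum_nbs_next[of "\<lambda>b. y0 b v" v] by simp
    also have "\<dots> - (\<Sum>b\<in>nbs v. y0 v b) = (\<Sum>b\<in>nbs v. g b (th v b))"
      unfolding sum_subtractf[symmetric]
      by (rule sum.cong) (auto simp: nbs_def y0[OF th_D] th_th)
    also have "\<dots> = (\<Sum>b\<in>nbs v. - g v b - g (th v b) v)"
    proof (rule sum.cong)
      fix b assume "b \<in> nbs v"
      then show "g b (th v b) = - g v b - g (th v b) v" using g2[of v b] by (simp add: nbs_def)
    qed simp
    also have "\<dots> = (\<Sum>b\<in>nbs v. - g v b) - (\<Sum>b\<in>nbs v. g b v)"
      using sum_nbs_next[of "\<lambda>b. g b v" v] by (simp add: sum_subtractf)
    also have "\<dots> = (\<Sum>b\<in>nbs v. - of_int (x {v,b}))"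
      unfolding sum_subtractf[symmetric]
    proof (rule sum.cong)
      fix b assume "b \<in> nbs v"
      then show "- g v b - g b v = - of_int (x {v,b})" using g1[of v b] by (simp add: nbs_def)
    qed simp
    also have "\<dots> = - of_int (\<Sum>b\<in>nbs v. x {v,b})" by (simp add: sum_negf)
    finally show ?thesis using vsum[OF v] by simp
  qed
  then have "\<exists>r. \<forall>(a,b)\<in>D. r (b, th a b) = r (a,b) \<and> y0 b a - y0 a b = r (a,b) - r (b,a)"
    by (intro face_potential_exists) simp_all
  then obtain r where r: "\<And>a b. (a,b) \<in> D \<Longrightarrow> r (b, th a b) = r (a,b)"
    "\<And>a b. (a,b) \<in> D \<Longrightarrow> y0 b a - y0 a b = r (a,b) - r (b,a)"
    by blast
  obtain a0 b0 where h0: "(a0,b0) \<in> D" using nonempty_D by auto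
  define y1 where "y1 a b = y0 a b + r (a,b) - (y0 a0 b0 + r (a0,b0))" for a b
  have y1_sym: "y1 a b = y1 b a" if "(a,b) \<in> D" for a b
    using r(2)[OF that] by (simp add: y1_def)
  have y1_g: "y1 b (th a b) - y1 (th a b) a = g a b" if "(a,b) \<in> D" for a b
    using r(1)[OF that] r(1)[OF th_D[OF that]] y0[OF that] th_th[OF that] by (simp add: y1_def)
  \<comment> \<open>\<open>y1\<close> vanishes at the dart \<open>(a0, b0)\<close> by its
    definition. Within a face its values differ by the integers \<open>g\<close>, across an edge
    they agree, and the faces are connected.\<close>
  have y1_Ints: "y1 a b \<in> \<int>" if "(a,b) \<in> D" for a b
  proof -
    let ?S = "{(a,b)\<in>D. y1 a b \<in> \<int>}"
    have g_Ints: "g a b \<in> \<int>" for a b by (simp add: g_def)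
    have "?S = D"
    proof (rule face_connected)
      have "(a0,b0) \<in> ?S" using h0 by (simp add: y1_def)
      then show "?S \<noteq> {}" by blast
      show "(b, a) \<in> ?S" if "(a, b) \<in> ?S" for a b
      proof -
        have "(a,b) \<in> D" "y1 a b \<in> \<int>" using that by auto
        then show ?thesis using y1_sym[of b a] sym_D[of a b] by simp
      qed
      show "(b, th a b) \<in> ?S" if "(a, b) \<in> ?S" for a b
      proof -
        have ab: "(a,b) \<in> D" using that by auto
        then have "(th a b, a) \<in> D" by (rule th_D')
        from y1_g[OF this] have "y1 a b - y1 b (th a b) = g (th a b) a"
          by (simp add: th_th'[OF ab])
        then have "y1 b (th a b) = y1 a b - g (th a b) a" by simp
        also have "\<dots> \<in> \<int>" using that g_Ints by (intro Ints_diff) auto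
        finally show ?thesis using th_D[OF ab] by simp
      qed
    qed auto
    with that have "(a,b) \<in> ?S" by (simp only:)
    then show ?thesis by simp
  qed
  define y where "y e = \<lfloor>y1 (Min e) (Max e)\<rfloor>" for e
  have y: "of_int (y {a,b}) = y1 a b" if "(a,b) \<in> D" for a b
  proof -
    have "y1 (Min {a,b}) (Max {a,b}) = y1 a b"
      using y1_sym[OF that] by (cases "a \<le> b") simp_all
    then show ?thesis using y1_Ints[OF that] by (simp add: y_def)
  qed
  have "shear y a b = x {a,b}" if ab: "(a,b) \<in> D" for a b
  proof -
    have "real_of_int (shear y a b) = g a b + g b a"
      using y1_g[OF ab] y1_g[OF sym_D[OF ab]] y[OF th_D[OF ab]] y[OF th_D'[OF ab]]
        y[OF th_D[OF sym_D[OF ab]]] y[OF th_D'[OF sym_D[OF ab]]]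
      unfolding shear_def by (simp only: algebra_simps)
    then show ?thesis using g1[OF ab] by linarith
  qed
  then show ?thesis by blast
qed

text \<open>The converse of \<open>shear_surjective\<close>: as \<open>b\<close> runs around
  \<open>v\<close>, each edge at \<open>v\<close> and each edge opposite to \<open>v\<close> in a
  face occurs once with either sign.\<close>

lemma vertex_sum_shear: "(\<Sum>b\<in>nbs v. shear y v b) = 0"
proof -
  have th_inv: "th v (th b v) = b" if "b \<in> nbs v" for b
    using th_th[of b v] sym_D[of v b] that by (simp add: nbs_def)
  have nb': "(\<Sum>b\<in>nbs v. f (th b v)) = (\<Sum>b\<in>nbs v. f b)" for f :: "nat \<Rightarrow> 'a"
    proof -
    have "(\<Sum>b\<in>nbs v. f (th b v)) = (\<Sum>b\<in>nbs v. f (th (th v b) v))"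
      by (rule sum_nbs_next[of "\<lambda>b. f (th b v)" v, symmetric])
    also have "\<dots> = (\<Sum>b\<in>nbs v. f b)" by (rule sum.cong) (auto simp: nbs_def th_th')
    finally show ?thesis .
  qed
  note nb'_pair = nb'[of "\<lambda>c. y {v, c}"]
  have "(\<Sum>b\<in>nbs v. y {th b v, b}) = (\<Sum>b\<in>nbs v. y {th b v, th v (th b v)})"
    by (rule sum.cong) (auto simp: th_inv)
  also have "\<dots> = (\<Sum>b\<in>nbs v. y {b, th v b})" by (rule nb')
  finally have "(\<Sum>b\<in>nbs v. y {th b v, b}) = (\<Sum>b\<in>nbs v. y {b, th v b})" .
  moreover have "(\<Sum>b\<in>nbs v. y {v, th b v}) = (\<Sum>b\<in>nbs v. y {b, v})"
    unfolding nb'_pair by (rule sum.cong) (simp_all add: insert_commute)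
  moreover have "(\<Sum>b\<in>nbs v. y {th v b, v}) = (\<Sum>b\<in>nbs v. y {b, v})"
    by (rule sum_nbs_next)
  moreover have "(\<Sum>b\<in>nbs v. shear y v b) = (\<Sum>b\<in>nbs v. y {b, th v b}) - (\<Sum>b\<in>nbs v. y {th v b, v})
      + (\<Sum>b\<in>nbs v. y {v, th b v}) - (\<Sum>b\<in>nbs v. y {th b v, b})"
    by (simp only: shear_def sum.distrib sum_subtractf)
  ultimately show ?thesis by simp
qed

text \<open>At each of the four vertices around the edge, \<open>\<zeta>\<close> enters once with
  either sign. For logarithmic lengths this is the invariance of cross ratios under vertex
  scalings.\<close>

lemma shear_incidence:
  assumes "(a, b) \<in> D" "\<And>c d. (c, d) \<in> D \<Longrightarrow> y {c, d} = \<zeta> c + \<zeta> d"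
  shows "shear y a b = 0"
proof -
  have *: "(b, th a b) \<in> D" "(th a b, a) \<in> D" "(a, th b a) \<in> D" "(th b a, b) \<in> D"
    by (rule th_D th_D' th_D[OF sym_D] th_D'[OF sym_D], rule assms(1))+
  show ?thesis unfolding shear_def *[THEN assms(2)] by (simp add: algebra_simps)
qed

end

section \<open>Complements of cycle-rooted spanning trees with odd cycle\<close>

context dart_map begin

lemma shear_add: "shear (\<lambda>e. x e + y e) a b = shear x a b + shear y a b"
  by (simp add: shear_def algebra_simps)

lemma shear_of_int: "shear (\<lambda>e. of_int (y e)) a b = of_int (shear y a b)"
  by (simp add: shear_def)

lemma sum_nbs_edges: "(\<Sum>b\<in>nbs v. x {v, b}) = (\<Sum>e\<in>{e\<in>edge_set. v \<in> e}. x e)"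
proof (rule sum.reindex_bij_betw)
  show "bij_betw (\<lambda>b. {v, b}) (nbs v) {e \<in> edge_set. v \<in> e}"
    unfolding bij_betw_def
  proof
    show "inj_on (\<lambda>b. {v, b}) (nbs v)" by (auto simp: inj_on_def doubleton_eq_iff)
    show "(\<lambda>b. {v, b}) ` nbs v = {e \<in> edge_set. v \<in> e}"
    proof (intro equalityI subsetI)
      fix e assume "e \<in> {e \<in> edge_set. v \<in> e}"
      then obtain a b where ab: "e = {a, b}" "(a, b) \<in> D" "v = a \<or> v = b" by (auto simp: edge_set_def)
      from ab(3) show "e \<in> (\<lambda>b. {v, b}) ` nbs v"
      proof
        assume "v = a" then show ?thesis using ab by (auto simp: nbs_def)
      next
        assume "v = b"
        then have "e = {v, a}" "a \<in> nbs v" using ab sym_D[OF ab(2)] by (auto simp: nbs_def)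
        then show ?thesis by blast
      qed
    qed (auto simp: edge_set_def nbs_def)
  qed
qed

lemma finite_edge_set: "finite edge_set"
proof -
  have "edge_set = (\<lambda>(a,b). {a,b}) ` D" by (auto simp: edge_set_def)
  then show ?thesis using finite_D by simp
qed

end

locale dart_map_crst = dart_map +
  fixes C :: "nat set set"
  assumes C_edges: "C \<subseteq> edge_set" and card_C: "card C = card V"
    and C_connected: "\<And>a b. a \<in> V \<Longrightarrow> b \<in> V \<Longrightarrow> (a, b) \<in> (adj_rel C)\<^sup>*"
    and C_odd: "has_odd_cycle C"
begin

lemma finite_C: "finite C"
  using C_edges finite_edge_set finite_subset by blast

lemma C_D: "{a, b} \<in> C \<Longrightarrow> (a, b) \<in> D"
proof -
  assume "{a, b} \<in> C"
  then obtain c d where "{a, b} = {c, d}" "(c, d) \<in> D" using C_edges unfolding edge_set_def by blast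
  then show "(a, b) \<in> D" using sym_D[of c d] by (auto simp: doubleton_eq_iff)
qed

text \<open>The image of the unsigned incidence map from integral weights on \<open>C\<close> to
  functions on \<open>V\<close>. With an odd cycle it is the lattice of functions with even sum; the
  generators of that lattice are produced below.\<close>

definition in_incidence_image :: "(nat \<Rightarrow> int) \<Rightarrow> bool" where
  "in_incidence_image b \<longleftrightarrow> (\<exists>c. \<forall>v\<in>V. (\<Sum>e\<in>C. of_bool (v \<in> e) * c e) = b v)"

lemma incidence_image_add:
  assumes "in_incidence_image b" "in_incidence_image b'"
  shows "in_incidence_image (\<lambda>v. b v + b' v)"
proof -
  obtain c c' where "\<forall>v\<in>V. (\<Sum>e\<in>C. of_bool (v \<in> e) * c e) = b v"
    "\<forall>v\<in>V. (\<Sum>e\<in>C. of_bool (v \<in> e) * c' e) = b' v"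
    using assms unfolding in_incidence_image_def by blast
  then have "\<forall>v\<in>V. (\<Sum>e\<in>C. of_bool (v \<in> e) * (c e + c' e)) = b v + b' v"
    by (simp add: distrib_left sum.distrib)
  then show ?thesis unfolding in_incidence_image_def by (rule exI[of _ "\<lambda>e. c e + c' e"])
qed

lemma incidence_image_uminus:
  assumes "in_incidence_image b"
  shows "in_incidence_image (\<lambda>v. - b v)"
proof -
  obtain c where "\<forall>v\<in>V. (\<Sum>e\<in>C. of_bool (v \<in> e) * c e) = b v"
    using assms unfolding in_incidence_image_def by blast
  then have "\<forall>v\<in>V. (\<Sum>e\<in>C. of_bool (v \<in> e) * (- c e)) = - b v"
    by (simp add: sum_negf)
  then show ?thesis unfolding in_incidence_image_def by (rule exI[of _ "\<lambda>e. - c e"])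
qed

lemma incidence_image_edge:
  assumes "{p, q} \<in> C"
  shows "in_incidence_image (\<lambda>v. of_bool (v = p) + of_bool (v = q))"
proof -
  have "p \<noteq> q" using irrefl_D C_D assms by blast
  have "(\<Sum>e\<in>C. of_bool (v \<in> e) * of_bool (e = {p,q})) = (of_bool (v = p) + of_bool (v = q) :: int)" for v
  proof -
    have "(\<Sum>e\<in>C. of_bool (v \<in> e) * of_bool (e = {p,q})) = (\<Sum>e\<in>C. if e = {p,q} then of_bool (v \<in> {p,q}) else (0::int))"
      by (rule sum.cong) auto
    also have "\<dots> = of_bool (v \<in> {p,q})" using assms finite_C by simp
    finally show ?thesis using \<open>p \<noteq> q\<close> by auto
  qed
  then show ?thesis unfolding in_incidence_image_def by (intro exI[of _ "\<lambda>e. of_bool (e = {p,q})"]) simp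
qed

text \<open>The alternating sum of the edges of a walk telescopes; the parity of its length decides
  the sign at the far end.\<close>

lemma incidence_image_path:
  assumes "(p, q) \<in> (adj_rel C)\<^sup>*"
  shows "in_incidence_image (\<lambda>v. of_bool (v = p) + of_bool (v = q)) \<or>
         in_incidence_image (\<lambda>v. of_bool (v = p) - of_bool (v = q))"
  using assms
proof (induction rule: rtrancl_induct)
  case base
  have "in_incidence_image (\<lambda>v. 0)" unfolding in_incidence_image_def by (rule exI[of _ "\<lambda>_. 0"]) simp
  then show ?case by simp
next
  case (step q r)
  have e: "in_incidence_image (\<lambda>v. of_bool (v = q) + of_bool (v = r))"
    using incidence_image_edge step.hyps(2) by (simp add: adj_rel_def)
  from step.IH show ?case
  proof
    assume "in_incidence_image (\<lambda>v. of_bool (v = p) + of_bool (v = q))"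
    from incidence_image_add[OF this incidence_image_uminus[OF e]] show ?thesis by simp
  next
    assume "in_incidence_image (\<lambda>v. of_bool (v = p) - of_bool (v = q))"
    from incidence_image_add[OF this e] show ?thesis by simp
  qed
qed

text \<open>Walking once around the odd cycle returns to the start with the sign that adds up
  instead of cancelling. This is the only use of oddness.\<close>

lemma incidence_image_cycle_vertex:
  "\<exists>p\<in>V. in_incidence_image (\<lambda>v. 2 * of_bool (v = p))"
proof -
  obtain vs where vs: "length vs \<ge> 3" "\<And>i. i < length vs \<Longrightarrow> {vs ! i, vs ! ((i + 1) mod length vs)} \<in> C"
    "odd (length vs)"
    using C_odd by (auto simp: has_odd_cycle_def is_cycle_def)
  define n where "n = length vs"
  define p where "p i = vs ! (i mod n)" for i
  have n: "n \<ge> 3" "odd n" using vs by (auto simp: n_def)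
  have edge: "{p i, p (Suc i)} \<in> C" for i
  proof -
    have "i mod n < n" using n by simp
    then show ?thesis using vs(2)[of "i mod n"] by (simp add: p_def n_def mod_Suc_eq)
  qed
  have alt: "in_incidence_image (\<lambda>v. of_bool (v = p 0) - (-1) ^ i * of_bool (v = p i))" for i
  proof (induction i)
    case 0
    have "in_incidence_image (\<lambda>v. 0)" unfolding in_incidence_image_def by (rule exI[of _ "\<lambda>_. 0"]) simp
    then show ?case by simp
  next
    case (Suc i)
    note e = incidence_image_edge[OF edge[of i]]
    show ?case
    proof (cases "even i")
      case True
      then show ?thesis using incidence_image_add[OF Suc e] by simp
    next
      case False
      then show ?thesis using incidence_image_add[OF Suc incidence_image_uminus[OF e]] by simp
    qed
  qed
  have "p n = p 0" by (simp add: p_def)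
  then have "in_incidence_image (\<lambda>v. 2 * of_bool (v = p 0))" using alt[of n] n(2) by simp
  moreover have "p 0 \<in> V" using C_D[OF edge[of 0]] D_V by auto
  ultimately show ?thesis by blast
qed

text \<open>Twice the combination for a path from \<open>q\<close> to \<open>p\<close> leaves an
  error of twice the indicator of \<open>p\<close>, which the cycle vertex corrects.\<close>

lemma incidence_image_double:
  assumes "q \<in> V"
  shows "in_incidence_image (\<lambda>v. 2 * of_bool (v = q))"
proof -
  obtain p where p: "p \<in> V" "in_incidence_image (\<lambda>v. 2 * of_bool (v = p))"
    using incidence_image_cycle_vertex by blast
  from incidence_image_path[OF C_connected[OF assms p(1)]] show ?thesis
  proof
    assume a: "in_incidence_image (\<lambda>v. of_bool (v = q) + of_bool (v = p))"
    from incidence_image_add[OF incidence_image_add[OF a a] incidence_image_uminus[OF p(2)]]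
    show ?thesis by simp
  next
    assume a: "in_incidence_image (\<lambda>v. of_bool (v = q) - of_bool (v = p))"
    from incidence_image_add[OF incidence_image_add[OF a a] p(2)]
    show ?thesis by simp
  qed
qed

text \<open>If the path yields the difference of the indicators, adding twice the indicator of
  \<open>q\<close> changes the sign.\<close>

lemma incidence_image_pair:
  assumes "p \<in> V" "q \<in> V"
  shows "in_incidence_image (\<lambda>v. of_bool (v = p) + of_bool (v = q))"
  using incidence_image_path[OF C_connected[OF assms]]
proof
  assume a: "in_incidence_image (\<lambda>v. of_bool (v = p) - of_bool (v = q))"
  from incidence_image_add[OF this incidence_image_double[OF assms(2)]]
  show ?thesis by (simp add: add.commute)
qed

text \<open>Half-integrality of the inverse incidence matrix \<open>X\<close> with integral pair sums is what makes
  the normalised edge functions below integral.\<close>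

lemma incidence_inverse:
  obtains X :: "nat set \<Rightarrow> nat \<Rightarrow> real"
  where "\<And>e a b. e \<in> C \<Longrightarrow> {a, b} \<in> C \<Longrightarrow> X e a + X e b = of_bool (e = {a, b})"
    and "\<And>e p q. e \<in> C \<Longrightarrow> p \<in> V \<Longrightarrow> q \<in> V \<Longrightarrow> X e p + X e q \<in> \<int>"
proof -
  have "\<forall>q\<in>V. \<exists>c::nat set \<Rightarrow> int. \<forall>v\<in>V. (\<Sum>e\<in>C. of_bool (v \<in> e) * c e) = 2 * of_bool (v = q)"
    using incidence_image_double unfolding in_incidence_image_def by blast
  then obtain c :: "nat \<Rightarrow> nat set \<Rightarrow> int"
    where c: "\<And>q v. q \<in> V \<Longrightarrow> v \<in> V \<Longrightarrow> (\<Sum>e\<in>C. of_bool (v \<in> e) * c q e) = 2 * of_bool (v = q)"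
    by metis
  define X where "X e q = real_of_int (c q e) / 2" for e q
  have right: "(\<Sum>e\<in>C. of_bool (v \<in> e) * X e q) = (if v = q then 1 else 0)" if "v \<in> V" "q \<in> V" for v q
  proof -
    have "(\<Sum>e\<in>C. of_bool (v \<in> e) * X e q) = of_int (\<Sum>e\<in>C. of_bool (v \<in> e) * c q e) / 2"
      by (simp add: X_def sum_divide_distrib)
    then show ?thesis using c[OF that(2,1)] by simp
  qed
  have left: "(\<Sum>v\<in>V. X e v * of_bool (v \<in> e')) = (if e = e' then 1 else 0)" if "e \<in> C" "e' \<in> C" for e e'
    using right_inverse_imp_left_inverse_on[OF finite_C finite_V card_C right that] by simp
  have left': "X e a + X e b = of_bool (e = {a, b})" if "e \<in> C" "{a, b} \<in> C" for e a b
  proof -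
    have ab: "a \<noteq> b" "a \<in> V" "b \<in> V" using C_D[OF that(2)] irrefl_D D_V by blast+
    have "(\<Sum>v\<in>V. X e v * of_bool (v \<in> {a,b})) = (\<Sum>v\<in>V. if v \<in> {a,b} then X e v else 0)"
      by (rule sum.cong) auto
    also have "\<dots> = (\<Sum>v\<in>V \<inter> {a,b}. X e v)" using finite_V by (simp add: sum.inter_restrict)
    also have "V \<inter> {a,b} = {a,b}" using ab by auto
    finally show ?thesis using left[OF that] ab by simp
  qed
  moreover have "X e p + X e q \<in> \<int>" if eC: "e \<in> C" and pq: "p \<in> V" "q \<in> V" for e p q
  proof -
    obtain w :: "nat set \<Rightarrow> int" where w: "\<And>v. v \<in> V \<Longrightarrow> (\<Sum>e\<in>C. of_bool (v \<in> e) * w e) = of_bool (v = p) + of_bool (v = q)"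
      using incidence_image_pair[OF pq] unfolding in_incidence_image_def by blast
    \<comment> \<open>Applied to the vertex sums of an integral \<open>w\<close>, the left inverse
      returns the entry \<open>w e\<close>; for these vertex sums it also returns the pair sum,
      which is therefore an integer.\<close>
    have "(\<Sum>v\<in>V. X e v * (\<Sum>e'\<in>C. of_bool (v \<in> e') * real_of_int (w e'))) =
          (\<Sum>v\<in>V. X e v * (of_bool (v = p) + of_bool (v = q)))"
    proof (rule sum.cong)
      fix v assume "v \<in> V"
      have "(\<Sum>e'\<in>C. of_bool (v \<in> e') * real_of_int (w e')) = of_int (\<Sum>e'\<in>C. of_bool (v \<in> e') * w e')"
        by simp
      also have "\<dots> = of_bool (v = p) + of_bool (v = q)" unfolding w[OF \<open>v \<in> V\<close>] by simp
      finally show "X e v * (\<Sum>e'\<in>C. of_bool (v \<in> e') * real_of_int (w e')) = X e v * (of_bool (v = p) + of_bool (v = q))"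
        by simp
    qed simp
    also have "\<dots> = (\<Sum>v\<in>V. if v = p then X e v else 0) + (\<Sum>v\<in>V. if v = q then X e v else 0)"
      unfolding sum.distrib[symmetric] by (rule sum.cong) auto
    also have "\<dots> = X e p + X e q" using that finite_V by simp
    finally have "X e p + X e q = (\<Sum>v\<in>V. \<Sum>e'\<in>C. X e v * of_bool (v \<in> e') * real_of_int (w e'))"
      by (simp add: sum_distrib_left mult.assoc)
    also have "\<dots> = (\<Sum>e'\<in>C. (\<Sum>v\<in>V. X e v * of_bool (v \<in> e')) * real_of_int (w e'))"
      unfolding sum_distrib_right by (rule sum.swap)
    also have "\<dots> = (\<Sum>e'\<in>C. if e' = e then real_of_int (w e') else 0)"
      by (rule sum.cong) (auto simp: left[OF that(1)])
    also have "\<dots> = real_of_int (w e)" using that finite_C by simp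
    finally show ?thesis by simp
  qed
  ultimately show ?thesis using that by blast
qed

section \<open>Edge functions modulo vertex potentials\<close>

lemma shear_congruent:
  assumes "\<And>c d. (c, d) \<in> D \<Longrightarrow> y {c, d} = x {c, d} + (\<zeta> c + \<zeta> d)" "(a, b) \<in> D"
  shows "shear y a b = shear x a b"
proof -
  have "shear (\<lambda>e. y e - x e) a b = 0"
    by (rule shear_incidence[OF assms(2), where \<zeta> = \<zeta>]) (simp add: assms(1))
  moreover have "shear y a b = shear (\<lambda>e. x e + (y e - x e)) a b" by simp
  ultimately show ?thesis unfolding shear_add by simp
qed

text \<open>The equations \<zeta>_a + \<zeta>_b = - L_ab on \<open>C\<close> are solved by the
  inverse incidence matrix. Away from \<open>C\<close> only the sums \<zeta>_a + \<zeta>_b matter,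
  and these are integral combinations of the values on \<open>C\<close>, although \<zeta> itself may
  be half-integral.\<close>

lemma normalise_edge_function:
  fixes L :: "nat set \<Rightarrow> 'a::real_field"
  obtains L' \<zeta> where "\<And>e. e \<in> C \<Longrightarrow> L' e = 0"
    and "\<And>a b. (a, b) \<in> D \<Longrightarrow> L' {a, b} = L {a, b} + (\<zeta> a + \<zeta> b)"
    and "\<And>a b. \<forall>e\<in>C. L e \<in> \<int> \<Longrightarrow> (a, b) \<in> D \<Longrightarrow> \<zeta> a + \<zeta> b \<in> \<int>"
proof -
  obtain X :: "nat set \<Rightarrow> nat \<Rightarrow> real"
    where X: "\<And>e a b. e \<in> C \<Longrightarrow> {a, b} \<in> C \<Longrightarrow> X e a + X e b = of_bool (e = {a, b})"
      and XZ: "\<And>e p q. e \<in> C \<Longrightarrow> p \<in> V \<Longrightarrow> q \<in> V \<Longrightarrow> X e p + X e q \<in> \<int>"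
    by (rule incidence_inverse) blast
  define \<zeta> :: "nat \<Rightarrow> 'a" where "\<zeta> p = - (\<Sum>e\<in>C. of_real (X e p) * L e)" for p
  have pair: "\<zeta> a + \<zeta> b = - (\<Sum>e\<in>C. of_real (X e a + X e b) * L e)" for a b
    by (simp add: \<zeta>_def distrib_right sum.distrib)
  define L' where "L' e = L e + (\<zeta> (Min e) + \<zeta> (Max e))" for e
  have L': "L' {a, b} = L {a, b} + (\<zeta> a + \<zeta> b)" for a b
    by (cases "a \<le> b") (simp_all add: L'_def add.commute)
  show ?thesis
  proof (rule that[of L' \<zeta>])
    fix e assume e: "e \<in> C"
    then obtain a b where ab: "e = {a, b}" using C_edges by (auto simp: edge_set_def)
    have "\<zeta> a + \<zeta> b = - (\<Sum>e'\<in>C. if e' = e then L e' else 0)"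
      unfolding pair using e by (intro arg_cong[where f = uminus] sum.cong) (auto simp: X ab)
    also have "\<dots> = - L e" using e finite_C by simp
    finally show "L' e = 0" unfolding ab L' by simp
  next
    fix a b assume Z: "\<forall>e\<in>C. L e \<in> \<int>" and "(a, b) \<in> D"
    then have "a \<in> V" "b \<in> V" using D_V by auto
    show "\<zeta> a + \<zeta> b \<in> \<int>"
      unfolding pair
    proof (intro Ints_minus Ints_sum Ints_mult Z[rule_format])
      fix e assume "e \<in> C"
      then have "X e a + X e b \<in> \<int>" using XZ \<open>a \<in> V\<close> \<open>b \<in> V\<close> by blast
      then show "of_real (X e a + X e b) \<in> (\<int> :: 'a set)" by (metis Ints_cases Ints_of_int of_real_of_int_eq)
    qed
  qed (rule L')
qed

text \<open>Gives the columns of an integral inverse of the minor. The unit at \<open>e0\<close> is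
  extended over \<open>C\<close> so that all vertex sums vanish, pulled back under shear, and
  normalised on \<open>C\<close>; the last operation changes neither shear nor integrality.\<close>

lemma shear_unit_preimage:
  assumes e0: "e0 \<in> edge_set - C"
  obtains y :: "nat set \<Rightarrow> int" where "\<And>e. e \<in> C \<Longrightarrow> y e = 0"
    and "\<And>a b. (a, b) \<in> D \<Longrightarrow> {a, b} \<notin> C \<Longrightarrow> shear y a b = of_bool ({a, b} = e0)"
proof -
  obtain p q where pq: "e0 = {p, q}" "(p, q) \<in> D" using e0 by (auto simp: edge_set_def)
  then have pq': "p \<noteq> q" "p \<in> V" "q \<in> V" using irrefl_D D_V by blast+
  obtain w :: "nat set \<Rightarrow> int" where w: "\<And>v. v \<in> V \<Longrightarrow> (\<Sum>e\<in>C. of_bool (v \<in> e) * w e) = of_bool (v = p) + of_bool (v = q)"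
    using incidence_image_pair[OF pq'(2,3)] unfolding in_incidence_image_def by blast
  \<comment> \<open>The weights \<open>w\<close> on \<open>C\<close> have the same vertex sums as
    the single edge \<open>e0\<close>, so the sign makes them cancel.\<close>
  define x where "x e = (if e \<in> C then - w e else of_bool (e = e0))" for e
  have "(\<Sum>b\<in>nbs v. x {v, b}) = 0" if v: "v \<in> V" for v
  proof -
    have "(\<Sum>b\<in>nbs v. x {v, b}) = (\<Sum>e\<in>edge_set. of_bool (v \<in> e) * x e)"
      unfolding sum_nbs_edges using finite_edge_set by (simp add: sum.inter_filter of_bool_def if_distrib[of "\<lambda>t. t * _"] cong: if_cong)
    also have "\<dots> = (\<Sum>e\<in>C. of_bool (v \<in> e) * x e) + (\<Sum>e\<in>edge_set - C. of_bool (v \<in> e) * x e)"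
      using sum.subset_diff[OF C_edges finite_edge_set, of "\<lambda>e. of_bool (v \<in> e) * x e"] by simp
    also have "(\<Sum>e\<in>C. of_bool (v \<in> e) * x e) = (\<Sum>e\<in>C. - (of_bool (v \<in> e) * w e))"
      by (rule sum.cong) (auto simp: x_def)
    also have "\<dots> = - (of_bool (v = p) + of_bool (v = q))" unfolding sum_negf w[OF v] ..
    also have "(\<Sum>e\<in>edge_set - C. of_bool (v \<in> e) * x e) = (\<Sum>e\<in>edge_set - C. if e = e0 then of_bool (v \<in> e0) else 0)"
      by (rule sum.cong) (auto simp: x_def)
    also have "\<dots> = of_bool (v \<in> e0)" using e0 finite_edge_set by simp
    finally show ?thesis using pq'(1) by (auto simp: pq)
  qed
  then obtain y0 where y0: "\<And>a b. (a, b) \<in> D \<Longrightarrow> shear y0 a b = x {a, b}"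
    using shear_surjective[of x] by blast
  obtain y1 \<zeta> where y1: "\<And>e. e \<in> C \<Longrightarrow> y1 e = (0::real)"
    "\<And>a b. (a, b) \<in> D \<Longrightarrow> y1 {a, b} = real_of_int (y0 {a, b}) + (\<zeta> a + \<zeta> b)"
    "\<And>a b. (a, b) \<in> D \<Longrightarrow> \<zeta> a + \<zeta> b \<in> \<int>"
  proof (rule normalise_edge_function[of "\<lambda>e. real_of_int (y0 e)"])
    fix L' \<zeta> assume "\<And>e. e \<in> C \<Longrightarrow> L' e = (0::real)"
      "\<And>a b. (a, b) \<in> D \<Longrightarrow> L' {a, b} = real_of_int (y0 {a, b}) + (\<zeta> a + \<zeta> b)"
      "\<And>a b. \<forall>e\<in>C. real_of_int (y0 e) \<in> \<int> \<Longrightarrow> (a, b) \<in> D \<Longrightarrow> \<zeta> a + \<zeta> b \<in> \<int>"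
    then show thesis by (intro that[of L' \<zeta>]) simp_all
  qed
  \<comment> \<open>Normalisation takes place over the reals; the values are integers, and floors
    return them to type \<open>int\<close>.\<close>
  have y1Z: "real_of_int \<lfloor>y1 {a, b}\<rfloor> = y1 {a, b}" if "(a, b) \<in> D" for a b
  proof -
    have "y1 {a, b} \<in> \<int>" unfolding y1(2)[OF that] by (rule Ints_add[OF Ints_of_int y1(3)[OF that]])
    then show ?thesis by simp
  qed
  show ?thesis
  proof (rule that[of "\<lambda>e. \<lfloor>y1 e\<rfloor>"])
    show "\<lfloor>y1 e\<rfloor> = 0" if "e \<in> C" for e using y1(1)[OF that] by simp
    show "shear (\<lambda>e. \<lfloor>y1 e\<rfloor>) a b = of_bool ({a, b} = e0)" if "(a, b) \<in> D" "{a, b} \<notin> C" for a b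
    proof -
      have "real_of_int (shear (\<lambda>e. \<lfloor>y1 e\<rfloor>) a b) = shear (\<lambda>e. real_of_int \<lfloor>y1 e\<rfloor>) a b"
        by (simp only: shear_of_int)
      also have "\<dots> = shear (\<lambda>e. real_of_int (y0 e)) a b"
        by (rule shear_congruent[OF _ that(1), where \<zeta> = \<zeta>]) (simp only: y1Z, rule y1(2))
      also have "\<dots> = real_of_int (x {a, b})" unfolding shear_of_int y0[OF that(1)] ..
      finally have "shear (\<lambda>e. \<lfloor>y1 e\<rfloor>) a b = x {a, b}" by (simp only: of_int_eq_iff)
      then show ?thesis using that(2) by (simp only: x_def if_False)
    qed
  qed
qed

end

section \<open>Determinants\<close>

text \<open>Pairing an eigenvector with its eigenvalue equation exhibits the eigenvalue of the
  Hermitian form as a quotient of sums of squares with nonnegative weights. The determinant is the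
  product of these eigenvalues with multiplicity.\<close>

lemma det_gram_nonneg:
  fixes s :: "'t \<Rightarrow> nat \<Rightarrow> complex" and g :: "'t \<Rightarrow> real" and n :: nat
  assumes "finite T" and g: "\<And>t. t \<in> T \<Longrightarrow> g t \<ge> 0"
  defines "A \<equiv> mat n n (\<lambda>(i,j). \<Sum>t\<in>T. of_real (g t) * s t i * cnj (s t j))"
  shows "\<exists>r\<ge>0. det A = of_real r"
proof -
  \<comment> \<open>The negative is taken so that the characteristic polynomial at 0 is
    \<open>det A\<close> itself, with no sign depending on n.\<close>
  define M where "M = - A"
  have M: "M \<in> carrier_mat n n" by (simp add: M_def A_def)
  obtain as where as: "char_poly M = (\<Prod>a\<leftarrow>as. [:- a, 1:])"
    using char_poly_factorized[OF M] by blast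
  have eig: "\<exists>r\<ge>0. - a = of_real r" if "a \<in> set as" for a
  proof -
    have "poly (char_poly M) a = 0"
      using that unfolding as poly_prod_list by (auto simp: prod_list_zero_iff)
    then obtain v where v: "v \<in> carrier_vec n" "v \<noteq> 0\<^sub>v n" "M *\<^sub>v v = a \<cdot>\<^sub>v v"
      using eigenvalue_root_char_poly[OF M, of a] M by (auto simp: eigenvalue_def eigenvector_def)
    define q where "q t = (\<Sum>j<n. cnj (s t j) * v $ j)" for t
    have row: "a * v $ i = - (\<Sum>t\<in>T. of_real (g t) * s t i * q t)" if "i < n" for i
    proof -
      have "a * v $ i = (M *\<^sub>v v) $ i" using v that by simp
      also have "\<dots> = - (\<Sum>j<n. \<Sum>t\<in>T. of_real (g t) * s t i * cnj (s t j) * v $ j)"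
        using v(1) that by (simp add: M_def A_def scalar_prod_def lessThan_atLeast0 sum_negf sum_distrib_right)
      also have "\<dots> = - (\<Sum>t\<in>T. of_real (g t) * s t i * q t)"
        by (subst sum.swap) (simp add: q_def sum_distrib_left mult.assoc)
      finally show ?thesis .
    qed
    define Q where "Q = (\<Sum>t\<in>T. g t * (cmod (q t))\<^sup>2)"
    define nv where "nv = (\<Sum>i<n. (cmod (v $ i))\<^sup>2)"
    have "(\<Sum>i<n. cnj (v $ i) * (a * v $ i)) = a * of_real nv"
      unfolding nv_def of_real_sum sum_distrib_left by (rule sum.cong) (auto simp: complex_norm_square[unfolded of_real_power])
    moreover have "(\<Sum>i<n. cnj (v $ i) * (a * v $ i)) = - (\<Sum>i<n. \<Sum>t\<in>T. cnj (v $ i) * (of_real (g t) * s t i * q t))"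
      by (simp add: row sum_negf sum_distrib_left)
    moreover have "\<dots> = - (\<Sum>t\<in>T. of_real (g t) * q t * (\<Sum>i<n. cnj (v $ i) * s t i))"
      by (subst sum.swap) (simp add: sum_distrib_left mult_ac)
    moreover have "(\<Sum>i<n. cnj (v $ i) * s t i) = cnj (q t)" for t
      by (simp add: q_def cnj_sum mult.commute)
    moreover have "(\<Sum>t\<in>T. of_real (g t) * q t * cnj (q t)) = of_real Q"
      unfolding Q_def of_real_sum by (rule sum.cong) (auto simp: complex_norm_square[unfolded of_real_power] mult.assoc)
    ultimately have e: "a * of_real nv = - of_real Q" by simp
    have "nv \<noteq> 0"
    proof
      assume "nv = 0"
      then have "\<forall>i\<in>{..<n}. (cmod (v $ i))\<^sup>2 = 0"
        unfolding nv_def by (subst (asm) sum_nonneg_eq_0_iff) auto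
      then have "v = 0\<^sub>v n" using v(1) by (intro eq_vecI) auto
      with v(2) show False by simp
    qed
    moreover have "nv \<ge> 0" unfolding nv_def by (rule sum_nonneg) auto
    moreover have "Q \<ge> 0" unfolding Q_def by (rule sum_nonneg) (auto simp: g)
    moreover have "- a = of_real (Q / nv)"
      using e \<open>nv \<noteq> 0\<close> by (simp add: field_simps)
    ultimately show ?thesis by (intro exI[of _ "Q / nv"]) auto
  qed
  have "char_matrix M 0 = M" using M by (intro eq_matI) (auto simp: char_matrix_def)
  then have "poly (char_poly M) 0 = det A"
    using char_poly_matrix[OF M, of 0] by (simp add: M_def)
  moreover have "poly (char_poly M) 0 = (\<Prod>a\<leftarrow>as. - a)"
    unfolding as poly_prod_list by (simp add: o_def)
  moreover have "\<exists>r\<ge>0. (\<Prod>a\<leftarrow>bs. - a) = complex_of_real r" if "set bs \<subseteq> set as" for bs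
    using that
  proof (induction bs)
    case Nil
    show ?case by (intro exI[of _ 1]) simp
  next
    case (Cons b bs)
    then obtain r r' where "r \<ge> 0" "(\<Prod>a\<leftarrow>bs. - a) = complex_of_real r" "r' \<ge> 0" "- b = of_real r'"
      using eig[of b] by auto
    then show ?case by (intro exI[of _ "r' * r"]) auto
  qed
  ultimately show ?thesis by force
qed

text \<open>Exchanging the two block columns gives a block diagonal matrix. The exchange is an
  involution, so the modulus of its determinant is 1 and its sign need not be known.\<close>

lemma cmod_det_antidiagonal_blocks:
  fixes B C :: "complex mat"
  assumes B: "B \<in> carrier_mat n n" and C: "C \<in> carrier_mat n n"
  shows "cmod (det (four_block_mat (0\<^sub>m n n) B C (0\<^sub>m n n))) = cmod (det B) * cmod (det C)"
proof -
  define P where "P = four_block_mat (0\<^sub>m n n) (1\<^sub>m n) (1\<^sub>m n) (0\<^sub>m n n :: complex mat)"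
  define F where "F = four_block_mat (0\<^sub>m n n) B C (0\<^sub>m n n)"
  have P: "P \<in> carrier_mat (n + n) (n + n)" and F: "F \<in> carrier_mat (n + n) (n + n)"
    unfolding P_def F_def by (rule four_block_carrier_mat; simp)+
  have "P * P = four_block_mat (1\<^sub>m n) (0\<^sub>m n n) (0\<^sub>m n n) (1\<^sub>m n)"
    unfolding P_def by (subst mult_four_block_mat[of _ n n _ n _ n _ _ n _ n]) auto
  then have "det (P * P) = 1"
    by (simp add: det_four_block_mat_upper_right_zero[of _ n _ n])
  then have "det P * det P = 1" using det_mult[OF P P] by simp
  then have "cmod (det P) * cmod (det P) = 1" by (metis norm_mult norm_one)
  then have p: "cmod (det P) = 1" by (metis abs_norm_cancel abs_square_eq_1 power2_eq_square)
  have "F * P = four_block_mat B (0\<^sub>m n n) (0\<^sub>m n n) C"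
    unfolding P_def F_def using B C by (subst mult_four_block_mat[of _ n n _ n _ n _ _ n _ n]) auto
  then have "det (F * P) = det B * det C"
    using B C by (simp add: det_four_block_mat_upper_right_zero[of _ n _ n])
  then have "det F * det P = det B * det C" using det_mult[OF F P] by simp
  then have "cmod (det F) * cmod (det P) = cmod (det B) * cmod (det C)" by (metis norm_mult)
  then show ?thesis using p by (simp add: F_def)
qed

section \<open>The skew form of the shear operator\<close>

context dart_map begin

text \<open>\<open>Min\<close> and \<open>Max\<close> merely name the endpoints; by
  \<open>shear_commute\<close> their order is immaterial.\<close>

definition shear_edge :: "(nat set \<Rightarrow> 'a::comm_ring_1) \<Rightarrow> nat set \<Rightarrow> 'a" where
  "shear_edge y e = shear y (Min e) (Max e)"

lemma shear_edge: "shear_edge y {a, b} = shear y a b"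
  by (cases "a \<le> b") (simp_all add: shear_edge_def shear_commute)

lemma edge_cases:
  assumes "e \<in> edge_set" obtains a b where "e = {a, b}" "(a, b) \<in> D"
  using assms by (auto simp: edge_set_def)

lemma shear_cong:
  assumes "(a, b) \<in> D" "\<And>e. e \<in> edge_set \<Longrightarrow> x e = y e"
  shows "shear x a b = shear y a b"
proof -
  have *: "(b, th a b) \<in> D" "(th a b, a) \<in> D" "(a, th b a) \<in> D" "(th b a, b) \<in> D"
    by (rule th_D th_D' th_D[OF sym_D] th_D'[OF sym_D], rule assms(1))+
  have "x {c, d} = y {c, d}" if "(c, d) \<in> D" for c d
    using that by (intro assms(2)) (auto simp: edge_set_def)
  then show ?thesis unfolding shear_def using * by simp
qed

lemma shear_sum: "shear (\<lambda>e. \<Sum>i\<in>I. c i * y i e) a b = (\<Sum>i\<in>I. c i * shear (y i) a b)"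
  by (simp add: shear_def sum.distrib sum_subtractf distrib_left right_diff_distrib)

lemma shear_cnj: "shear (\<lambda>e. cnj (y e)) a b = cnj (shear y a b)"
  by (simp add: shear_def)

lemma sum_darts_edges: "(\<Sum>(a,b)\<in>D. f {a, b}) = 2 * (\<Sum>e\<in>edge_set. f e :: 'a::comm_ring_1)"
proof -
  have "(\<Sum>(a,b)\<in>D. f {a, b}) = (\<Sum>v\<in>V. \<Sum>e\<in>{e\<in>edge_set. v \<in> e}. f e)"
    unfolding sum_D_nbs[of "\<lambda>a b. f {a, b}"] sum_nbs_edges ..
  also have "\<dots> = (\<Sum>v\<in>V. \<Sum>e\<in>edge_set. if v \<in> e then f e else 0)"
    using finite_edge_set by (simp add: sum.inter_filter)
  also have "\<dots> = (\<Sum>e\<in>edge_set. \<Sum>v\<in>V. if v \<in> e then f e else 0)" by (rule sum.swap)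
  also have "\<dots> = (\<Sum>e\<in>edge_set. 2 * f e)"
  proof (rule sum.cong)
    fix e assume "e \<in> edge_set"
    then obtain a b where ab: "e = {a, b}" "(a, b) \<in> D" by (rule edge_cases)
    have "(\<Sum>v\<in>V. if v \<in> e then f e else 0) = (\<Sum>v\<in>{v\<in>V. v \<in> e}. f e)"
      by (rule sum.inter_filter[symmetric, OF finite_V])
    also have "{v\<in>V. v \<in> e} = {a, b}" using ab D_V by auto
    also have "(\<Sum>v\<in>{a, b}. f e) = 2 * f e" using irrefl_D[OF ab(2)] by simp
    finally show "(\<Sum>v\<in>V. if v \<in> e then f e else 0) = 2 * f e" .
  qed simp
  finally show ?thesis by (simp add: sum_distrib_left)
qed

text \<open>The form x^T \<epsilon> y, bilinear over the complex numbers: conjugates are written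
  explicitly in the arguments.\<close>

definition pairing :: "(nat set \<Rightarrow> complex) \<Rightarrow> (nat set \<Rightarrow> complex) \<Rightarrow> complex" where
  "pairing x y = (\<Sum>e\<in>edge_set. x e * shear_edge y e)"

lemma pairing_darts: "2 * pairing x y = (\<Sum>(a,b)\<in>D. x {a, b} * shear y a b)"
  using sum_darts_edges[of "\<lambda>e. x e * shear_edge y e"] by (simp add: pairing_def shear_edge)

text \<open>The shear of an edge is the sum of one term from each adjacent face. Giving each term to
  the dart of its own face turns the sum over edges into one over corners, which can be collected by
  faces.\<close>

lemma pairing_corners: "pairing x y = (\<Sum>(a,b)\<in>D. x {a, b} * (y {b, th a b} - y {th a b, a}))"
proof -
  define f where "f a b = x {a, b} * (y {b, th a b} - y {th a b, a})" for a b
  have "x {a, b} * shear y a b = f a b + f b a" for a b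
  proof -
    have "f b a = x {a, b} * (y {a, th b a} - y {th b a, b})" by (simp add: f_def insert_commute)
    then show ?thesis by (simp add: f_def shear_def algebra_simps)
  qed
  then have "2 * pairing x y = (\<Sum>(a,b)\<in>D. f a b) + (\<Sum>(a,b)\<in>D. f b a)"
    unfolding pairing_darts by (simp add: sum.distrib[symmetric] split_def)
  also have "(\<Sum>(a,b)\<in>D. f b a) = (\<Sum>(a,b)\<in>D. f a b)" by (rule sum_D_reverse)
  finally show ?thesis by (simp add: f_def)
qed

text \<open>Functions \<zeta>_a + \<zeta>_b are orthogonal to the image of shear because its vertex
  sums vanish.\<close>

lemma pairing_congruent_left:
  assumes "\<And>a b. (a, b) \<in> D \<Longrightarrow> x' {a, b} = x {a, b} + (\<zeta> a + \<zeta> b)"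
  shows "pairing x' y = pairing x y"
proof -
  have v0: "(\<Sum>(a,b)\<in>D. \<zeta> a * shear y a b) = 0"
    unfolding sum_D_nbs by (simp add: sum_distrib_left[symmetric] vertex_sum_shear)
  have "(\<Sum>(a,b)\<in>D. \<zeta> b * shear y a b) = (\<Sum>(a,b)\<in>D. \<zeta> a * shear y a b)"
    using sum_D_reverse[of "\<lambda>a b. \<zeta> a * shear y a b"] by (simp only: shear_commute)
  moreover have "2 * pairing x' y = (\<Sum>(a,b)\<in>D. x {a, b} * shear y a b) + (\<Sum>(a,b)\<in>D. \<zeta> a * shear y a b)
      + (\<Sum>(a,b)\<in>D. \<zeta> b * shear y a b)"
    unfolding pairing_darts sum.distrib[symmetric]
    by (rule sum.cong) (auto simp: assms distrib_right)
  ultimately have "2 * pairing x' y = 2 * pairing x y" unfolding pairing_darts[of x y] using v0 by simp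
  then show ?thesis by simp
qed

end

context dart_map_crst begin

text \<open>Replacing L by its normalisation preserves both the shear and the pairings, so all sums
  can be restricted to the complement of \<open>C\<close>. The unit preimages form an integral
  inverse \<open>YZ\<close> of the minor \<open>EZ\<close>.\<close>

lemma cmod_det_complement:
  fixes L :: "nat \<Rightarrow> nat set \<Rightarrow> complex" and es :: "nat \<Rightarrow> nat set"
  assumes es: "bij_betw es {..<2*N} (edge_set - C)"
    and LL: "\<And>i j. i < N \<Longrightarrow> j < N \<Longrightarrow> pairing (L i) (L j) = 0"
    and LcL: "\<And>i j. i < N \<Longrightarrow> j < N \<Longrightarrow> pairing (L i) (\<lambda>e. cnj (L j e)) = - 4 * \<i> * M $$ (i,j)"
    and M: "M \<in> carrier_mat N N"
  defines "J \<equiv> mat (2*N) (2*N) (\<lambda>(i,j). if i < N then \<i>/2 * shear_edge (L i) (es j)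
       else cnj (\<i>/2 * shear_edge (L (i - N)) (es j)))"
  shows "cmod (det J) = cmod (det M)"
proof -
  have "\<forall>i. \<exists>L' \<zeta>. (\<forall>e\<in>C. L' e = 0) \<and> (\<forall>a b. (a, b) \<in> D \<longrightarrow> L' {a, b} = L i {a, b} + (\<zeta> a + \<zeta> b))"
  proof
    fix i
    obtain L' \<zeta> where "\<And>e. e \<in> C \<Longrightarrow> L' e = 0" "\<And>a b. (a, b) \<in> D \<Longrightarrow> L' {a, b} = L i {a, b} + (\<zeta> a + \<zeta> b)"
      by (rule normalise_edge_function[of "L i"]) blast
    then show "\<exists>L' \<zeta>. (\<forall>e\<in>C. L' e = 0) \<and> (\<forall>a b. (a, b) \<in> D \<longrightarrow> L' {a, b} = L i {a, b} + (\<zeta> a + \<zeta> b))"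
      by blast
  qed
  then obtain L' \<zeta> where L'C: "\<And>i e. e \<in> C \<Longrightarrow> L' i e = 0"
    and L': "\<And>i a b. (a, b) \<in> D \<Longrightarrow> L' i {a, b} = L i {a, b} + (\<zeta> i a + \<zeta> i b)"
    by metis
  have es_mem: "es j \<in> edge_set" "es j \<notin> C" if "j < 2*N" for j
    using es that by (auto simp: bij_betw_def)
  have es_inj: "es j = es k \<longleftrightarrow> j = k" if "j < 2*N" "k < 2*N" for j k
    using es that by (auto simp: bij_betw_def inj_on_def)
  have sh': "shear_edge (L' i) e = shear_edge (L i) e" if "e \<in> edge_set" for i e
    using that
  proof (rule edge_cases)
    fix a b assume "e = {a, b}" "(a, b) \<in> D"
    then show ?thesis
      using shear_congruent[of "L' i" "L i" "\<zeta> i", OF L'] by (simp add: shear_edge)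
  qed
  \<comment> \<open>A function vanishing on \<open>C\<close> is a combination of indicators of the
    \<open>es k\<close>, so its shear has integral coefficients in its values there. The ring stays
    general, since both integral and complex functions are expanded.\<close>
  have expand: "shear_edge y e = (\<Sum>k<2*N. of_int (shear_edge (\<lambda>e. of_bool (e = es k)) e) * y (es k))"
    if y: "\<And>e. e \<in> C \<Longrightarrow> y e = 0" and e: "e \<in> edge_set" for y :: "nat set \<Rightarrow> 'a::comm_ring_1" and e
    using e
  proof (rule edge_cases)
    fix a b assume ab: "e = {a, b}" "(a, b) \<in> D"
    have "y e = (\<Sum>k<2*N. y (es k) * of_int (of_bool (e = es k)))" if eE: "e \<in> edge_set" for e
    proof (cases "e \<in> C")
      case True
      then show ?thesis using y es_mem(2) by (subst sum.neutral) auto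
    next
      case False
      then obtain j where j: "j < 2*N" "e = es j" using es eE by (auto simp: bij_betw_def)
      have "(\<Sum>k<2*N. y (es k) * of_int (of_bool (e = es k))) = (\<Sum>k<2*N. if k = j then y (es k) else 0)"
        using j es_inj by (intro sum.cong) auto
      then show ?thesis using j by simp
    qed
    then have "shear y a b = shear (\<lambda>e. \<Sum>k<2*N. y (es k) * of_int (of_bool (e = es k))) a b"
      by (intro shear_cong[OF ab(2)]) blast
    then show ?thesis unfolding ab(1) shear_edge shear_sum shear_of_int by (simp add: mult.commute)
  qed
  define EZ :: "int mat" where "EZ = mat (2*N) (2*N) (\<lambda>(i,k). shear_edge (\<lambda>e. of_bool (e = es k)) (es i))"
  define E :: "complex mat" where "E = map_mat of_int EZ"
  have EZ: "EZ \<in> carrier_mat (2*N) (2*N)" and E: "E \<in> carrier_mat (2*N) (2*N)"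
    by (simp_all add: EZ_def E_def)
  have "\<forall>k<2*N. \<exists>y::nat set \<Rightarrow> int. (\<forall>e\<in>C. y e = 0) \<and>
      (\<forall>e\<in>edge_set - C. shear_edge y e = of_bool (e = es k))"
  proof (intro allI impI)
    fix k assume "k < 2*N"
    then have "es k \<in> edge_set - C" using es_mem by blast
    then obtain y :: "nat set \<Rightarrow> int" where y: "\<And>e. e \<in> C \<Longrightarrow> y e = 0"
      "\<And>a b. (a, b) \<in> D \<Longrightarrow> {a, b} \<notin> C \<Longrightarrow> shear y a b = of_bool ({a, b} = es k)"
      by (rule shear_unit_preimage) blast
    have "shear_edge y e = of_bool (e = es k)" if "e \<in> edge_set - C" for e
    proof -
      have "e \<in> edge_set" using that by simp
      then obtain a b where "e = {a, b}" "(a, b) \<in> D" by (rule edge_cases)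
      then show ?thesis using y(2) that by (simp add: shear_edge)
    qed
    with y(1) show "\<exists>y::nat set \<Rightarrow> int. (\<forall>e\<in>C. y e = 0) \<and> (\<forall>e\<in>edge_set - C. shear_edge y e = of_bool (e = es k))"
      by blast
  qed
  then obtain Y :: "nat \<Rightarrow> nat set \<Rightarrow> int" where Y: "\<And>k e. k < 2*N \<Longrightarrow> e \<in> C \<Longrightarrow> Y k e = 0"
    "\<And>k e. k < 2*N \<Longrightarrow> e \<in> edge_set - C \<Longrightarrow> shear_edge (Y k) e = of_bool (e = es k)"
    by metis
  define YZ where "YZ = mat (2*N) (2*N) (\<lambda>(j,k). Y k (es j))"
  have YZ: "YZ \<in> carrier_mat (2*N) (2*N)" by (simp add: YZ_def)
  have "EZ * YZ = 1\<^sub>m (2*N)"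
  proof (rule eq_matI)
    fix i k assume ik: "i < dim_row (1\<^sub>m (2*N) :: int mat)" "k < dim_col (1\<^sub>m (2*N) :: int mat)"
    then have "(EZ * YZ) $$ (i,k) = (\<Sum>j<2*N. shear_edge (\<lambda>e. of_bool (e = es j)) (es i) * Y k (es j))"
      by (simp add: EZ_def YZ_def scalar_prod_def lessThan_atLeast0)
    also have "\<dots> = shear_edge (Y k) (es i)"
      using ik expand[of "Y k" "es i"] Y(1) es_mem by simp
    also have "\<dots> = of_bool (es i = es k)" using ik Y(2) es_mem by simp
    finally show "(EZ * YZ) $$ (i,k) = 1\<^sub>m (2*N) $$ (i,k)" using ik es_inj by simp
  qed (auto simp: EZ_def YZ_def)
  \<comment> \<open>In the integers this leaves only the values 1 and -1 for the minor.\<close>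
  then have "det EZ * det YZ = 1" using det_mult[OF EZ YZ] by simp
  then have "\<bar>det EZ\<bar> = 1" by (metis abs_zmult_eq_1 abs_1)
  moreover have "det E = of_int (det EZ)" unfolding E_def by (rule of_int_hom.hom_det)
  ultimately have detE: "cmod (det E) = 1" by (metis norm_of_int of_int_1 of_int_abs)
  define G where "G = mat (2*N) (2*N) (\<lambda>(j,i). if i < N then \<i>/2 * L' i (es j) else cnj (\<i>/2 * L' (i - N) (es j)))"
  have G: "G \<in> carrier_mat (2*N) (2*N)" by (simp add: G_def)
  have EGe: "(E * G) $$ (j, i) = (if i < N then \<i>/2 * shear_edge (L i) (es j) else cnj (\<i>/2 * shear_edge (L (i - N)) (es j)))"
    if ij: "i < 2*N" "j < 2*N" for i j
  proof -
    have s: "shear_edge (L m) (es j) = (\<Sum>k<2*N. of_int (shear_edge (\<lambda>e. of_bool (e = es k)) (es j)) * L' m (es k))" for m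
      using sh'[OF es_mem(1)[OF ij(2)]] expand[of "L' m" "es j", OF L'C es_mem(1)[OF ij(2)]] by simp
    have "(E * G) $$ (j, i) = (\<Sum>k<2*N. of_int (shear_edge (\<lambda>e. of_bool (e = es k)) (es j)) *
        (if i < N then \<i>/2 * L' i (es k) else cnj (\<i>/2 * L' (i - N) (es k))))"
      using ij by (simp add: E_def EZ_def G_def scalar_prod_def lessThan_atLeast0)
    also have "\<dots> = (if i < N then \<i>/2 * (\<Sum>k<2*N. of_int (shear_edge (\<lambda>e. of_bool (e = es k)) (es j)) * L' i (es k))
        else cnj (\<i>/2 * (\<Sum>k<2*N. of_int (shear_edge (\<lambda>e. of_bool (e = es k)) (es j)) * L' (i - N) (es k))))"
      by (simp add: sum_distrib_left mult.left_commute)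
    finally show ?thesis by (simp only: s)
  qed
  have "transpose_mat J = E * G"
    by (rule eq_matI) (use E G EGe in \<open>auto simp: J_def\<close>)
  then have "det J = det (E * G)"
    using det_transpose[of J "2*N"] by (simp add: J_def)
  then have dJ: "det J = det E * det G" using det_mult[OF E G] by simp
  \<comment> \<open>Only the left factor has to vanish on \<open>C\<close>; the edges of
    \<open>C\<close> then contribute nothing to the full pairing.\<close>
  have pair: "(\<Sum>j<2*N. x' (es j) * shear_edge y (es j)) = pairing x y"
    if "\<And>e. e \<in> C \<Longrightarrow> x' e = 0" "\<And>a b. (a, b) \<in> D \<Longrightarrow> x' {a, b} = x {a, b} + (\<zeta> a + \<zeta> b)" for x x' y \<zeta>
  proof -
    have "pairing x y = pairing x' y" using pairing_congruent_left[where x = x and x' = x' and \<zeta> = \<zeta>, OF that(2)] by simp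
    also have "\<dots> = (\<Sum>e\<in>edge_set - C. x' e * shear_edge y e)"
      unfolding pairing_def using C_edges finite_edge_set that(1) by (intro sum.mono_neutral_right) auto
    also have "\<dots> = (\<Sum>j<2*N. x' (es j) * shear_edge y (es j))"
      using sum.reindex_bij_betw[OF es, of "\<lambda>e. x' e * shear_edge y e"] by simp
    finally show ?thesis ..
  qed
  have shc: "shear_edge (\<lambda>e. cnj (y e)) e = cnj (shear_edge y e)" for y e
    by (simp add: shear_edge_def shear_cnj)
  \<comment> \<open>The product of i/2 and its conjugate is 1/4, which turns -4 i M into -i
    M.\<close>
  define B where "B = (- \<i>) \<cdot>\<^sub>m M"
  have B: "B \<in> carrier_mat N N" using M by (simp add: B_def)
  have GEG: "transpose_mat G * (E * G) = four_block_mat (0\<^sub>m N N) B (map_mat cnj B) (0\<^sub>m N N)"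
  proof (rule eq_matI)
    show "dim_row (transpose_mat G * (E * G)) = dim_row (four_block_mat (0\<^sub>m N N) B (map_mat cnj B) (0\<^sub>m N N))"
      "dim_col (transpose_mat G * (E * G)) = dim_col (four_block_mat (0\<^sub>m N N) B (map_mat cnj B) (0\<^sub>m N N))"
      using G B by auto
    fix i i' assume "i < dim_row (four_block_mat (0\<^sub>m N N) B (map_mat cnj B) (0\<^sub>m N N))"
      "i' < dim_col (four_block_mat (0\<^sub>m N N) B (map_mat cnj B) (0\<^sub>m N N))"
    then have i: "i < 2*N" "i' < 2*N" using B by auto
    have e: "(transpose_mat G * (E * G)) $$ (i, i') = (\<Sum>j<2*N.
      (if i < N then \<i>/2 * L' i (es j) else cnj (\<i>/2 * L' (i - N) (es j))) *
      (if i' < N then \<i>/2 * shear_edge (L i') (es j) else cnj (\<i>/2 * shear_edge (L (i' - N)) (es j))))"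
    proof -
      have "(transpose_mat G * (E * G)) $$ (i, i') = (\<Sum>j<2*N. G $$ (j,i) * (E * G) $$ (j, i'))"
        using i G E by (simp add: scalar_prod_def lessThan_atLeast0 del: index_mult_mat(1)) (simp add: scalar_prod_def lessThan_atLeast0)
      also have "\<dots> = (\<Sum>j<2*N.
      (if i < N then \<i>/2 * L' i (es j) else cnj (\<i>/2 * L' (i - N) (es j))) *
      (if i' < N then \<i>/2 * shear_edge (L i') (es j) else cnj (\<i>/2 * shear_edge (L (i' - N)) (es j))))"
      proof (rule sum.cong)
        fix j assume "j \<in> {..<2*N}"
        then have j: "j < 2*N" by simp
        have "G $$ (j,i) = (if i < N then \<i>/2 * L' i (es j) else cnj (\<i>/2 * L' (i - N) (es j)))"
          using i(1) j by (simp add: G_def)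
        then show "G $$ (j,i) * (E * G) $$ (j, i') = (if i < N then \<i>/2 * L' i (es j) else cnj (\<i>/2 * L' (i - N) (es j))) *
      (if i' < N then \<i>/2 * shear_edge (L i') (es j) else cnj (\<i>/2 * shear_edge (L (i' - N)) (es j)))"
          by (simp only: EGe[OF i(2) j])
      qed simp
      finally show ?thesis .
    qed
    have p1: "(\<Sum>j<2*N. (\<i>/2 * L' k (es j)) * (\<i>/2 * shear_edge (L l) (es j))) = 0" if "k < N" "l < N" for k l
    proof -
      have "(\<Sum>j<2*N. (\<i>/2 * L' k (es j)) * (\<i>/2 * shear_edge (L l) (es j))) = (\<i>/2 * (\<i>/2)) * (\<Sum>j<2*N. L' k (es j) * shear_edge (L l) (es j))"
        unfolding sum_distrib_left by (rule sum.cong) (simp_all only: mult_ac)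
      also have "(\<Sum>j<2*N. L' k (es j) * shear_edge (L l) (es j)) = 0"
        using pair[of "L' k" "L k" "\<zeta> k" "L l", OF L'C L'] LL[OF that] by simp
      finally show ?thesis by simp
    qed
    have p2: "(\<Sum>j<2*N. (\<i>/2 * L' k (es j)) * cnj (\<i>/2 * shear_edge (L l) (es j))) = - \<i> * M $$ (k,l)" if "k < N" "l < N" for k l
    proof -
      have "(\<Sum>j<2*N. (\<i>/2 * L' k (es j)) * cnj (\<i>/2 * shear_edge (L l) (es j))) =
         (\<i>/2 * cnj (\<i>/2)) * (\<Sum>j<2*N. L' k (es j) * shear_edge (\<lambda>e. cnj (L l e)) (es j))"
        unfolding sum_distrib_left shc complex_cnj_mult by (rule sum.cong) (simp_all only: mult_ac)
      also have "(\<Sum>j<2*N. L' k (es j) * shear_edge (\<lambda>e. cnj (L l e)) (es j)) = - 4 * \<i> * M $$ (k,l)"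
        using pair[of "L' k" "L k" "\<zeta> k" "\<lambda>e. cnj (L l e)", OF L'C L'] LcL[OF that] by simp
      finally show ?thesis by simp
    qed
    have p1': "(\<Sum>j<2*N. cnj (\<i>/2 * L' k (es j)) * cnj (\<i>/2 * shear_edge (L l) (es j))) = 0" if "k < N" "l < N" for k l
      using arg_cong[OF p1[OF that], of cnj] by simp
    have p2': "(\<Sum>j<2*N. cnj (\<i>/2 * L' k (es j)) * (\<i>/2 * shear_edge (L l) (es j))) = cnj (- \<i> * M $$ (k,l))" if "k < N" "l < N" for k l
      unfolding p2[OF that, symmetric] by simp
    show "(transpose_mat G * (E * G)) $$ (i, i') = four_block_mat (0\<^sub>m N N) B (map_mat cnj B) (0\<^sub>m N N) $$ (i, i')"
      unfolding e using i M p1[of i i'] p2[of i "i' - N"] p1'[of "i - N" "i' - N"] p2'[of "i - N" i']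
      by (cases "i < N"; cases "i' < N") (simp_all add: B_def)
  qed
  have "det (transpose_mat G * (E * G)) = det G * (det E * det G)"
    using det_mult[of "transpose_mat G" "2*N" "E * G"] det_mult[OF E G] det_transpose[OF G] E G by simp
  then have "cmod (det G * (det E * det G)) = cmod (det B) * cmod (det (map_mat cnj B))"
    unfolding GEG using cmod_det_antidiagonal_blocks[OF B, of "map_mat cnj B"] B by simp
  moreover have "det (map_mat cnj B) = cnj (det B)"
  proof -
    interpret cnj: comm_ring_hom cnj by unfold_locales auto
    show ?thesis by (rule cnj.hom_det)
  qed
  moreover have "cmod (det B) = cmod (det M)"
    using M by (simp add: B_def norm_mult norm_power)
  ultimately have "cmod (det G) * cmod (det G) = cmod (det M) * cmod (det M)"
    using detE by (simp add: norm_mult)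
  then have "cmod (det G) = cmod (det M)"
    by (metis norm_ge_zero power2_eq_iff_nonneg power2_eq_square)
  then show ?thesis unfolding dJ using detE by (simp add: norm_mult)
qed

end

section \<open>Wirtinger calculus and the Bloch--Wigner function\<close>

text \<open>Differentiability along real lines through the coordinate \<open>w v\<close>, with
  derivative real-linear in the direction. Nothing stronger is required because \<open>pdiff\<close>
  is itself a derivative along a line.\<close>

definition has_wirt :: "((nat \<Rightarrow> complex) \<Rightarrow> complex) \<Rightarrow> (nat \<Rightarrow> complex) \<Rightarrow> nat \<Rightarrow> complex \<Rightarrow> complex \<Rightarrow> bool" where
  "has_wirt f w v p q \<longleftrightarrow>
    (\<forall>h. ((\<lambda>t::real. f (w(v := w v + of_real t * h))) has_vector_derivative (p * h + q * cnj h)) (at 0))"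

lemma has_wirt_imp_pdiff: "has_wirt f w v p q \<Longrightarrow> pdiff f w v h = p * h + q * cnj h"
  unfolding has_wirt_def pdiff_def by (blast intro: vector_derivative_at)

lemma has_wirt_imp_wirt_z: "has_wirt f w v p q \<Longrightarrow> wirt_z f w v = p"
  by (simp add: wirt_z_def has_wirt_imp_pdiff algebra_simps)

lemma has_wirt_imp_wirt_zbar: "has_wirt f w v p q \<Longrightarrow> wirt_zbar f w v = q"
  by (simp add: wirt_zbar_def has_wirt_imp_pdiff algebra_simps)

lemma has_wirt_independent:
  assumes "\<And>x. f (w(v := x)) = f w"
  shows "has_wirt f w v 0 0"
  unfolding has_wirt_def by (simp add: assms)

lemma has_wirt_const: "has_wirt (\<lambda>w. c) w v 0 0"
  by (rule has_wirt_independent) simp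

lemma has_wirt_coordinate: "has_wirt (\<lambda>w. w a) w v (of_bool (a = v)) 0"
proof (cases "a = v")
  case True
  have "((\<lambda>t::real. w v + of_real t * h) has_vector_derivative h) (at 0)" for h
    by (auto intro!: derivative_eq_intros)
  then show ?thesis using True by (simp add: has_wirt_def)
qed (simp add: has_wirt_independent)

lemma has_wirt_add:
  assumes "has_wirt f w v p q" "has_wirt g w v p' q'"
  shows "has_wirt (\<lambda>w. f w + g w) w v (p + p') (q + q')"
  unfolding has_wirt_def
proof
  fix h
  have "((\<lambda>t::real. f (w(v := w v + of_real t * h)) + g (w(v := w v + of_real t * h)))
     has_vector_derivative ((p * h + q * cnj h) + (p' * h + q' * cnj h))) (at 0)"
    using assms unfolding has_wirt_def by (intro has_vector_derivative_add) auto
  then show "((\<lambda>t::real. f (w(v := w v + of_real t * h)) + g (w(v := w v + of_real t * h)))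
     has_vector_derivative ((p + p') * h + (q + q') * cnj h)) (at 0)"
    by (simp add: algebra_simps)
qed

lemma has_wirt_mult:
  assumes "has_wirt f w v p q" "has_wirt g w v p' q'"
  shows "has_wirt (\<lambda>w. f w * g w) w v (f w * p' + p * g w) (f w * q' + q * g w)"
  unfolding has_wirt_def
proof
  fix h
  have "((\<lambda>t::real. f (w(v := w v + of_real t * h)) * g (w(v := w v + of_real t * h)))
     has_vector_derivative (f (w(v := w v + of_real 0 * h)) * (p' * h + q' * cnj h)
        + (p * h + q * cnj h) * g (w(v := w v + of_real 0 * h)))) (at 0)"
    using assms unfolding has_wirt_def by (intro has_vector_derivative_mult) auto
  then show "((\<lambda>t::real. f (w(v := w v + of_real t * h)) * g (w(v := w v + of_real t * h)))
     has_vector_derivative ((f w * p' + p * g w) * h + (f w * q' + q * g w) * cnj h)) (at 0)"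
    by (simp add: algebra_simps)
qed

lemma has_wirt_cmult: "has_wirt f w v p q \<Longrightarrow> has_wirt (\<lambda>w. c * f w) w v (c * p) (c * q)"
  using has_wirt_mult[OF has_wirt_const[of c]] by simp

lemma has_wirt_minus: "has_wirt f w v p q \<Longrightarrow> has_wirt (\<lambda>w. - f w) w v (- p) (- q)"
  using has_wirt_cmult[of f w v p q "-1"] by simp

lemma has_wirt_diff:
  "has_wirt f w v p q \<Longrightarrow> has_wirt g w v p' q' \<Longrightarrow> has_wirt (\<lambda>w. f w - g w) w v (p - p') (q - q')"
  using has_wirt_add[OF _ has_wirt_minus] by fastforce

lemma has_wirt_sum:
  assumes "\<And>i. i \<in> I \<Longrightarrow> has_wirt (f i) w v (p i) (q i)"
  shows "has_wirt (\<lambda>w. \<Sum>i\<in>I. f i w) w v (\<Sum>i\<in>I. p i) (\<Sum>i\<in>I. q i)"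
  using assms by (induction I rule: infinite_finite_induct) (auto intro: has_wirt_const has_wirt_add)

lemma has_wirt_cnj:
  assumes "has_wirt f w v p q"
  shows "has_wirt (\<lambda>w. cnj (f w)) w v (cnj q) (cnj p)"
  unfolding has_wirt_def
proof
  fix h
  have "((\<lambda>t::real. cnj (f (w(v := w v + of_real t * h)))) has_vector_derivative cnj (p * h + q * cnj h)) (at 0)"
    using assms unfolding has_wirt_def by (intro has_vector_derivative_cnj) auto
  then show "((\<lambda>t::real. cnj (f (w(v := w v + of_real t * h)))) has_vector_derivative
      (cnj q * h + cnj p * cnj h)) (at 0)"
    by (simp add: algebra_simps)
qed

lemma has_wirt_compose:
  assumes "has_wirt f w v p q" "(g has_field_derivative d) (at (f w))"
  shows "has_wirt (\<lambda>w. g (f w)) w v (d * p) (d * q)"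
  unfolding has_wirt_def
proof
  fix h
  have "(g \<circ> (\<lambda>t::real. f (w(v := w v + of_real t * h))) has_vector_derivative ((p * h + q * cnj h) * d)) (at 0)"
    using assms unfolding has_wirt_def by (intro field_vector_diff_chain_at) auto
  then show "((\<lambda>t::real. g (f (w(v := w v + of_real t * h)))) has_vector_derivative
      (d * p * h + d * q * cnj h)) (at 0)"
    by (simp add: algebra_simps o_def)
qed

text \<open>Needed for second derivatives: the formula for the first derivative is available only
  where the triangles keep their orientation, that is, near the configuration.\<close>

lemma has_wirt_transform:
  assumes "has_wirt f w v p q" "\<forall>\<^sub>F x in nhds (w v). f (w(v := x)) = g (w(v := x))"
  shows "has_wirt g w v p q"
  unfolding has_wirt_def
proof
  fix h
  have lim: "filterlim (\<lambda>t::real. w v + of_real t * h) (nhds (w v)) (nhds 0)"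
    by (rule tendsto_eq_intros filterlim_ident refl | simp)+
  have ev: "\<forall>\<^sub>F t::real in nhds 0. f (w(v := w v + of_real t * h)) = g (w(v := w v + of_real t * h))"
    using filterlim_iff[THEN iffD1, OF lim, rule_format, OF assms(2)] .
  show "((\<lambda>t::real. g (w(v := w v + of_real t * h))) has_vector_derivative (p * h + q * cnj h)) (at 0)"
  proof (rule has_vector_derivative_cong_ev[THEN iffD1])
    show "((\<lambda>t::real. f (w(v := w v + of_real t * h))) has_vector_derivative (p * h + q * cnj h)) (at 0)"
      using assms(1) unfolding has_wirt_def by blast
    show "\<forall>\<^sub>F t::real in nhds 0. t \<in> UNIV \<longrightarrow> f (w(v := w v + of_real t * h)) = g (w(v := w v + of_real t * h))"
      using ev by simp
    show "f (w(v := w v + of_real 0 * h)) = g (w(v := w v + of_real 0 * h))"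
      using eventually_nhds_x_imp_x[OF ev] .
  qed
qed

lemma has_wirt_Re:
  assumes "has_wirt f w v p q"
  shows "has_wirt (\<lambda>w. of_real (Re (f w))) w v ((p + cnj q) / 2) ((q + cnj p) / 2)"
proof -
  have *: "complex_of_real (Re x) = 1/2 * (x + cnj x)" for x by (simp add: complex_eq_iff)
  show ?thesis unfolding *
    using has_wirt_cmult[OF has_wirt_add[OF assms has_wirt_cnj[OF assms]], of "1/2"] by simp
qed

lemma has_wirt_Im:
  assumes "has_wirt f w v p q"
  shows "has_wirt (\<lambda>w. of_real (Im (f w))) w v ((p - cnj q) / (2*\<i>)) ((q - cnj p) / (2*\<i>))"
proof -
  have "complex_of_real (Im x) = 1/(2*\<i>) * (x - cnj x)" for x by (simp add: complex_eq_iff)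
  then show ?thesis
    using has_wirt_cmult[OF has_wirt_diff[OF assms has_wirt_cnj[OF assms]], of "1/(2*\<i>)"] by simp
qed

section \<open>Logarithm, dilogarithm and Bloch-Wigner function\<close>

text \<open>\<open>Ln 0\<close> is unspecified, whereas \<open>Arg 0 = 0\<close> and \<open>ln 0 = 0\<close>.\<close>

definition cLn :: "complex \<Rightarrow> complex" where
  "cLn x = (if x = 0 then 0 else Ln x)"

lemma Arg_eq_Im_cLn: "Arg x = Im (cLn x)"
  by (simp add: cLn_def Arg_eq_Im_Ln Arg_zero)

lemma ln_cmod_eq_Re_cLn: "ln (cmod x) = Re (cLn x)"
  by (simp add: cLn_def)

lemma cLn_has_field_derivative:
  assumes "x \<notin> \<real>\<^sub>\<le>\<^sub>0"
  shows "(cLn has_field_derivative (1 / x)) (at x)"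
proof (rule has_field_derivative_transform_within_open[of Ln _ _ "- \<real>\<^sub>\<le>\<^sub>0"])
  show "(Ln has_field_derivative 1 / x) (at x)"
    using assms has_field_derivative_Ln[OF assms] by (simp add: inverse_eq_divide)
qed (use assms in \<open>auto simp: cLn_def open_Compl\<close>)

text \<open>The plane slit along [1, inf) is starlike about 0 and the integrand extends
  holomorphically over 0, so it has a primitive \<open>g\<close> there; up to a constant
  \<open>Li2\<close> is its negative.\<close>

lemma Li2_has_field_derivative:
  assumes "Im w \<noteq> 0"
  shows "(Li2 has_field_derivative (- Ln (1 - w) / w)) (at w)"
proof -
  define S where "S = {x::complex. 1 - x \<notin> \<real>\<^sub>\<le>\<^sub>0}"
  have "S = (\<lambda>x. 1 - x) -` (- \<real>\<^sub>\<le>\<^sub>0)" by (auto simp: S_def)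
  then have openS: "open S" by (simp add: continuous_intros open_vimage open_Compl)
  have seg: "closed_segment 0 x \<subseteq> S" if "x \<in> S" for x
  proof
    fix y assume "y \<in> closed_segment 0 x"
    then obtain t where t: "0 \<le> t" "t \<le> 1" "y = of_real t * x"
      by (auto simp: in_segment scaleR_conv_of_real)
    show "y \<in> S"
    proof (rule ccontr)
      assume "y \<notin> S"
      then have *: "t * Im x = 0" "t * Re x \<ge> 1"
        by (auto simp: S_def t complex_nonpos_Reals_iff)
      then have "t \<noteq> 0" by auto
      then have im: "Im x = 0" using * by simp
      have "Re x > 0" using * t(1) by (smt (verit) mult_nonneg_nonpos)
      then have "Re x \<ge> 1" using * t by (smt (verit) mult_left_le_one_le)
      with im have "Im x = 0" "Re x \<ge> 1" by simp_all
      then show False using \<open>x \<in> S\<close> by (auto simp: S_def complex_nonpos_Reals_iff)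
    qed
  qed
  have S0: "0 \<in> S" by (simp add: S_def)
  have star: "starlike S" unfolding starlike_def using seg S0 by blast
  define f where "f t = Ln (1 - t)" for t :: complex
  have holf: "f holomorphic_on S" unfolding f_def
    by (intro holomorphic_intros) (auto simp: S_def)
  \<comment> \<open>The singularity at 0 is removable because \<open>f 0 = Ln 1 = 0\<close>; the
    quotient is completed by the derivative.\<close>
  define F where "F t = (if t = 0 then deriv f 0 else (f t - f 0) / (t - 0))" for t
  have holF: "F holomorphic_on S"
    unfolding F_def by (rule pole_lemma_open[OF holf openS])
  obtain g where g: "\<And>x. x \<in> S \<Longrightarrow> (g has_field_derivative F x) (at x)"
    using holomorphic_starlike_primitive[OF holomorphic_on_imp_continuous_on[OF holF] star openS, of "{}"]
      holF openS by (metis Diff_empty finite.emptyI holomorphic_on_open field_differentiable_def)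
  have Li2: "Li2 x = g 0 - g x" if x: "x \<in> S" for x
  proof -
    have "(F has_contour_integral (g (pathfinish (linepath 0 x)) - g (pathstart (linepath 0 x)))) (linepath 0 x)"
    proof (rule contour_integral_primitive[of S])
      show "path_image (linepath 0 x) \<subseteq> S" using seg[OF x] by (simp only: path_image_linepath)
      show "valid_path (linepath 0 x)" by (rule valid_path_linepath)
    qed (rule has_field_derivative_at_within[OF g])
    then have "((\<lambda>s. F (linepath 0 x s) * (x - 0)) has_integral (g x - g 0)) {0..1}"
      by (simp only: has_contour_integral_linepath pathfinish_linepath pathstart_linepath)
    \<comment> \<open>The integrands can differ only at parameter 0, where division by zero in
      \<open>Li2\<close> gives 0 instead of the completed value.\<close>
    then have "((\<lambda>s. Ln (1 - linepath 0 x s) / linepath 0 x s * (x - 0)) has_integral (g x - g 0)) {0..1}"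
      by (rule has_integral_spike_finite[rotated 2, where S = "{0}"])
         (cases "x = 0"; auto simp: F_def f_def linepath_def)+
    then have "((\<lambda>t. Ln (1 - t) / t) has_contour_integral (g x - g 0)) (linepath 0 x)"
      by (subst has_contour_integral_linepath)
    then show ?thesis by (simp add: Li2_def contour_integral_unique)
  qed
  have wS: "w \<in> S" and w0: "w \<noteq> 0" using assms by (auto simp: S_def complex_nonpos_Reals_iff)
  have "((\<lambda>x. g 0 - g x) has_field_derivative - F w) (at w)"
    using g[OF wS] by (auto intro!: derivative_eq_intros)
  then have "(Li2 has_field_derivative - F w) (at w)"
    by (rule has_field_derivative_transform_within_open[OF _ openS wS]) (simp add: Li2)
  then show ?thesis using w0 by (simp add: F_def f_def)
qed

text \<open>The z-derivative of the Bloch-Wigner function, read off from its differential ln|x| d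
  arg(1 - x) - ln|1 - x| d arg x.\<close>

definition bw_deriv :: "complex \<Rightarrow> complex" where
  "bw_deriv x = (\<i> / 2) * (of_real (Re (cLn (1 - x))) * (1 / x) + of_real (Re (cLn x)) * (1 / (1 - x)))"

text \<open>The argument of 1 - x cancels between the dilogarithm and the product term, so that only
  logarithms of moduli survive. The function is real, hence the second component is the conjugate of
  the first.\<close>

lemma has_wirt_bloch_wigner:
  assumes f: "has_wirt f w v p 0" and im: "Im (f w) \<noteq> 0"
  shows "has_wirt (\<lambda>w. of_real (bloch_wigner (f w))) w v (bw_deriv (f w) * p) (cnj (bw_deriv (f w) * p))"
proof -
  define x where "x = f w"
  have x: "x \<noteq> 0" "1 - x \<noteq> 0" "x \<notin> \<real>\<^sub>\<le>\<^sub>0" "1 - x \<notin> \<real>\<^sub>\<le>\<^sub>0"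
    using im by (auto simp: x_def complex_nonpos_Reals_iff complex_eq_iff)
  have L1: "has_wirt (\<lambda>w. cLn (f w)) w v (1 / x * p) (1 / x * 0)"
    unfolding x_def by (rule has_wirt_compose[OF f cLn_has_field_derivative]) (use x in \<open>simp add: x_def\<close>)
  have L2: "has_wirt (\<lambda>w. cLn (1 - f w)) w v (1 / (1 - x) * (0 - p)) (1 / (1 - x) * (0 - 0))"
    unfolding x_def by (rule has_wirt_compose[OF has_wirt_diff[OF has_wirt_const f] cLn_has_field_derivative])
      (use x in \<open>simp add: x_def\<close>)
  have L3: "has_wirt (\<lambda>w. Li2 (f w)) w v (- Ln (1 - x) / x * p) (- Ln (1 - x) / x * 0)"
    unfolding x_def by (rule has_wirt_compose[OF f Li2_has_field_derivative[OF im]])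
  note H = has_wirt_add[OF has_wirt_Im[OF L3] has_wirt_mult[OF has_wirt_Re[OF L1] has_wirt_Im[OF L2]]]
  define R1 R2 I2 where "R1 = complex_of_real (Re (cLn (f w)))" and "R2 = complex_of_real (Re (cLn (1 - f w)))"
    and "I2 = complex_of_real (Im (cLn (1 - f w)))"
  have l1: "Ln (1 - x) = R2 + \<i> * I2"
    using x(2) complex_eq[of "cLn (1 - x)"] by (simp add: R2_def I2_def x_def cLn_def)
  have bw': "bw_deriv (f w) = \<i> / 2 * (R2 / x + R1 / (1 - x))"
    unfolding bw_deriv_def R1_def R2_def by (simp add: x_def)
  have P: "(- Ln (1 - x) / x * p - cnj (- Ln (1 - x) / x * 0)) / (2 * \<i>) +
      (R1 * ((1 / (1 - x) * (0 - p) - cnj (1 / (1 - x) * (0 - 0))) / (2 * \<i>)) +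
       (1 / x * p + cnj (1 / x * 0)) / 2 * I2) = bw_deriv (f w) * p"
    unfolding bw' l1 using x(1,2) by (simp add: field_simps)
  have real: "cnj R1 = R1" "cnj I2 = I2" by (simp_all add: R1_def I2_def)
  have "cnj (bw_deriv (f w) * p) = (cnj (- Ln (1 - x) / x * p) - 0) / (- 2 * \<i>) +
      (R1 * (cnj (1 / (1 - x) * (0 - p)) / (- 2 * \<i>)) + cnj (1 / x * p) / 2 * I2)"
    unfolding P[symmetric] by (simp add: real)
  also have "\<dots> = (- Ln (1 - x) / x * 0 - cnj (- Ln (1 - x) / x * p)) / (2 * \<i>) +
      (R1 * ((1 / (1 - x) * (0 - 0) - cnj (1 / (1 - x) * (0 - p))) / (2 * \<i>)) +
       (1 / x * 0 + cnj (1 / x * p)) / 2 * I2)"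
    by simp
  finally have Q: "(- Ln (1 - x) / x * 0 - cnj (- Ln (1 - x) / x * p)) / (2 * \<i>) +
      (R1 * ((1 / (1 - x) * (0 - 0) - cnj (1 / (1 - x) * (0 - p))) / (2 * \<i>)) +
       (1 / x * 0 + cnj (1 / x * p)) / 2 * I2) = cnj (bw_deriv (f w) * p)" ..
  have bw: "of_real (bloch_wigner y) = complex_of_real (Im (Li2 y)) + of_real (Re (cLn y)) * of_real (Im (cLn (1 - y)))" for y
    by (simp add: bloch_wigner_def Arg_eq_Im_cLn ln_cmod_eq_Re_cLn)
  show ?thesis unfolding bw using H unfolding R1_def[symmetric] I2_def[symmetric] P Q .
qed

lemma has_wirt_inverse:
  assumes "has_wirt f w v p 0" "f w \<noteq> 0"
  shows "has_wirt (\<lambda>w. 1 / f w) w v (- p / (f w)\<^sup>2) 0"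
proof -
  have "((\<lambda>y. 1 / y) has_field_derivative - 1 / (f w)\<^sup>2) (at (f w))"
    using assms(2) by (auto intro!: derivative_eq_intros simp: power2_eq_square)
  from has_wirt_compose[OF assms(1) this] show ?thesis by simp
qed

text \<open>Both \<open>f\<close> and \<open>g\<close> are holomorphic in the moving coordinate, so
  the conjugated expression depends on it holomorphically only through the two logarithmic moduli.
  The other Wirtinger component is left unspecified, as the Hessian takes only this one.\<close>

lemma has_wirt_bw_deriv:
  assumes f: "has_wirt f w u p 0" and g: "has_wirt g w u p' 0" and im: "Im (f w) \<noteq> 0"
  shows "\<exists>q. has_wirt (\<lambda>w. cnj (bw_deriv (f w) * g w)) w u
     (- of_real (Im (f w) / (2 * (cmod (f w))\<^sup>2 * (cmod (1 - f w))\<^sup>2)) * p * cnj (g w)) q"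
proof -
  define x where "x = f w"
  have x: "x \<noteq> 0" "1 - x \<noteq> 0" "x \<notin> \<real>\<^sub>\<le>\<^sub>0" "1 - x \<notin> \<real>\<^sub>\<le>\<^sub>0"
    using im by (auto simp: x_def complex_nonpos_Reals_iff complex_eq_iff)
  have L1: "has_wirt (\<lambda>w. cLn (f w)) w u (1 / x * p) (1 / x * 0)"
    unfolding x_def by (rule has_wirt_compose[OF f cLn_has_field_derivative]) (use x in \<open>simp add: x_def\<close>)
  have f1: "has_wirt (\<lambda>w. 1 - f w) w u (- p) 0"
    using has_wirt_diff[OF has_wirt_const f, of 1] by simp
  have L2: "has_wirt (\<lambda>w. cLn (1 - f w)) w u (1 / (1 - x) * - p) (1 / (1 - x) * 0)"
    unfolding x_def by (rule has_wirt_compose[OF f1 cLn_has_field_derivative])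
      (use x in \<open>simp add: x_def\<close>)
  have I1: "has_wirt (\<lambda>w. 1 / f w) w u (- p / (f w)\<^sup>2) 0"
    using x by (intro has_wirt_inverse f) (simp add: x_def)
  have I2: "has_wirt (\<lambda>w. 1 / (1 - f w)) w u (- (- p) / (1 - f w)\<^sup>2) 0"
    using x by (intro has_wirt_inverse f1) (simp add: x_def)
  note H = has_wirt_cnj[OF has_wirt_mult[OF has_wirt_cmult[OF has_wirt_add[OF has_wirt_mult[OF has_wirt_Re[OF L2] I1] has_wirt_mult[OF has_wirt_Re[OF L1] I2]], of "\<i>/2"] g]]
  define c where "c = cnj x"
  have c: "c \<noteq> 0" "1 - c \<noteq> 0" using x(1,2) by (auto simp: c_def complex_eq_iff)
  have cc: "cnj c = x" by (simp add: c_def)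
  have im_x: "complex_of_real (Im x) = - \<i> / 2 * (x - c)" by (simp add: c_def complex_eq_iff)
  have n1: "complex_of_real ((cmod x)\<^sup>2) = x * c" unfolding c_def by (rule complex_norm_square)
  have n2: "complex_of_real ((cmod (1 - x))\<^sup>2) = (1 - x) * (1 - c)"
    using complex_norm_square[of "1 - x"] by (simp add: c_def)
  define G where "G = complex_of_real (Im (f w) / (2 * (cmod (f w))\<^sup>2 * (cmod (1 - f w))\<^sup>2))"
  have G: "G = - \<i> / 2 * (x - c) / (2 * (x * c) * ((1 - x) * (1 - c)))"
    unfolding G_def x_def[symmetric] of_real_divide of_real_mult im_x n1 n2 by simp
  define K where "K = p / (x * (2 - 2 * c)) - p / ((2 - x * 2) * c)"
  have K: "K = - p / (1 - x) / 2 / c + p / x / 2 / (1 - c)"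
    using x(1,2) c unfolding K_def by (simp add: divide_simps)
  have GK: "- \<i> / 2 * K = - G * p"
    unfolding G K using x(1,2) c by (simp add: divide_simps) (simp add: algebra_simps)
  have "- (\<i> * (K * cnj (g w)) / 2) = (- \<i> / 2 * K) * cnj (g w)" by simp
  then have "- (\<i> * (K * cnj (g w)) / 2) = - G * p * cnj (g w)" unfolding GK .
  moreover have "\<exists>q. has_wirt (\<lambda>w. cnj (bw_deriv (f w) * g w)) w u (- (\<i> * (K * cnj (g w)) / 2)) q"
    using H unfolding bw_deriv_def K_def
    by (intro exI) (simp add: x_def[symmetric] c_def[symmetric] cc mult.assoc)
  ultimately show ?thesis unfolding G_def by (simp only:)
qed

section \<open>Derivatives of edge angles and face volumes\<close>

text \<open>The functions L_v. Numerator and denominator both change sign under exchange of the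
  endpoints, which makes this a function of the unordered edge.\<close>

definition dlog_edge :: "(nat \<Rightarrow> complex) \<Rightarrow> nat \<Rightarrow> nat set \<Rightarrow> complex" where
  "dlog_edge z v e = (of_bool (Min e = v) - of_bool (Max e = v)) / (z (Min e) - z (Max e))"

lemma dlog_edge: "dlog_edge z v {a, b} = (of_bool (a = v) - of_bool (b = v)) / (z a - z b)"
proof (cases "a \<le> b")
  case False
  then have "dlog_edge z v {a, b} = (of_bool (b = v) - of_bool (a = v)) / (z b - z a)"
    by (simp add: dlog_edge_def)
  also have "\<dots> = (of_bool (a = v) - of_bool (b = v)) / (z a - z b)"
    by (subst minus_divide_divide[symmetric]) (simp only: minus_diff_eq)
  finally show ?thesis .
qed (simp add: dlog_edge_def)

lemma has_wirt_coordinate_diff: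
  "has_wirt (\<lambda>w. w a - w b) w v (of_bool (a = v) - of_bool (b = v)) 0"
  using has_wirt_diff[OF has_wirt_coordinate[of a w v] has_wirt_coordinate[of b w v]]
  by (simp only: diff_zero)

text \<open>The angle is the imaginary part of the logarithm of a ratio, whence the factor -i/2 and
  a difference of two L_v. A nonreal ratio stays off the branch cut.\<close>

lemma has_wirt_Arg_ratio:
  assumes "Im ((w b - w c) / (w a - w c)) \<noteq> 0"
  shows "has_wirt (\<lambda>w. of_real (Arg ((w b - w c) / (w a - w c)))) w v
    (- \<i> / 2 * (dlog_edge w v {b, c} - dlog_edge w v {c, a}))
    (cnj (- \<i> / 2 * (dlog_edge w v {b, c} - dlog_edge w v {c, a})))"
proof -
  define X Y where "X = w b - w c" and "Y = w a - w c"
  have XY: "X \<noteq> 0" "Y \<noteq> 0" using assms by (auto simp: X_def Y_def)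
  define dX dY where "dX = (of_bool (b = v) - of_bool (c = v) :: complex)"
    and "dY = (of_bool (a = v) - of_bool (c = v) :: complex)"
  have X: "has_wirt (\<lambda>w. w b - w c) w v dX 0" and Y: "has_wirt (\<lambda>w. w a - w c) w v dY 0"
    unfolding dX_def dY_def by (rule has_wirt_coordinate_diff)+
  have iY: "has_wirt (\<lambda>w. 1 / (w a - w c)) w v (- dY / Y\<^sup>2) 0"
    using has_wirt_inverse[OF Y] XY by (simp add: Y_def)
  have "has_wirt (\<lambda>w. (w b - w c) * (1 / (w a - w c))) w v (X * (- dY / Y\<^sup>2) + dX * (1 / Y)) (X * 0 + 0 * (1 / Y))"
    using has_wirt_mult[OF X iY] by (simp only: X_def Y_def)
  then have Q: "has_wirt (\<lambda>w. (w b - w c) / (w a - w c)) w v (X * (- dY / Y\<^sup>2) + dX * (1 / Y)) 0"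
    by simp
  have "(cLn has_field_derivative (1 / (X / Y))) (at (X / Y))"
    by (rule cLn_has_field_derivative) (use assms in \<open>auto simp: complex_nonpos_Reals_iff X_def Y_def\<close>)
  then have "has_wirt (\<lambda>w. cLn ((w b - w c) / (w a - w c))) w v (1 / (X / Y) * (X * (- dY / Y\<^sup>2) + dX * (1 / Y))) (1 / (X / Y) * 0)"
    by (intro has_wirt_compose[OF Q]) (simp add: X_def Y_def)
  note H = has_wirt_Im[OF this, folded Arg_eq_Im_cLn]
  have e: "1 / (X / Y) * (X * (- dY / Y\<^sup>2) + dX * (1 / Y)) = dX / X - dY / Y"
    using XY by (simp add: field_simps power2_eq_square)
  have d: "dlog_edge w v {b, c} = dX / X"
    unfolding dlog_edge dX_def X_def ..
  have "dlog_edge w v {a, c} = dY / Y"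
    unfolding dlog_edge dY_def Y_def ..
  then have d': "dlog_edge w v {c, a} = dY / Y" by (simp only: insert_commute)
  have i: "x / (2 * \<i>) = - \<i> / 2 * x" "- \<i> / 2 * (0 - x) = \<i> / 2 * x" for x
    by simp_all
  have c: "cnj (- \<i> / 2 * x) = \<i> / 2 * cnj x" for x by simp
  show ?thesis using H unfolding e d d' c mult_zero_right complex_cnj_zero diff_zero i .
qed

lemma has_wirt_theta:
  assumes e: "e = {a, b}" "a < b" and cd: "c = thirdv z T a b" "d = thirdv z T b a"
    and "Im ((z b - z c) / (z a - z c)) \<noteq> 0" "Im ((z a - z d) / (z b - z d)) \<noteq> 0"
  shows "has_wirt (\<lambda>w. complex_of_real (theta z T e w)) z v
     (\<i> / 2 * (dlog_edge z v {b, c} - dlog_edge z v {c, a} + dlog_edge z v {a, d} - dlog_edge z v {d, b}))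
     (cnj (\<i> / 2 * (dlog_edge z v {b, c} - dlog_edge z v {c, a} + dlog_edge z v {a, d} - dlog_edge z v {d, b})))"
proof -
  have "theta z T e w = pi - Arg ((w b - w c) / (w a - w c)) - Arg ((w a - w d) / (w b - w d))" for w
    using e cd by (simp add: theta_def Let_def)
  then have t: "complex_of_real (theta z T e w) = of_real pi - of_real (Arg ((w b - w c) / (w a - w c)))
    - of_real (Arg ((w a - w d) / (w b - w d)))" for w by simp
  have "has_wirt (\<lambda>w. complex_of_real (theta z T e w)) z v
     (0 - - \<i> / 2 * (dlog_edge z v {b, c} - dlog_edge z v {c, a}) - - \<i> / 2 * (dlog_edge z v {a, d} - dlog_edge z v {d, b}))
     (0 - cnj (- \<i> / 2 * (dlog_edge z v {b, c} - dlog_edge z v {c, a})) - cnj (- \<i> / 2 * (dlog_edge z v {a, d} - dlog_edge z v {d, b})))"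
    unfolding t by (intro has_wirt_diff has_wirt_const has_wirt_Arg_ratio assms)
  moreover have "0 - - \<i> / 2 * (p - q) - - \<i> / 2 * (r - s) = \<i> / 2 * (p - q + r - s)" for p q r s
    by (simp add: field_simps)
  moreover have "0 - cnj (- \<i> / 2 * (p - q)) - cnj (- \<i> / 2 * (r - s)) = cnj (\<i> / 2 * (p - q + r - s))" for p q r s
    by (simp add: field_simps)
  ultimately show ?thesis by (simp only:)
qed

section \<open>Shape parameters of faces and the Hessian of the volume\<close>

definition opposite_side :: "(nat \<Rightarrow> complex) \<Rightarrow> nat \<times> nat \<times> nat \<Rightarrow> nat \<Rightarrow> complex" where
  "opposite_side w f v = (case f of (a, b, c) \<Rightarrow>
     of_bool (a = v) * (w c - w b) + of_bool (b = v) * (w a - w c) + of_bool (c = v) * (w b - w a))"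

text \<open>The shape parameter of the ideal tetrahedron spanned by the face and infinity.\<close>

definition face_ratio :: "nat \<times> nat \<times> nat \<Rightarrow> (nat \<Rightarrow> complex) \<Rightarrow> complex" where
  "face_ratio f w = (case f of (a, b, c) \<Rightarrow> (w c - w a) / (w b - w a))"

definition face_ratio_deriv :: "nat \<times> nat \<times> nat \<Rightarrow> nat \<Rightarrow> (nat \<Rightarrow> complex) \<Rightarrow> complex" where
  "face_ratio_deriv f v w = (case f of (a, b, c) \<Rightarrow> opposite_side w f v * (1 / (w b - w a) * (1 / (w b - w a))))"

lemma has_wirt_face_ratio:
  assumes "w (fst f) \<noteq> w (fst (snd f))"
  shows "has_wirt (face_ratio f) w v (face_ratio_deriv f v w) 0"
proof -
  obtain a b c where f: "f = (a, b, c)" by (cases f)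
  define X Y where "X = w c - w a" and "Y = w b - w a"
  have Y0: "Y \<noteq> 0" using assms by (simp add: f Y_def)
  have X: "has_wirt (\<lambda>w. w c - w a) w v (of_bool (c = v) - of_bool (a = v)) 0"
    and Y: "has_wirt (\<lambda>w. w b - w a) w v (of_bool (b = v) - of_bool (a = v)) 0"
    by (rule has_wirt_coordinate_diff)+
  have iY: "has_wirt (\<lambda>w. 1 / (w b - w a)) w v (- (of_bool (b = v) - of_bool (a = v)) / Y\<^sup>2) 0"
    using has_wirt_inverse[OF Y] Y0 by (simp add: Y_def)
  have "face_ratio f = (\<lambda>w. (w c - w a) * (1 / (w b - w a)))" by (auto simp: face_ratio_def f)
  moreover have "has_wirt (\<lambda>w. (w c - w a) * (1 / (w b - w a))) w v
      (X * (- (of_bool (b = v) - of_bool (a = v)) / Y\<^sup>2) + (of_bool (c = v) - of_bool (a = v)) * (1 / Y)) (X * 0 + 0 * (1 / Y))"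
    using has_wirt_mult[OF X iY] by (simp only: X_def Y_def)
  moreover have "X * (- (of_bool (b = v) - of_bool (a = v)) / Y\<^sup>2) + (of_bool (c = v) - of_bool (a = v)) * (1 / Y)
     = face_ratio_deriv f v w"
  proof -
    have "face_ratio_deriv f v w = (of_bool (a = v) * (X - Y) - of_bool (b = v) * X + of_bool (c = v) * Y) * (1 / Y * (1 / Y))"
      by (simp add: face_ratio_deriv_def opposite_side_def f X_def Y_def algebra_simps)
    moreover have "X * (- (q - p) / Y\<^sup>2) + (r - p) * (1 / Y) = (p * (X - Y) - q * X + r * Y) * (1 / Y * (1 / Y))" for p q r
      using Y0 by (simp add: field_simps power2_eq_square)
    ultimately show ?thesis by simp
  qed
  ultimately show ?thesis by simp
qed

text \<open>Only holomorphy matters; the value of the derivative does not enter the mixed second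
  derivative.\<close>

lemma has_wirt_face_ratio_deriv:
  assumes "w (fst f) \<noteq> w (fst (snd f))"
  shows "\<exists>p. has_wirt (face_ratio_deriv f v) w u p 0"
proof -
  obtain a b c where f: "f = (a, b, c)" by (cases f)
  have D: "\<exists>p. has_wirt (\<lambda>w. w x - w y) w u p 0" for x y
    using has_wirt_coordinate_diff by blast
  have C: "\<exists>p. has_wirt (\<lambda>w. k * (w x - w y)) w u p 0" for x y and k :: complex
  proof -
    obtain p where "has_wirt (\<lambda>w. w x - w y) w u p 0" using D by blast
    from has_wirt_cmult[OF this, of k] show ?thesis unfolding mult_zero_right by blast
  qed
  obtain p1 where p1: "has_wirt (\<lambda>w. of_bool (a = v) * (w c - w b)) w u p1 0" using C by blast
  obtain p2 where p2: "has_wirt (\<lambda>w. of_bool (b = v) * (w a - w c)) w u p2 0" using C by blast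
  obtain p3 where p3: "has_wirt (\<lambda>w. of_bool (c = v) * (w b - w a)) w u p3 0" using C by blast
  from has_wirt_add[OF has_wirt_add[OF p1 p2] p3]
  have S: "has_wirt (\<lambda>w. opposite_side w f v) w u (p1 + p2 + p3) 0" by (simp add: opposite_side_def f)
  obtain q where "has_wirt (\<lambda>w. w b - w a) w u q 0" using D by blast
  from has_wirt_inverse[OF this] assms have "\<exists>r. has_wirt (\<lambda>w. 1 / (w b - w a)) w u r 0"
    unfolding f fst_conv snd_conv by force
  then obtain r where r: "has_wirt (\<lambda>w. 1 / (w b - w a)) w u r 0" ..
  from has_wirt_mult[OF S has_wirt_mult[OF r r]]
  show ?thesis unfolding face_ratio_deriv_def[abs_def] f prod.case by auto
qed

text \<open>The vertex order chosen in \<open>face_vol\<close>, made explicit so that a volume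
  becomes the Bloch-Wigner function of one shape parameter.\<close>

definition listing :: "(nat \<Rightarrow> complex) \<Rightarrow> nat set \<Rightarrow> nat \<times> nat \<times> nat" where
  "listing z t = (let a = Min t; b = Min (t - {a}); c = Max (t - {a}) in
     if ccw (z a) (z b) (z c) then (a, b, c) else (a, c, b))"

lemma face_vol_eq: "face_vol z t w = bloch_wigner (face_ratio (listing z t) w)"
  by (simp add: face_vol_def listing_def Let_def Vol_def face_ratio_def)

lemma ccw_iff_Im_ratio: "ccw a b c \<longleftrightarrow> Im ((c - a) / (b - a)) > 0"
proof (cases "b = a")
  case False
  have "(c - a) / (b - a) = (cnj (b - a) * (c - a)) / of_real ((cmod (b - a))\<^sup>2)"
    using False by (simp add: complex_norm_square mult.commute del: of_real_power)
  then have "Im ((c - a) / (b - a)) = Im (cnj (b - a) * (c - a)) / (cmod (b - a))\<^sup>2"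
    by (simp only: Im_divide_of_real)
  then show ?thesis using False by (simp add: ccw_def zero_less_divide_iff)
qed (simp add: ccw_def)

text \<open>Minus the mixed second derivative of the Bloch-Wigner function at the shape parameter;
  positive for a counterclockwise face.\<close>

definition face_weight :: "nat \<times> nat \<times> nat \<Rightarrow> (nat \<Rightarrow> complex) \<Rightarrow> real" where
  "face_weight f z = Im (face_ratio f z) / (2 * (cmod (face_ratio f z))\<^sup>2 * (cmod (1 - face_ratio f z))\<^sup>2)"

text \<open>Shape parameters are holomorphic in the z_v, so each mixed derivative factors into a
  weight, one derivative and one conjugate derivative. The exterior term involves only fixed points,
  and the minus sign in \<open>A_T\<close> makes the weights positive.\<close>

lemma hess_AT_entry:
  assumes fin: "finite T" and pos: "\<And>t. t \<in> T \<Longrightarrow> Im (face_ratio (listing z t) z) > 0"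
    and uv: "u > 3" "v > 3"
  shows "wirt_z (\<lambda>w. wirt_zbar (\<lambda>w'. complex_of_real (A_T z T w')) w v) z u =
    (\<Sum>t\<in>T. of_real (face_weight (listing z t) z) * face_ratio_deriv (listing z t) u z
       * cnj (face_ratio_deriv (listing z t) v z))"
proof -
  define f where "f = listing z"
  have ne: "w (fst (f t)) \<noteq> w (fst (snd (f t)))" if "Im (face_ratio (f t) w) > 0" for t w
    using that by (auto simp: face_ratio_def split: prod.splits)
  have nomin: "Min {1,2,3::nat} = 1" "Min ({1,2,3} - {1::nat}) = 2" "Max ({1,2,3} - {1::nat}) = 3"
    by (simp_all add: insert_Diff_if)
  have ext: "face_vol z {1,2,3} (w(v := x)) = face_vol z {1,2,3} w" for w x
    using uv unfolding face_vol_def nomin Let_def by simp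
  have A: "complex_of_real (A_T z T w) = - (\<Sum>t\<in>T. of_real (bloch_wigner (face_ratio (f t) w))) + of_real (face_vol z {1,2,3} w)" for w
    by (simp add: A_T_def face_vol_eq f_def)
  define B where "B w = - (\<Sum>t\<in>T. cnj (bw_deriv (face_ratio (f t) w) * face_ratio_deriv (f t) v w))" for w
  have first: "wirt_zbar (\<lambda>w'. complex_of_real (A_T z T w')) w v = B w"
    if pos: "\<And>t. t \<in> T \<Longrightarrow> Im (face_ratio (f t) w) > 0" for w
  proof -
    have "has_wirt (\<lambda>w. complex_of_real (A_T z T w)) w v
      (- (\<Sum>t\<in>T. bw_deriv (face_ratio (f t) w) * face_ratio_deriv (f t) v w) + 0) (B w + 0)"
      unfolding A B_def
    proof (intro has_wirt_add has_wirt_minus has_wirt_sum)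
      fix t assume "t \<in> T"
      then have "Im (face_ratio (f t) w) > 0" by (rule pos)
      then show "has_wirt (\<lambda>w. complex_of_real (bloch_wigner (face_ratio (f t) w))) w v
        (bw_deriv (face_ratio (f t) w) * face_ratio_deriv (f t) v w)
        (cnj (bw_deriv (face_ratio (f t) w) * face_ratio_deriv (f t) v w))"
        using ne by (intro has_wirt_bloch_wigner has_wirt_face_ratio) auto
    qed (rule has_wirt_independent, simp only: ext)
    from has_wirt_imp_wirt_zbar[OF this] show ?thesis by simp
  qed
  have "\<forall>t\<in>T. \<exists>q. has_wirt (\<lambda>w. cnj (bw_deriv (face_ratio (f t) w) * face_ratio_deriv (f t) v w)) z u
     (- of_real (face_weight (f t) z) * face_ratio_deriv (f t) u z * cnj (face_ratio_deriv (f t) v z)) q"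
  proof
    fix t assume "t \<in> T"
    then have im: "Im (face_ratio (f t) z) > 0" using pos by (simp add: f_def)
    obtain p where p: "has_wirt (face_ratio_deriv (f t) v) z u p 0"
      using has_wirt_face_ratio_deriv[OF ne[OF im]] by blast
    have im': "Im (face_ratio (f t) z) \<noteq> 0" using im by simp
    show "\<exists>q. has_wirt (\<lambda>w. cnj (bw_deriv (face_ratio (f t) w) * face_ratio_deriv (f t) v w)) z u
     (- of_real (face_weight (f t) z) * face_ratio_deriv (f t) u z * cnj (face_ratio_deriv (f t) v z)) q"
      unfolding face_weight_def by (rule has_wirt_bw_deriv[OF has_wirt_face_ratio[OF ne[OF im]] p im'])
  qed
  from bchoice[OF this] obtain q where "\<forall>t\<in>T. has_wirt (\<lambda>w. cnj (bw_deriv (face_ratio (f t) w) * face_ratio_deriv (f t) v w)) z u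
     (- of_real (face_weight (f t) z) * face_ratio_deriv (f t) u z * cnj (face_ratio_deriv (f t) v z)) (q t)" ..
  note q = bspec[OF this]
  have "has_wirt B z u (- (\<Sum>t\<in>T. - of_real (face_weight (f t) z) * face_ratio_deriv (f t) u z * cnj (face_ratio_deriv (f t) v z))) (- (\<Sum>t\<in>T. q t))"
    unfolding B_def[abs_def] by (intro has_wirt_minus has_wirt_sum q)
  \<comment> \<open>The inner derivative is known where all triangles are counterclockwise, an open
    condition in the moved point.\<close>
  moreover have "\<forall>\<^sub>F x in nhds (z u). B (z(u := x)) = wirt_zbar (\<lambda>w'. complex_of_real (A_T z T w')) (z(u := x)) v"
  proof -
    have "\<forall>\<^sub>F x in nhds (z u). \<forall>t\<in>T. Im (face_ratio (f t) (z(u := x))) > 0"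
    proof (intro eventually_ball_finite fin ballI)
      fix t assume "t \<in> T"
      then have im: "Im (face_ratio (f t) z) > 0" using pos by (simp add: f_def)
      obtain a b c where abc: "f t = (a, b, c)" by (cases "f t")
      have co: "((\<lambda>x. (z(u := x)) i) \<longlongrightarrow> z i) (nhds (z u))" for i
        by (cases "i = u") (auto simp: filterlim_ident)
      have "((\<lambda>x. Im (((z(u := x)) c - (z(u := x)) a) / ((z(u := x)) b - (z(u := x)) a))) \<longlongrightarrow>
          Im ((z c - z a) / (z b - z a))) (nhds (z u))"
        using ne[OF im] by (intro tendsto_intros co) (auto simp: abc)
      then have "((\<lambda>x. Im (face_ratio (f t) (z(u := x)))) \<longlongrightarrow> Im (face_ratio (f t) z)) (nhds (z u))"
        by (simp only: face_ratio_def abc prod.case)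
      from order_tendstoD(1)[OF this, of 0] im
      show "\<forall>\<^sub>F x in nhds (z u). Im (face_ratio (f t) (z(u := x))) > 0" by simp
    qed
    then show ?thesis by eventually_elim (rule first[symmetric], blast)
  qed
  ultimately have "has_wirt (\<lambda>w. wirt_zbar (\<lambda>w'. complex_of_real (A_T z T w')) w v) z u
     (- (\<Sum>t\<in>T. - of_real (face_weight (f t) z) * face_ratio_deriv (f t) u z * cnj (face_ratio_deriv (f t) v z))) (- (\<Sum>t\<in>T. q t))"
    by (rule has_wirt_transform)
  from has_wirt_imp_wirt_z[OF this] show ?thesis by (simp add: f_def sum_negf)
qed

text \<open>All differences of logarithmic edge derivatives around a face are multiples of one linear form,
  so their exterior products vanish and the Hermitian ones have rank one.\<close>

lemma dlog_edge_diff: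
  assumes "z a \<noteq> z b" "z b \<noteq> z c" "z c \<noteq> z a"
  shows "dlog_edge z v {a, b} - dlog_edge z v {c, a} = opposite_side z (a, b, c) v / ((z a - z b) * (z c - z a))"
    and "dlog_edge z v {b, c} - dlog_edge z v {c, a} = - opposite_side z (a, b, c) v / ((z b - z c) * (z c - z a))"
proof -
  have 1: "(p - q) / (x - y) - (r - p) / (w - x) = (p * (w - y) + q * (x - w) + r * (y - x)) / ((x - y) * (w - x))"
    "(q - r) / (y - w) - (r - p) / (w - x) = - (p * (w - y) + q * (x - w) + r * (y - x)) / ((y - w) * (w - x))"
    if "x \<noteq> y" "y \<noteq> w" "w \<noteq> x" for p q r x y w :: complex
  proof -
    have "(p - q) * (w - x) - (r - p) * (x - y) = p * (w - y) + q * (x - w) + r * (y - x)"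
      "(q - r) * (w - x) - (r - p) * (y - w) = - (p * (w - y) + q * (x - w) + r * (y - x))"
      by (simp_all add: algebra_simps)
    then show "(p - q) / (x - y) - (r - p) / (w - x) = (p * (w - y) + q * (x - w) + r * (y - x)) / ((x - y) * (w - x))"
      "(q - r) / (y - w) - (r - p) / (w - x) = - (p * (w - y) + q * (x - w) + r * (y - x)) / ((y - w) * (w - x))"
      using that by (simp_all add: diff_frac_eq)
  qed
  show "dlog_edge z v {a, b} - dlog_edge z v {c, a} = opposite_side z (a, b, c) v / ((z a - z b) * (z c - z a))"
    "dlog_edge z v {b, c} - dlog_edge z v {c, a} = - opposite_side z (a, b, c) v / ((z b - z c) * (z c - z a))"
    unfolding dlog_edge opposite_side_def prod.case by (rule 1[OF assms])+
qed

text \<open>The part of the skew form that lives on a single face; by \<open>face_form_eq\<close> it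
  is a 2 by 2 determinant of differences.\<close>

definition face_form :: "(nat set \<Rightarrow> complex) \<Rightarrow> (nat set \<Rightarrow> complex) \<Rightarrow> nat \<Rightarrow> nat \<Rightarrow> nat \<Rightarrow> complex" where
  "face_form x y a b c = x {a,b} * (y {b,c} - y {c,a}) + x {b,c} * (y {c,a} - y {a,b}) + x {c,a} * (y {a,b} - y {b,c})"

lemma face_form_eq: "face_form x y a b c =
   (x {a,b} - x {c,a}) * (y {b,c} - y {c,a}) - (x {b,c} - x {c,a}) * (y {a,b} - y {c,a})"
  by (simp add: face_form_def algebra_simps)

lemma face_form_dlog_edge:
  assumes "z a \<noteq> z b" "z b \<noteq> z c" "z c \<noteq> z a"
  shows "face_form (dlog_edge z u) (dlog_edge z v) a b c = 0"
proof -
  have "p / x * (- q / y) - - p / y * (q / x) = 0" for p q x y :: complex by (simp add: mult.commute)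
  then show ?thesis unfolding face_form_eq dlog_edge_diff[OF assms] .
qed

text \<open>The differences are multiples of \<open>S\<close> and \<open>S'\<close>, so a scalar
  identity remains. The conjugate sides get names of their own, and the identity is rational in six
  variables subject to each triple having sum zero.\<close>

lemma face_form_dlog_edge_cnj:
  assumes "z a \<noteq> z b" "z b \<noteq> z c" "z c \<noteq> z a"
  shows "face_form (dlog_edge z u) (\<lambda>e. cnj (dlog_edge z v e)) a b c =
    - 4 * \<i> * (of_real (face_weight (a, b, c) z) * face_ratio_deriv (a, b, c) u z * cnj (face_ratio_deriv (a, b, c) v z))"
proof -
  define A B C where "A = z b - z a" and "B = z c - z b" and "C = z a - z c"
  have nz: "A \<noteq> 0" "B \<noteq> 0" "C \<noteq> 0" using assms by (auto simp: A_def B_def C_def)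
  define S S' where "S = opposite_side z (a, b, c) u" and "S' = cnj (opposite_side z (a, b, c) v)"
  define A' B' C' where "A' = cnj A" and "B' = cnj B" and "C' = cnj C"
  have nz': "A' \<noteq> 0" "B' \<noteq> 0" "C' \<noteq> 0" using nz by (auto simp: A'_def B'_def C'_def)
  have s: "B = - A - C" by (simp add: A_def B_def C_def)
  have s': "B' = - A' - C'" by (simp add: A'_def B'_def C'_def s)
  have AC: "(z a - z b) * (z c - z a) = A * C" and BC: "(z b - z c) * (z c - z a) = B * C"
    by (simp_all add: A_def B_def C_def algebra_simps)
  have d: "dlog_edge z u {a, b} - dlog_edge z u {c, a} = S / (A * C)"
    "dlog_edge z u {b, c} - dlog_edge z u {c, a} = - S / (B * C)"
    unfolding dlog_edge_diff[OF assms] AC BC S_def by simp_all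
  have d': "cnj (dlog_edge z v {a, b}) - cnj (dlog_edge z v {c, a}) = S' / (A' * C')"
    "cnj (dlog_edge z v {b, c}) - cnj (dlog_edge z v {c, a}) = - S' / (B' * C')"
    unfolding complex_cnj_diff[symmetric] dlog_edge_diff[OF assms] AC BC S'_def A'_def B'_def C'_def
    by simp_all
  have r: "face_ratio (a, b, c) z = - C / A" by (simp add: face_ratio_def A_def C_def)
  have r1: "1 - face_ratio (a, b, c) z = - B / A" using nz unfolding r s by (simp add: field_simps)
  have im: "complex_of_real (Im x) = - \<i> / 2 * (x - cnj x)" for x by (simp add: complex_eq_iff)
  have wt: "complex_of_real (face_weight (a, b, c) z) =
     - \<i> / 2 * (- C / A + C' / A') / (2 * (C * C' / (A * A')) * (B * B' / (A * A')))"
    unfolding face_weight_def r1 unfolding r of_real_divide of_real_mult im of_real_power complex_norm_square[unfolded of_real_power]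
    by (simp add: A'_def B'_def C'_def)
  have fd: "face_ratio_deriv (a, b, c) u z = S / (A * A)" "cnj (face_ratio_deriv (a, b, c) v z) = S' / (A' * A')"
    by (simp_all add: face_ratio_deriv_def S_def S'_def A_def A'_def)
  have "- C / A + C' / A' = B / A - B' / A'" unfolding s s' using nz nz' by (simp add: field_simps)
  also have "\<dots> = (A' * B - A * B') / (A * A')" using nz nz' by (simp add: field_simps)
  finally have CA: "- C / A + C' / A' = (A' * B - A * B') / (A * A')" .
  \<comment> \<open>Equal to -2 i times the doubled signed area of the face; it links the
    determinant on the left to the imaginary part of the shape parameter on the right.\<close>
  define U where "U = A * B' - A' * B"
  have CA': "- C / A + C' / A' = - U / (A * A')" unfolding CA U_def by simp
  have "S / (A * C) * (- S' / (B' * C')) - - S / (B * C) * (S' / (A' * C')) =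
     S * S' / (C * C') * (1 / (B * A') - 1 / (A * B'))"
    by (simp add: divide_inverse algebra_simps)
  also have "1 / (B * A') - 1 / (A * B') = U / ((A * A') * (B * B'))"
    using nz nz' unfolding U_def by (simp add: field_simps)
  also have "S * S' / (C * C') * (U / ((A * A') * (B * B'))) =
      - 4 * \<i> * (- \<i> / 2 * (- U / (A * A')) / (2 * (C * C' / (A * A')) * (B * B' / (A * A'))) *
      (S * S' / ((A * A') * (A * A'))))"
  proof -
    have "S * S' / m * (U / (k * n)) =
       - 4 * \<i> * (- \<i> / 2 * (- U / k) / (2 * (m / k) * (n / k)) * (S * S' / (k * k)))"
      if "k \<noteq> 0" "m \<noteq> 0" "n \<noteq> 0" for k m n
      using that by (simp add: field_simps)
    then show ?thesis using nz nz' by simp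
  qed
  also have "S * S' / ((A * A') * (A * A')) = (S / (A * A)) * (S' / (A' * A'))"
    by (simp add: divide_inverse algebra_simps)
  finally show ?thesis unfolding face_form_eq d d' wt fd CA' by (simp only: mult.assoc)
qed

section \<open>Triangulations of a triangle\<close>

text \<open>Twice the signed Euclidean area.\<close>

definition area :: "complex \<Rightarrow> complex \<Rightarrow> complex \<Rightarrow> real" where
  "area a b c = Im (cnj (b - a) * (c - a))"

lemma area_rotate: "area b c a = area a b c"
  by (simp add: area_def algebra_simps)

lemma area_swap: "area b a c = - area a b c"
  by (simp add: area_def algebra_simps)

lemma area_self: "area a b a = 0" "area a b b = 0" "area a a b = 0"
  by (simp_all add: area_def algebra_simps)

lemma ccw_iff_area: "ccw a b c \<longleftrightarrow> area a b c > 0"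
  by (simp add: ccw_def area_def)

lemma cw_iff_area: "cw a b c \<longleftrightarrow> area a b c < 0"
  by (simp add: cw_def area_def)

lemma area_affine:
  assumes "u + v = 1"
  shows "area a b (u *\<^sub>R x + v *\<^sub>R y) = u * area a b x + v * area a b y"
proof -
  have "u *\<^sub>R x + v *\<^sub>R y - a = u *\<^sub>R (x - a) + v *\<^sub>R (y - a)"
  proof -
    have v: "v = 1 - u" using assms by simp
    show ?thesis unfolding v complex_eq_iff by (simp add: algebra_simps)
  qed
  moreover have "cnj d * (u *\<^sub>R e + v *\<^sub>R f) = u *\<^sub>R (cnj d * e) + v *\<^sub>R (cnj d * f)" for d e f
    by (simp only: distrib_left mult_scaleR_right)
  ultimately show ?thesis unfolding area_def by (simp only: plus_complex.sel scaleR_complex.sel)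
qed

lemma convex_area_zero: "convex {x. area a b x = 0}"
  unfolding convex_def by (auto simp: area_affine)

lemma area_zero_imp_collinear:
  assumes "area a b c = 0"
  shows "collinear {a, b, c}"
proof (cases "b = a")
  case False
  define k where "k = Re ((c - a) / (b - a))"
  have "Im ((c - a) / (b - a)) = 0"
    using assms False by (simp add: Im_complex_div_eq_0 area_def mult.commute)
  then have "(c - a) / (b - a) = of_real k" by (simp add: k_def complex_eq_iff)
  then have "c - a = k *\<^sub>R (b - a)" using False by (simp add: field_simps scaleR_conv_of_real)
  then have "collinear {0, b - a, c - a}" unfolding collinear_lemma by blast
  then have "collinear {b, a, c}" by (subst collinear_3) simp
  then show ?thesis by (simp add: insert_commute)
qed simp

lemma area_barycentric:
  assumes "u + v + w = 1"
  shows "area a b (u *\<^sub>R a + v *\<^sub>R b + w *\<^sub>R c) = w * area a b c"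
proof -
  define d e where "d = b - a" and "e = c - a"
  have u: "u = 1 - v - w" using assms by simp
  have "u *\<^sub>R a + v *\<^sub>R b + w *\<^sub>R c - a = v *\<^sub>R d + w *\<^sub>R e"
    unfolding u d_def e_def complex_eq_iff by (simp add: algebra_simps)
  moreover have "cnj d * (v *\<^sub>R d + w *\<^sub>R e) = v *\<^sub>R (cnj d * d) + w *\<^sub>R (cnj d * e)"
    by (simp only: distrib_left mult_scaleR_right)
  moreover have "Im (cnj d * d) = 0" by (simp add: mult.commute)
  ultimately show ?thesis
    unfolding area_def d_def[symmetric] e_def[symmetric] by simp
qed

lemma area_convex_hull_3:
  assumes "x \<in> convex hull {a, b, c}"
  obtains w where "w \<ge> 0" "area a b x = w * area a b c"
proof -
  obtain u v w where "0 \<le> w" "u + v + w = 1" "x = u *\<^sub>R a + v *\<^sub>R b + w *\<^sub>R c"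
    using assms unfolding convex_hull_3 by blast
  then show ?thesis using that area_barycentric by blast
qed

lemma area_convex_hull_edge: "x \<in> convex hull {a, b} \<Longrightarrow> area a b x = 0"
  using hull_minimal[of "{a, b}" "{x. area a b x = 0}" convex] convex_area_zero[of a b]
  by (auto simp: area_self)

text \<open>\<open>\<i> * (b - a)\<close> is the normal to the left of the directed edge. Probe
  points along it from the midpoint detect which triangle lies to the left.\<close>

lemma area_offset: "area a b ((a + b) / 2 + of_real r * (\<i> * (b - a))) = r * (cmod (b - a))\<^sup>2"
proof -
  define d where "d = b - a"
  have "(a + b) / 2 + of_real r * (\<i> * (b - a)) - a = d / 2 + of_real r * (\<i> * d)"
    by (simp add: d_def field_simps)
  then have "area a b ((a + b) / 2 + of_real r * (\<i> * (b - a))) = Im (cnj d * (d / 2 + of_real r * (\<i> * d)))"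
    by (simp only: area_def d_def)
  also have "\<dots> = r * (cmod d)\<^sup>2"
    unfolding cmod_power2 by (simp add: algebra_simps power2_eq_square)
  finally show ?thesis by (simp only: d_def)
qed

lemma ccw_offset_in_triangle:
  assumes "area a b c > 0"
  obtains r0 where "r0 > 0"
    "\<And>r. 0 < r \<Longrightarrow> r \<le> r0 \<Longrightarrow> (a + b) / 2 + of_real r * (\<i> * (b - a)) \<in> convex hull {a, b, c}"
proof -
  define x y where "x = Re ((c - a) / (b - a))" and "y = Im ((c - a) / (b - a))"
  have y: "y > 0" using assms by (simp add: y_def ccw_iff_area ccw_iff_Im_ratio[symmetric])
  have ba: "b \<noteq> a" using assms by (auto simp: area_self)
  have "(c - a) / (b - a) = of_real x + \<i> * of_real y" unfolding x_def y_def by (rule complex_eq)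
  then have c: "c = a + (of_real x + \<i> * of_real y) * (b - a)" using ba by (simp add: field_simps)
  \<comment> \<open>With s = r / y the probe has barycentric coordinates 1/2 + s x - s, 1/2 - s x
    and s; this bound on r keeps all three nonnegative.\<close>
  define r0 where "r0 = y / (2 * (1 + \<bar>x\<bar>))"
  show ?thesis
  proof (rule that)
    show "r0 > 0" using y by (simp add: r0_def)
    fix r assume r: "0 < r" "r \<le> r0"
    define s where "s = r / y"
    have s: "s > 0" "r = s * y" using r y by (simp_all add: s_def)
    have "r * (2 * (1 + \<bar>x\<bar>)) \<le> y" using r(2) by (simp add: r0_def pos_le_divide_eq)
    then have "y * (s * (2 * (1 + \<bar>x\<bar>))) \<le> y * 1" by (simp add: s(2) mult_ac)
    then have s1: "s * (2 * (1 + \<bar>x\<bar>)) \<le> 1" using y mult_le_cancel_left_pos by blast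
    have "s * x \<le> s * \<bar>x\<bar>" "s * (- x) \<le> s * \<bar>x\<bar>"
      using s(1) mult_left_mono[of x "\<bar>x\<bar>" s] mult_left_mono[of "- x" "\<bar>x\<bar>" s] by simp_all
    moreover have "s * (2 * (1 + \<bar>x\<bar>)) = 2 * s + 2 * (s * \<bar>x\<bar>)" by (simp add: algebra_simps)
    ultimately have bounds: "1/2 - s * x \<ge> 0" "1/2 + s * x - s \<ge> 0" using s1 s(1) by linarith+
    have sy: "of_real r = of_real s * (of_real y :: complex)" unfolding s(2) by simp
    have "(a + b) / 2 + of_real r * (\<i> * (b - a)) =
      (1/2 + s * x - s) *\<^sub>R a + (1/2 - s * x) *\<^sub>R b + s *\<^sub>R c"
      unfolding scaleR_conv_of_real sy c by (simp add: field_simps)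
    then show "(a + b) / 2 + of_real r * (\<i> * (b - a)) \<in> convex hull {a, b, c}"
      unfolding convex_hull_3 using bounds s by force
  qed
qed

lemma offset_limit:
  assumes "closed S" "\<And>\<epsilon>. \<epsilon> > 0 \<Longrightarrow> \<exists>r. 0 < r \<and> r < \<epsilon> \<and> m + of_real r * n \<in> S"
  shows "(m::complex) \<in> S"
proof -
  have "\<exists>y\<in>S. dist y m < e" if "e > 0" for e
  proof -
    obtain r where r: "0 < r" "r < e / (1 + cmod n)" "m + of_real r * n \<in> S"
      using assms(2)[of "e / (1 + cmod n)"] \<open>e > 0\<close> by (auto simp: add_pos_nonneg)
    have "dist (m + of_real r * n) m = r * cmod n" using r by (simp add: dist_norm norm_mult)
    also have "\<dots> \<le> r * (1 + cmod n)" using r by simp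
    also have "\<dots> < e" using r(2) by (simp add: pos_less_divide_eq add_pos_nonneg)
    finally show ?thesis using r(3) by blast
  qed
  then show ?thesis using closed_approachable[OF assms(1)] by blast
qed

lemma card_3_obtain:
  assumes "card t = 3" "a \<in> t" "b \<in> t" "a \<noteq> b"
  obtains c where "t = {a, b, c}" "c \<noteq> a" "c \<noteq> b"
proof -
  have fin: "finite t" using assms(1) card.infinite by fastforce
  have "card (t - {a, b}) = 1" using assms fin by (simp add: card_Diff_subset)
  then obtain c where "t - {a, b} = {c}" by (rule card_1_singletonE)
  then have "t = {a, b, c}" "c \<noteq> a" "c \<noteq> b" using assms by auto
  then show ?thesis by (rule that)
qed

section \<open>Neighbouring triangles and connectedness across edges\<close>

locale triangulated_triangle =
  fixes N :: nat and z :: "nat \<Rightarrow> complex" and T :: "nat set set"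
  assumes noncol: "\<not> collinear {z 1, z 2, z 3}"
    and inside: "\<And>v. v \<in> {4..N+3} \<Longrightarrow> z v \<in> interior (convex hull {z 1, z 2, z 3})"
    and T_tri: "is_triangulation z {1..N+3} T"
begin

abbreviation "V \<equiv> {1..N+3}"

abbreviation "ar a b c \<equiv> area (z a) (z b) (z c)"

lemma finite_T: "finite T" using T_tri by (simp add: is_triangulation_def)

lemma triangle_sub: "t \<in> T \<Longrightarrow> t \<subseteq> V" and triangle_card: "t \<in> T \<Longrightarrow> card t = 3"
  and triangle_noncollinear: "t \<in> T \<Longrightarrow> \<not> collinear (z ` t)"
  using T_tri by (auto simp: is_triangulation_def)

lemma triangle_finite: "t \<in> T \<Longrightarrow> finite t"
  using triangle_sub finite_subset by blast

lemma covers: "(\<Union>t\<in>T. convex hull (z ` t)) = convex hull (z ` V)"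
  and face_to_face: "t \<in> T \<Longrightarrow> s \<in> T \<Longrightarrow> convex hull (z ` t) \<inter> convex hull (z ` s) = convex hull (z ` (t \<inter> s))"
  using T_tri by (auto simp: is_triangulation_def)

lemma hull_V: "convex hull (z ` V) = convex hull {z 1, z 2, z 3}"
proof
  have "z v \<in> convex hull {z 1, z 2, z 3}" if "v \<in> V" for v
  proof (cases "v \<ge> 4")
    case True
    then show ?thesis using inside[of v] interior_subset that by auto
  next
    case False
    then have "v = 1 \<or> v = 2 \<or> v = 3" using that by auto
    then show ?thesis by (auto intro: hull_inc)
  qed
  then show "convex hull (z ` V) \<subseteq> convex hull {z 1, z 2, z 3}"
    by (intro hull_minimal) auto
  show "convex hull {z 1, z 2, z 3} \<subseteq> convex hull (z ` V)"
    by (intro hull_mono) auto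
qed

lemma triangle_area:
  assumes "{a, b, c} \<in> T" shows "ar a b c \<noteq> 0"
  using triangle_noncollinear[OF assms] area_zero_imp_collinear[of "z a" "z b" "z c"] by auto

text \<open>Interior points have positive barycentric coordinates, so no further vertex lies on a
  side of the outer triangle.\<close>

lemma outer_area_pos:
  assumes pqo: "{p, q, o'} = {1, 2, 3}" and pos: "ar p q o' > 0" and i: "i \<in> V" "i \<noteq> p" "i \<noteq> q"
  shows "ar p q i > 0"
proof (cases "i = o'")
  case False
  then have "i \<notin> {p, q, o'}" using i by simp
  then have "i \<in> {4..N+3}" unfolding pqo using i(1) by auto
  have eq: "{z p, z q, z o'} = {z 1, z 2, z 3}" using arg_cong[OF pqo, of "image z"] by simp
  have "z i \<in> interior (convex hull {z p, z q, z o'})" unfolding eq using inside \<open>i \<in> {4..N+3}\<close> by blast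
  moreover have "\<not> collinear {z p, z q, z o'}" unfolding eq by (rule noncol)
  ultimately obtain u v w where "0 < w" "u + v + w = 1" "u *\<^sub>R z p + v *\<^sub>R z q + w *\<^sub>R z o' = z i"
    by (subst (asm) interior_convex_hull_3_minimal) auto
  then have "ar p q i = w * ar p q o'" using area_barycentric by metis
  then show ?thesis using \<open>0 < w\<close> pos by simp
qed (use pos in simp)

text \<open>Two triangles to the left of the same edge share a probe point off the edge, while
  meeting face-to-face confines their intersection to the edge.\<close>

lemma neighbour_unique:
  assumes "{a, b, c} \<in> T" "{a, b, c'} \<in> T" "ar a b c > 0" "ar a b c' > 0"
  shows "c = c'"
proof (rule ccontr)
  assume "c \<noteq> c'"
  have ne: "c \<noteq> a" "c \<noteq> b" "c' \<noteq> a" "c' \<noteq> b" using assms(3,4) by (auto simp: area_self)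
  obtain r1 where r1: "r1 > 0" "\<And>r. 0 < r \<Longrightarrow> r \<le> r1 \<Longrightarrow> (z a + z b) / 2 + of_real r * (\<i> * (z b - z a)) \<in> convex hull {z a, z b, z c}"
    using ccw_offset_in_triangle[OF assms(3)] by blast
  obtain r2 where r2: "r2 > 0" "\<And>r. 0 < r \<Longrightarrow> r \<le> r2 \<Longrightarrow> (z a + z b) / 2 + of_real r * (\<i> * (z b - z a)) \<in> convex hull {z a, z b, z c'}"
    using ccw_offset_in_triangle[OF assms(4)] by blast
  define r where "r = min r1 r2"
  have r: "0 < r" "r \<le> r1" "r \<le> r2" using r1(1) r2(1) by (simp_all add: r_def)
  let ?x = "(z a + z b) / 2 + of_real r * (\<i> * (z b - z a))"
  have "?x \<in> convex hull (z ` {a, b, c}) \<inter> convex hull (z ` {a, b, c'})"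
    using r1(2)[OF r(1,2)] r2(2)[OF r(1,3)] by simp
  also have "\<dots> = convex hull (z ` ({a, b, c} \<inter> {a, b, c'}))" by (rule face_to_face[OF assms(1,2)])
  also have "{a, b, c} \<inter> {a, b, c'} = {a, b}" using \<open>c \<noteq> c'\<close> ne by auto
  finally have "area (z a) (z b) ?x = 0" by (intro area_convex_hull_edge) simp
  then have "r * (cmod (z b - z a))\<^sup>2 = 0" unfolding area_offset .
  then have "z b = z a" using r(1) by simp
  then show False using assms(3) by (simp add: area_self)
qed

lemma no_neighbour_outside:
  assumes "{a, b, c} \<in> T" "ar a b c > 0" "{a, b, c'} = {1, 2, 3}" "ar a b c' < 0"
  shows False
proof -
  have "ar b a c' > 0" using assms(4) area_swap[of "z b" "z a" "z c'"] by simp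
  moreover have "c \<in> V" using triangle_sub[OF assms(1)] by simp
  moreover have "c \<noteq> a" "c \<noteq> b" using assms(2) by (auto simp: area_self)
  moreover have "{b, a, c'} = {1, 2, 3}" using assms(3) by (simp add: insert_commute)
  ultimately have "ar b a c > 0" using outer_area_pos[of b a c' c] by blast
  then show False using assms(2) area_swap[of "z b" "z a" "z c"] by simp
qed

lemma midpoint_interior:
  assumes "a \<in> {4..N+3}" "b \<in> V" "z a \<noteq> z b"
  shows "(z a + z b) / 2 \<in> interior (convex hull (z ` V))"
proof -
  have "z a \<in> interior (convex hull (z ` V))" using inside[OF assms(1)] unfolding hull_V .
  moreover have "z b \<in> closure (convex hull (z ` V))"
    using assms(2) closure_subset hull_inc[of "z b" "z ` V"] by blast
  ultimately have "open_segment (z a) (z b) \<subseteq> interior (convex hull (z ` V))"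
    by (intro in_interior_closure_convex_segment convex_convex_hull)
  moreover have "midpoint (z a) (z b) \<in> open_segment (z a) (z b)" using assms(3) by simp
  moreover have "midpoint (z a) (z b) = (z a + z b) / 2"
    by (simp add: midpoint_def scaleR_conv_of_real)
  ultimately show ?thesis by auto
qed

lemma midpoint_not_opposite:
  assumes "ar a b c \<noteq> 0" shows "(z a + z b) / 2 \<notin> convex hull {z b, z c}"
proof
  assume "(z a + z b) / 2 \<in> convex hull {z b, z c}"
  then have "area (z b) (z c) ((z a + z b) / 2) = 0" by (rule area_convex_hull_edge)
  moreover have "(z a + z b) / 2 = (1/2) *\<^sub>R z a + (1/2) *\<^sub>R z b"
    by (simp add: scaleR_conv_of_real add_divide_distrib)
  ultimately have "area (z b) (z c) ((1/2) *\<^sub>R z a + (1/2) *\<^sub>R z b) = 0" by (simp only:)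
  moreover have "area (z b) (z c) ((1/2) *\<^sub>R z a + (1/2) *\<^sub>R z b) = 1/2 * ar b c a + 1/2 * ar b c b"
    by (rule area_affine) simp
  ultimately have "ar b c a = 0" by (simp add: area_self(1))
  then show False using assms area_rotate[of "z b" "z c" "z a"] by simp
qed

text \<open>An endpoint is interior to the hull, so short probes to the left are covered. Some
  triangle contains arbitrarily short ones, hence by closedness the midpoint; meeting
  \<open>t\<close> face-to-face, it must contain the edge.\<close>

lemma neighbour_exists:
  assumes t: "t \<in> T" "a \<in> t" "b \<in> t" "a \<noteq> b" and int: "\<not> {a, b} \<subseteq> {1, 2, 3}"
  obtains c where "{a, b, c} \<in> T" "ar a b c > 0"
proof -
  obtain c0 where c0: "t = {a, b, c0}" "c0 \<noteq> a" "c0 \<noteq> b" using card_3_obtain[OF triangle_card[OF t(1)] t(2,3,4)] .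
  have area0: "ar a b c0 \<noteq> 0" using triangle_area t(1) c0 by simp
  then have zab: "z a \<noteq> z b" by (auto simp: area_self)
  define m n where "m = (z a + z b) / 2" and "n = \<i> * (z b - z a)"
  have abV: "a \<in> V" "b \<in> V" using triangle_sub[OF t(1)] t(2,3) by auto
  have "m \<in> interior (convex hull (z ` V))"
  proof (cases "a \<in> {4..N+3}")
    case True
    then show ?thesis unfolding m_def using midpoint_interior abV zab by blast
  next
    case False
    then have "b \<in> {4..N+3}" using int abV by auto
    then have "(z b + z a) / 2 \<in> interior (convex hull (z ` V))" using midpoint_interior abV zab by metis
    then show ?thesis by (simp add: m_def add.commute)
  qed
  then obtain e where e: "e > 0" "ball m e \<subseteq> convex hull (z ` V)"
    by (auto simp: mem_interior)
  have near: "m + of_real r * n \<in> convex hull (z ` V)" if "0 < r" "r < e / (1 + cmod n)" for r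
  proof -
    have "dist m (m + of_real r * n) = r * cmod n" using that by (simp add: dist_norm norm_mult)
    also have "\<dots> \<le> r * (1 + cmod n)" using that by simp
    also have "\<dots> < e" using that(2) by (simp add: pos_less_divide_eq add_pos_nonneg)
    finally show ?thesis using e(2) by auto
  qed
  have "\<exists>s\<in>T. \<forall>\<epsilon>>0. \<exists>r. 0 < r \<and> r < \<epsilon> \<and> m + of_real r * n \<in> convex hull (z ` s)"
  proof (rule ccontr)
    assume "\<not> ?thesis"
    then have "\<forall>s\<in>T. \<exists>\<epsilon>>0. \<forall>r. 0 < r \<and> r < \<epsilon> \<longrightarrow> m + of_real r * n \<notin> convex hull (z ` s)"
      by blast
    then obtain \<epsilon> where eps: "\<forall>s\<in>T. \<epsilon> s > 0 \<and> (\<forall>r. 0 < r \<and> r < \<epsilon> s \<longrightarrow> m + of_real r * n \<notin> convex hull (z ` s))"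
      by metis
    \<comment> \<open>If each triangle missed all short enough probes, a probe below every one of
      these bounds, yet still in the hull, would be uncovered.\<close>
    define \<delta> where "\<delta> = Min (insert (e / (1 + cmod n)) (\<epsilon> ` T))"
    have "\<delta> > 0" unfolding \<delta>_def using finite_T eps e(1) by (subst Min_gr_iff) (auto simp: add_pos_nonneg)
    have "\<delta> \<le> e / (1 + cmod n)" unfolding \<delta>_def using finite_T by (intro Min_le) auto
    have \<delta>T: "\<delta> \<le> \<epsilon> s" if "s \<in> T" for s unfolding \<delta>_def using finite_T that by (intro Min_le) auto
    have "0 < \<delta>/2" "\<delta>/2 < e / (1 + cmod n)"
      using \<open>\<delta> > 0\<close> \<open>\<delta> \<le> e / (1 + cmod n)\<close> by linarith+
    then have "m + of_real (\<delta>/2) * n \<in> convex hull (z ` V)" by (rule near)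
    then obtain s where s: "s \<in> T" "m + of_real (\<delta>/2) * n \<in> convex hull (z ` s)" unfolding covers[symmetric] by blast
    have "0 < \<delta>/2" "\<delta>/2 < \<epsilon> s" using \<delta>T[OF s(1)] \<open>\<delta> > 0\<close> by auto
    then show False using eps s by blast
  qed
  then obtain s where s: "s \<in> T" and lim: "\<And>\<epsilon>. \<epsilon> > 0 \<Longrightarrow> \<exists>r. 0 < r \<and> r < \<epsilon> \<and> m + of_real r * n \<in> convex hull (z ` s)"
    by blast
  have "closed (convex hull (z ` s))"
    using triangle_finite[OF s] by (intro compact_imp_closed compact_convex_hull finite_imp_compact) auto
  then have "m \<in> convex hull (z ` s)" using offset_limit lim by blast
  moreover have "m \<in> convex hull (z ` t)"
  proof -
    have "midpoint (z a) (z b) \<in> convex hull {z a, z b}" by (simp flip: segment_convex_hull)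
    moreover have "midpoint (z a) (z b) = m" by (simp add: midpoint_def m_def scaleR_conv_of_real)
    ultimately show ?thesis using hull_mono[of "{z a, z b}" "z ` t" convex] t by auto
  qed
  ultimately have m: "m \<in> convex hull (z ` (t \<inter> s))" using face_to_face[OF t(1) s] by blast
  \<comment> \<open>A common face without \<open>a\<close> lies in the edge from \<open>b\<close> to
    \<open>c0\<close>, which does not contain the midpoint.\<close>
  have "a \<in> s"
  proof (rule ccontr)
    assume "a \<notin> s"
    then have "z ` (t \<inter> s) \<subseteq> {z b, z c0}" unfolding c0 by auto
    then have "m \<in> convex hull {z b, z c0}" using m hull_mono by blast
    then show False using midpoint_not_opposite[OF area0] by (simp add: m_def)
  qed
  moreover have "b \<in> s"
  proof (rule ccontr)
    assume "b \<notin> s"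
    then have "z ` (t \<inter> s) \<subseteq> {z a, z c0}" unfolding c0 by auto
    then have "m \<in> convex hull {z a, z c0}" using m hull_mono by blast
    moreover have "ar b a c0 \<noteq> 0" using area0 area_swap[of "z b" "z a" "z c0"] by simp
    ultimately show False using midpoint_not_opposite[of b a c0] by (simp add: m_def add.commute)
  qed
  ultimately obtain d where d: "s = {a, b, d}" using card_3_obtain[OF triangle_card[OF s] _ _ t(4)] by blast
  obtain r where r: "0 < r" "m + of_real r * n \<in> convex hull (z ` s)" using lim[of 1] by auto
  then obtain w where w: "w \<ge> 0" "area (z a) (z b) (m + of_real r * n) = w * ar a b d"
    using area_convex_hull_3[of "m + of_real r * n" "z a" "z b" "z d"] unfolding d by auto
  have "area (z a) (z b) (m + of_real r * n) > 0"
    unfolding m_def n_def area_offset using r zab by simp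
  then have "ar a b d > 0" using w by (simp add: zero_less_mult_iff)
  then show ?thesis using that s d by blast
qed

text \<open>A triangle through the midpoint of a boundary edge must use both endpoints, since all
  other vertices lie strictly on the inner side. This makes the sides of the exterior face edges of
  \<open>T\<close>.\<close>

lemma outer_edge_in_triangle:
  assumes pqo: "{p, q, o'} = {1, 2, 3}" and pos: "ar p q o' > 0"
  obtains t where "t \<in> T" "p \<in> t" "q \<in> t"
proof -
  define m where "m = (z p + z q) / 2"
  have zpq: "z p \<noteq> z q" using pos by (auto simp: area_self)
  have "{p, q} \<subseteq> {1, 2, 3}" unfolding pqo[symmetric] by blast
  also have "\<dots> \<subseteq> V" by simp
  finally have pqV: "p \<in> V" "q \<in> V" by simp_all
  have "midpoint (z p) (z q) \<in> convex hull {z p, z q}" by (simp flip: segment_convex_hull)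
  moreover have mid: "midpoint (z p) (z q) = m" by (simp add: midpoint_def m_def scaleR_conv_of_real)
  moreover have "convex hull {z p, z q} \<subseteq> convex hull (z ` V)" using pqV by (intro hull_mono) auto
  ultimately have "m \<in> convex hull (z ` V)" by auto
  then obtain t where t: "t \<in> T" "m \<in> convex hull (z ` t)" unfolding covers[symmetric] by blast
  have am: "area (z p) (z q) m = 0"
    using area_offset[of "z p" "z q" 0] by (simp add: m_def)
  have key: "x \<in> t" if x: "x = p \<and> y = q \<or> x = q \<and> y = p" for x y
  proof (rule ccontr)
    assume "x \<notin> t"
    \<comment> \<open>An open half-plane with one boundary point added is still convex. If
      \<open>t\<close> missed \<open>x\<close>, its hull would lie in it and could meet the boundary
      line only in \<open>z y\<close>.\<close>
    let ?S = "{u. area (z p) (z q) u > 0} \<union> {z y}"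
    have ay: "area (z p) (z q) (z y) = 0" using x by (auto simp: area_self)
    have "convex ?S"
      unfolding convex_alt
    proof (intro ballI allI impI)
      fix u v k assume uv: "u \<in> ?S" "v \<in> ?S" and k: "0 \<le> k \<and> k \<le> (1::real)"
      have aff: "area (z p) (z q) ((1 - k) *\<^sub>R u + k *\<^sub>R v) = (1 - k) * area (z p) (z q) u + k * area (z p) (z q) v"
        by (rule area_affine) simp
      consider "k = 0" | "k = 1" | "0 < k" "k < 1" using k by linarith
      then show "(1 - k) *\<^sub>R u + k *\<^sub>R v \<in> ?S"
      proof cases
        case 3
        show ?thesis
        proof (cases "u = z y \<and> v = z y")
          case True
          then show ?thesis by (simp add: algebra_simps)
        next
          case False
          then have "area (z p) (z q) u > 0 \<and> area (z p) (z q) v \<ge> 0 \<or> area (z p) (z q) u \<ge> 0 \<and> area (z p) (z q) v > 0"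
            using uv ay by auto
          then have "area (z p) (z q) ((1 - k) *\<^sub>R u + k *\<^sub>R v) > 0"
            unfolding aff using 3 by (auto intro: add_pos_nonneg add_nonneg_pos)
          then show ?thesis by simp
        qed
      qed (use uv in auto)
    qed
    moreover have "z ` t \<subseteq> ?S"
    proof
      fix w assume "w \<in> z ` t"
      then obtain i where i: "i \<in> t" "w = z i" by blast
      then have "i \<in> V" "i \<noteq> x" using triangle_sub[OF t(1)] \<open>x \<notin> t\<close> by auto
      then show "w \<in> ?S" using outer_area_pos[OF pqo pos, of i] i(2) x by (cases "i = y") auto
    qed
    ultimately have "convex hull (z ` t) \<subseteq> ?S" by (simp add: subset_hull)
    then have "m \<in> ?S" using t(2) by blast
    then have "m = z y" using am by simp
    then have "z p = z q" using x by (elim disjE conjE) (simp_all add: m_def)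
    then show False using zpq by simp
  qed
  show ?thesis using that t(1) key by blast
qed

text \<open>Triangles may touch in a vertex alone. Removing the finitely many vertices keeps the
  hull connected, while the parts covered by \<open>K\<close> and by its complement would become
  disjoint closed sets.\<close>

lemma triangles_connected:
  assumes K: "K \<subseteq> T" "K \<noteq> {}" and sep: "\<And>t s. t \<in> K \<Longrightarrow> s \<in> T - K \<Longrightarrow> card (t \<inter> s) \<le> 1"
  shows "K = T"
proof (rule ccontr)
  assume "K \<noteq> T"
  then have K': "T - K \<noteq> {}" using K by blast
  define hulls where "hulls M = (\<Union>t\<in>M. convex hull (z ` t))" for M
  have closed: "closed (hulls M)" if "M \<subseteq> T" for M
    unfolding hulls_def
  proof (intro closed_UN)
    show "finite M" using that finite_T finite_subset by blast
    show "\<forall>t\<in>M. closed (convex hull (z ` t))"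
    proof
      fix t assume "t \<in> M"
      then have "finite (z ` t)" using triangle_finite that by blast
      then show "closed (convex hull (z ` t))"
        by (intro compact_imp_closed compact_convex_hull finite_imp_compact)
    qed
  qed
  define H where "H = convex hull (z ` V) - z ` V"
  have "\<not> collinear (convex hull (z ` V))"
    using noncol collinear_subset[of "convex hull (z ` V)" "{z 1, z 2, z 3}"] unfolding hull_V by (auto intro: hull_inc)
  then have conn: "connected H" unfolding H_def
    by (intro connected_convex_diff_countable convex_convex_hull) auto
  have ne: "hulls M \<inter> H \<noteq> {}" if M: "M \<subseteq> T" "M \<noteq> {}" for M
  proof -
    obtain t where t: "t \<in> M" "t \<in> T" using M by blast
    obtain a b c where abc: "t = {a, b, c}" using triangle_card[OF t(2)] unfolding card_3_iff by blast
    have "z a \<noteq> z b"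
    proof
      assume "z a = z b"
      then have "ar a b c = 0" by (simp add: area_self)
      then show False using triangle_area t(2) unfolding abc by blast
    qed
    \<comment> \<open>A side of a triangle has a point that is not a vertex, so neither part becomes
      empty.\<close>
    then have "uncountable (closed_segment (z a) (z b))" by (rule uncountable_closed_segment)
    moreover have "countable (z ` V)" by simp
    ultimately have "\<not> closed_segment (z a) (z b) \<subseteq> z ` V" using countable_subset[of _ "z ` V"] by blast
    then obtain x where x: "x \<in> closed_segment (z a) (z b)" "x \<notin> z ` V" by blast
    have "x \<in> convex hull (z ` t)"
      using x(1) hull_mono[of "{z a, z b}" "z ` t" convex] abc by (auto simp: segment_convex_hull)
    moreover have "convex hull (z ` t) \<subseteq> convex hull (z ` V)" using triangle_sub[OF t(2)] by (intro hull_mono) auto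
    ultimately have "x \<in> H" using x(2) unfolding H_def by blast
    moreover have "x \<in> hulls M" unfolding hulls_def using t(1) \<open>x \<in> convex hull (z ` t)\<close> by (rule UN_I)
    ultimately show ?thesis by blast
  qed
  have "hulls K \<inter> hulls (T - K) \<inter> H = {}"
  proof (rule ccontr)
    assume "\<not> ?thesis"
    then obtain x t s where x: "x \<in> H" "t \<in> K" "s \<in> T - K" "x \<in> convex hull (z ` t)" "x \<in> convex hull (z ` s)"
      unfolding hulls_def by blast
    then have "t \<in> T" "s \<in> T" using K by auto
    then have "x \<in> convex hull (z ` (t \<inter> s))" using face_to_face[of t s] x by blast
    moreover have "finite (t \<inter> s)" using triangle_finite \<open>t \<in> T\<close> by blast
    then have "t \<inter> s = {} \<or> (\<exists>i. t \<inter> s = {i})" 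
    proof -
      assume fin: "finite (t \<inter> s)"
      have "card (t \<inter> s) = 0 \<or> card (t \<inter> s) = 1" using sep[OF x(2,3)] by linarith
      then show ?thesis using fin by (metis card_0_eq card_1_singletonE)
    qed
    ultimately have "\<exists>i\<in>t. x = z i"
    proof (elim disjE exE)
      assume "x \<in> convex hull (z ` (t \<inter> s))" "t \<inter> s = {}"
      then show ?thesis by simp
    next
      fix i assume "x \<in> convex hull (z ` (t \<inter> s))" "t \<inter> s = {i}"
      then show ?thesis by (intro bexI[of _ i]) (simp, blast)
    qed
    then show False using x(1) triangle_sub[OF \<open>t \<in> T\<close>] by (auto simp: H_def)
  qed
  moreover have "H \<subseteq> hulls K \<union> hulls (T - K)"
  proof -
    have "hulls K \<union> hulls (T - K) = hulls T" using K unfolding hulls_def by blast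
    moreover have "H \<subseteq> hulls T" unfolding H_def hulls_def covers by (rule Diff_subset)
    ultimately show ?thesis by simp
  qed
  moreover have "closed (hulls K)" "closed (hulls (T - K))" using closed K by auto
  moreover have "hulls K \<inter> H \<noteq> {}" "hulls (T - K) \<inter> H \<noteq> {}" using ne[OF K] ne[OF _ K'] by auto
  ultimately show False using connected_closedD[OF conn, of "hulls K" "hulls (T - K)"] by blast
qed

end

section \<open>The sphere obtained by adding the exterior face\<close>

context triangulated_triangle begin

definition darts :: "(nat \<times> nat) set" where
  "darts = {(a, b). {a, b} \<in> edges T}"

text \<open>The condition solved by \<open>thirdv\<close>. The vertices 1, 2, 3 may span an interior
  triangle besides the exterior face; orientation separates the two.\<close>

definition is_face :: "nat \<Rightarrow> nat \<Rightarrow> nat \<Rightarrow> bool" where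
  "is_face a b c \<longleftrightarrow> {a, b, c} \<in> T \<and> ar a b c > 0 \<or> {a, b, c} = {1, 2, 3} \<and> ar a b c < 0"

lemma darts_neq: "(a, b) \<in> darts \<Longrightarrow> a \<noteq> b"
  by (auto simp: darts_def edges_def)

lemma darts_sym: "(a, b) \<in> darts \<Longrightarrow> (b, a) \<in> darts"
  by (simp add: darts_def insert_commute)

lemma dartsI: "t \<in> T \<Longrightarrow> a \<in> t \<Longrightarrow> b \<in> t \<Longrightarrow> a \<noteq> b \<Longrightarrow> (a, b) \<in> darts"
  by (auto simp: darts_def edges_def)

lemma dartsE:
  assumes "(a, b) \<in> darts"
  obtains c where "{a, b, c} \<in> T" "a \<noteq> b" "c \<noteq> a" "c \<noteq> b"
proof -
  obtain t where t: "t \<in> T" "{a, b} \<subseteq> t" using assms by (auto simp: darts_def edges_def)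
  then obtain c where "t = {a, b, c}" "c \<noteq> a" "c \<noteq> b"
    using card_3_obtain[OF triangle_card[OF t(1)] _ _ darts_neq[OF assms]] by blast
  then show ?thesis using that t(1) darts_neq[OF assms] by blast
qed

lemma darts_V: "darts \<subseteq> V \<times> V"
proof
  fix h assume "h \<in> darts"
  then obtain a b where ab: "h = (a, b)" "(a, b) \<in> darts" by (cases h) auto
  then obtain c where "{a, b, c} \<in> T" by (metis dartsE)
  then have "{a, b, c} \<subseteq> V" by (rule triangle_sub)
  then show "h \<in> V \<times> V" unfolding ab(1) by simp
qed

lemma is_face_rotate: "is_face a b c \<Longrightarrow> is_face b c a"
proof -
  have "{b, c, a} = {a, b, c}" by blast
  then show "is_face a b c \<Longrightarrow> is_face b c a"
    unfolding is_face_def area_rotate[of "z b" "z c" "z a"] by simp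
qed

lemma is_face_area: "is_face a b c \<Longrightarrow> ar a b c \<noteq> 0"
  unfolding is_face_def by (elim disjE conjE) linarith+

text \<open>An edge with an endpoint inside has triangles on both sides. An edge between two of 1,
  2, 3 has its triangle on the inner side, where all other vertices are, and the exterior face on
  the other.\<close>

lemma face_exists:
  assumes "(a, b) \<in> darts" shows "\<exists>c. is_face a b c"
proof -
  obtain c where c: "{a, b, c} \<in> T" "a \<noteq> b" "c \<noteq> a" "c \<noteq> b" using assms by (rule dartsE)
  show ?thesis
  proof (cases "{a, b} \<subseteq> {1, 2, 3}")
    case False
    then obtain d where "{a, b, d} \<in> T" "ar a b d > 0"
      using neighbour_exists[OF c(1) _ _ c(2)] by blast
    then show ?thesis unfolding is_face_def by blast
  next
    case True
    then obtain o' where o': "{1, 2, 3} = {a, b, o'}"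
      using card_3_obtain[of "{1, 2, 3::nat}" a b] c(2) by auto
    have "{z a, z b, z o'} = {z 1, z 2, z 3}" using arg_cong[OF o', of "image z"] by simp
    then have "ar a b o' \<noteq> 0" using noncol area_zero_imp_collinear[of "z a" "z b" "z o'"] by auto
    then consider "ar a b o' > 0" | "ar a b o' < 0" by linarith
    then show ?thesis
    proof cases
      case 1
      have "c \<in> V" using triangle_sub[OF c(1)] by simp
      then have "ar a b c > 0" using outer_area_pos[OF o'[symmetric] 1 _ c(3,4)] by blast
      then show ?thesis using c(1) unfolding is_face_def by blast
    next
      case 2
      then show ?thesis using o' unfolding is_face_def by blast
    qed
  qed
qed

lemma face_unique:
  assumes "is_face a b c" "is_face a b c'" shows "c = c'"
proof -
  have outer: "c = c'" if "{a, b, c} = {1, 2, 3}" "{a, b, c'} = {1, 2, 3}" "ar a b c < 0" "ar a b c' < 0"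
  proof -
    have "c \<noteq> a" "c \<noteq> b" "c \<in> {a, b, c'}" using that by (auto simp: area_self)
    then show ?thesis by simp
  qed
  from assms show ?thesis
    unfolding is_face_def
  proof (elim disjE conjE)
    assume "{a, b, c} \<in> T" "ar a b c > 0" "{a, b, c'} \<in> T" "ar a b c' > 0"
    then show ?thesis by (intro neighbour_unique)
  next
    assume "{a, b, c} \<in> T" "ar a b c > 0" "{a, b, c'} = {1, 2, 3}" "ar a b c' < 0"
    then have False by (rule no_neighbour_outside)
    then show ?thesis ..
  next
    assume "{a, b, c} = {1, 2, 3}" "ar a b c < 0" "{a, b, c'} \<in> T" "ar a b c' > 0"
    then have False using no_neighbour_outside[of a b c' c] by simp
    then show ?thesis ..
  next
    assume "{a, b, c} = {1, 2, 3}" "ar a b c < 0" "{a, b, c'} = {1, 2, 3}" "ar a b c' < 0"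
    then show ?thesis by (intro outer)
  qed
qed

abbreviation "nxt \<equiv> thirdv z T"

lemma nxt_eq: "is_face a b c \<Longrightarrow> nxt a b = c"
proof -
  assume f: "is_face a b c"
  have "nxt a b = (THE c. is_face a b c)"
    unfolding thirdv_def is_face_def ccw_iff_area cw_iff_area ..
  also have "\<dots> = c" using f face_unique[OF _ f] by (rule the_equality)
  finally show ?thesis .
qed

lemma nxt_face: "(a, b) \<in> darts \<Longrightarrow> is_face a b (nxt a b)"
  using face_exists[of a b] nxt_eq[of a b] by fastforce

lemma nxt_nxt: "(a, b) \<in> darts \<Longrightarrow> nxt b (nxt a b) = a"
  by (rule nxt_eq[OF is_face_rotate[OF nxt_face]])

lemma nxt_darts: assumes "(a, b) \<in> darts" shows "(b, nxt a b) \<in> darts"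
proof -
  define c where "c = nxt a b"
  have f: "is_face a b c" using nxt_face[OF assms] by (simp add: c_def)
  then have "ar a b c \<noteq> 0" by (rule is_face_area)
  then have "c \<noteq> b" by (auto simp: area_self)
  from f have "(b, c) \<in> darts" unfolding is_face_def
  proof (elim disjE conjE)
    assume "{a, b, c} \<in> T"
    then show ?thesis using \<open>c \<noteq> b\<close>[symmetric] by (intro dartsI[of "{a, b, c}" b c]) simp_all
  next
    assume pqo: "{a, b, c} = {1, 2, 3}" and neg: "ar a b c < 0"
    have "ar c b a > 0"
      using neg area_swap[of "z c" "z b" "z a"] area_rotate[of "z b" "z c" "z a"] by linarith
    have "{c, b, a} = {a, b, c}" by blast
    then have "{c, b, a} = {1, 2, 3}" using pqo by (rule trans)
    then obtain t where "t \<in> T" "c \<in> t" "b \<in> t"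
      using \<open>ar c b a > 0\<close> by (rule outer_edge_in_triangle)
    then show ?thesis using \<open>c \<noteq> b\<close>[symmetric] by (intro dartsI[of t b c])
  qed
  then show ?thesis by (simp add: c_def)
qed

text \<open>Rotation and reversal produce all six darts of a triangle from one, so triangles sharing
  an edge are reached together. The darts of the exterior face are among these.\<close>

lemma faces_connected:
  assumes S: "S \<subseteq> darts" "S \<noteq> {}" and rev: "\<And>a b. (a, b) \<in> S \<Longrightarrow> (b, a) \<in> S"
    and nxt: "\<And>a b. (a, b) \<in> S \<Longrightarrow> (b, nxt a b) \<in> S"
  shows "S = darts"
proof -
  define K where "K = {t\<in>T. \<exists>a b. (a, b) \<in> S \<and> {a, b} \<subseteq> t}"
  have positive: "(b, c) \<in> S \<and> (c, a) \<in> S" if "(a, b) \<in> S" "{a, b, c} \<in> T" "ar a b c > 0" for a b c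
  proof -
    have "is_face a b c" using that by (simp add: is_face_def)
    then have "nxt a b = c" "nxt b c = a" using nxt_eq[of a b c] nxt_eq[OF is_face_rotate[of a b c]] by simp_all
    then show ?thesis using nxt[OF that(1)] nxt[of b c] by auto
  qed
  have all: "(x, y) \<in> S" if tK: "t \<in> K" and xy: "x \<in> t" "y \<in> t" "x \<noteq> y" for t x y
  proof -
    obtain a b where ab: "(a, b) \<in> S" "a \<in> t" "b \<in> t" "t \<in> T" using tK by (auto simp: K_def)
    then have "a \<noteq> b" using S darts_neq by blast
    then obtain c where c: "t = {a, b, c}" using card_3_obtain[OF triangle_card[OF ab(4)] ab(2,3)] by blast
    have "ar a b c \<noteq> 0" using triangle_area ab(4) c by simp
    then consider "ar a b c > 0" | "ar b a c > 0" using area_swap[of "z b" "z a" "z c"] by linarith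
    then have "(b, c) \<in> S \<and> (c, a) \<in> S \<or> (a, c) \<in> S \<and> (c, b) \<in> S"
    proof cases
      case 1 then show ?thesis using positive[OF ab(1)] ab(4) c by blast
    next
      case 2
      have "{b, a, c} \<in> T" using ab(4) unfolding c by (simp add: insert_commute)
      then show ?thesis using positive[OF rev[OF ab(1)] _ 2] by blast
    qed
    then have "(a, b) \<in> S" "(b, a) \<in> S" "(b, c) \<in> S" "(c, b) \<in> S" "(a, c) \<in> S" "(c, a) \<in> S"
      using ab(1) rev by blast+
    then show ?thesis using xy unfolding c by blast
  qed
  have edge_t: "\<exists>t\<in>T. a \<in> t \<and> b \<in> t" if "(a, b) \<in> darts" for a b
    using that by (auto simp: darts_def edges_def)
  have "K = T"
  proof (rule triangles_connected)
    show "K \<subseteq> T" by (auto simp: K_def)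
    obtain a b where "(a, b) \<in> S" using S(2) by auto
    moreover obtain t where "t \<in> T" "a \<in> t" "b \<in> t" using edge_t S(1) calculation by blast
    ultimately have "t \<in> K" unfolding K_def by blast
    then show "K \<noteq> {}" by blast
    show "card (t \<inter> s) \<le> 1" if "t \<in> K" "s \<in> T - K" for t s
    proof (rule ccontr)
      assume "\<not> card (t \<inter> s) \<le> 1"
      then have "\<exists>x y. x \<in> t \<inter> s \<and> y \<in> t \<inter> s \<and> x \<noteq> y"
        by (metis One_nat_def card_le_Suc0_iff_eq card.infinite zero_le)
      then obtain x y where "x \<in> t" "y \<in> t" "x \<in> s" "y \<in> s" "x \<noteq> y" by blast
      then have "s \<in> K" using all[OF that(1)] that(2) unfolding K_def by blast
      then show False using that(2) by blast
    qed
  qed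
  have "(a, b) \<in> S" if "(a, b) \<in> darts" for a b
    using edge_t[OF that] all \<open>K = T\<close> darts_neq[OF that] by blast
  then show ?thesis using S(1) by auto
qed

lemma card_darts: "card {(a, b) \<in> darts. a < b} = card (edges T)"
proof (rule bij_betw_same_card[of "\<lambda>(a, b). {a, b}"])
  show "bij_betw (\<lambda>(a, b). {a, b}) {(a, b) \<in> darts. a < b} (edges T)"
    unfolding bij_betw_def
  proof
    show "inj_on (\<lambda>(a, b). {a, b}) {(a, b) \<in> darts. a < b}"
      by (auto simp: inj_on_def doubleton_eq_iff)
    show "(\<lambda>(a, b). {a, b}) ` {(a, b) \<in> darts. a < b} = edges T"
    proof
      show "edges T \<subseteq> (\<lambda>(a, b). {a, b}) ` {(a, b) \<in> darts. a < b}"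
      proof
        fix e assume e: "e \<in> edges T"
        then have "card e = 2" by (simp add: edges_def)
        then obtain a b where ab: "e = {a, b}" "a \<noteq> b" by (auto simp: card_2_iff)
        then consider "a < b" | "b < a" by linarith
        then show "e \<in> (\<lambda>(a, b). {a, b}) ` {(a, b) \<in> darts. a < b}"
        proof cases
          case 1
          then have "(a, b) \<in> {(a, b) \<in> darts. a < b}" using e ab by (simp add: darts_def)
          then show ?thesis unfolding ab(1) by (rule rev_image_eqI) simp
        next
          case 2
          then have "(b, a) \<in> {(a, b) \<in> darts. a < b}" using e ab by (simp add: darts_def insert_commute)
          then show ?thesis unfolding ab(1) by (rule rev_image_eqI) (simp add: insert_commute)
        qed
      qed
    qed (auto simp: darts_def)
  qed
qed

lemma edges_darts: "{{a, b} | a b. (a, b) \<in> darts} = edges T"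
proof
  show "edges T \<subseteq> {{a, b} | a b. (a, b) \<in> darts}"
  proof
    fix e assume e: "e \<in> edges T"
    then have "card e = 2" by (simp add: edges_def)
    then obtain a b where "e = {a, b}" by (auto simp: card_2_iff)
    then show "e \<in> {{a, b} | a b. (a, b) \<in> darts}" using e by (auto simp: darts_def)
  qed
qed (auto simp: darts_def)

lemma finite_edges: "finite (edges T)"
proof (rule finite_subset)
  show "edges T \<subseteq> Pow V" using triangle_sub by (auto simp: edges_def)
qed simp

text \<open>Euler's relation is the count 2N + (N + 3) = 3(N + 3) - 6 of the edges, and the vertices
  are connected because the complement of \<open>E0\<close> is.\<close>

lemma dart_map_crst:
  assumes E0: "E0 \<subseteq> edges T" "card E0 = 2 * N" and crst: "is_crst V (edges T) (edges T - E0)"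
    and odd: "has_odd_cycle (edges T - E0)"
  shows "dart_map_crst V darts nxt (edges T - E0)"
proof -
  have finE0: "finite E0" using E0(1) finite_edges finite_subset by blast
  have cC: "card (edges T - E0) = N + 3" using crst by (simp add: is_crst_def)
  moreover have "card (edges T - E0) = card (edges T) - 2 * N"
    using card_Diff_subset[OF finE0 E0(1)] E0(2) by simp
  ultimately have cE: "card (edges T) = 3 * N + 3" by linarith
  have conn: "(a, b) \<in> (adj_rel (edges T - E0))\<^sup>*" if "a \<in> V" "b \<in> V" for a b
    using crst that by (auto simp: is_crst_def)
  interpret dart_map V darts nxt
  proof unfold_locales
    show "(b, nxt a b) \<in> darts" "nxt b (nxt a b) = a" if "(a, b) \<in> darts" for a b
      using nxt_darts nxt_nxt that by auto
    show "S = V" if S: "S \<subseteq> V" "S \<noteq> {}" "\<And>a b. a \<in> S \<Longrightarrow> (a, b) \<in> darts \<Longrightarrow> b \<in> S" for S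
    proof -
      obtain a where a: "a \<in> S" using S(2) by blast
      have "b \<in> S" if "b \<in> V" for b
      proof -
        have "(a, b) \<in> (adj_rel (edges T - E0))\<^sup>*" using conn a S(1) that by blast
        then show ?thesis
        proof (induction rule: rtrancl_induct)
          case (step x y)
          then show ?case using S(3)[of x y] by (auto simp: adj_rel_def darts_def)
        qed (rule a)
      qed
      then show ?thesis using S(1) by blast
    qed
    show "darts \<noteq> {}"
    proof
      assume "darts = {}"
      then have "card (edges T) = 0" using card_darts by simp
      then show False using cE by simp
    qed
    show "card {(a, b) \<in> darts. a < b} + 6 = 3 * card V"
      unfolding card_darts cE by simp
  qed (use darts_V darts_neq darts_sym faces_connected in auto)
  have es: "edge_set = edges T" by (simp only: edge_set_def edges_darts)
  show ?thesis
    by unfold_locales (use es cC conn odd in auto)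
qed

lemma listing:
  assumes "t \<in> T" "listing z t = (a, b, c)"
  shows "t = {a, b, c}" "ar a b c > 0"
proof -
  have fin: "finite t" "card t = 3" using triangle_finite triangle_card assms(1) by auto
  define x where "x = Min t"
  have x: "x \<in> t" unfolding x_def using fin by (intro Min_in) auto
  have c2: "card (t - {x}) = 2" "finite (t - {x})" using fin x by auto
  define y w where "y = Min (t - {x})" and "w = Max (t - {x})"
  obtain p q where pq: "t - {x} = {p, q}" "p \<noteq> q" using c2(1) unfolding card_2_iff by blast
  have yw: "t - {x} = {y, w}"
    unfolding y_def w_def pq(1) by (cases "p \<le> q") (simp_all add: insert_commute)
  have t: "t = {x, y, w}" using x yw by blast
  have "ar x y w \<noteq> 0" using triangle_area assms(1) t by simp
  moreover have "ar x w y = - ar x y w"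
    using area_swap[of "z x" "z w" "z y"] area_rotate[of "z w" "z x" "z y"] area_rotate[of "z x" "z y" "z w"] by linarith
  moreover have "listing z t = (if ar x y w > 0 then (x, y, w) else (x, w, y))"
    unfolding listing_def Let_def x_def[symmetric] y_def[symmetric] w_def[symmetric] ccw_iff_area ..
  ultimately show "t = {a, b, c}" "ar a b c > 0"
    using assms(2) t by (auto split: if_splits simp: insert_commute)
qed

text \<open>A corner is weighted by the value of \<open>x\<close> on its dart, so the exterior face
  contributes nothing. Every other dart has a counterclockwise triangle on its left, and these darts
  come in threes.\<close>

lemma sum_corners:
  assumes fin: "finite darts"
    and x: "\<And>a b. a \<in> {1, 2, 3} \<Longrightarrow> b \<in> {1, 2, 3} \<Longrightarrow> x {a, b} = (0::complex)"
  shows "(\<Sum>(a,b)\<in>darts. x {a, b} * (y {b, nxt a b} - y {nxt a b, a})) =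
    (\<Sum>t\<in>T. case listing z t of (a, b, c) \<Rightarrow> face_form x y a b c)"
proof -
  define h where "h = (\<lambda>(a,b). x {a, b} * (y {b, nxt a b} - y {nxt a b, a}))"
  define I where "I = {(a, b) \<in> darts. {a, b, nxt a b} \<in> T \<and> ar a b (nxt a b) > 0}"
  define g where "g = (\<lambda>(a,b). {a, b, nxt a b})"
  have I: "I \<subseteq> darts" "finite I" using fin by (auto simp: I_def intro: finite_subset)
  have "sum h darts = sum h I"
  proof (rule sum.mono_neutral_right[OF fin I(1)], rule ballI)
    fix d assume d: "d \<in> darts - I"
    obtain a b where ab: "d = (a, b)" by (cases d)
    have "is_face a b (nxt a b)" using nxt_face d ab by blast
    then have "{a, b, nxt a b} = {1, 2, 3}" using d ab unfolding is_face_def I_def by blast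
    then have "a \<in> {1, 2, 3}" "b \<in> {1, 2, 3}" by blast+
    then show "h d = 0" using x by (simp add: h_def ab)
  qed
  also have "\<dots> = (\<Sum>t\<in>T. sum h {d \<in> I. g d = t})"
    by (rule sum.group[symmetric, OF I(2) finite_T]) (auto simp: I_def g_def)
  also have "\<dots> = (\<Sum>t\<in>T. case listing z t of (a, b, c) \<Rightarrow> face_form x y a b c)"
  proof (rule sum.cong)
    fix t assume t: "t \<in> T"
    obtain a b c where abc: "listing z t = (a, b, c)" by (cases "listing z t")
    note l = listing[OF t abc]
    have ne: "a \<noteq> b" "b \<noteq> c" "c \<noteq> a" using l(2) by (auto simp: area_self)
    have f: "is_face a b c" "is_face b c a" "is_face c a b"
      using l t is_face_rotate unfolding is_face_def by auto
    note n = nxt_eq[OF f(1)] nxt_eq[OF f(2)] nxt_eq[OF f(3)]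
    have pos: "ar a b c > 0" "ar b c a > 0" "ar c a b > 0"
      using l(2) area_rotate[of "z b" "z c" "z a"] area_rotate[of "z c" "z a" "z b"] by linarith+
    have rot: "{b, c, a} = t" "{c, a, b} = t" using l(1) by auto
    have "{d \<in> I. g d = t} = {(a, b), (b, c), (c, a)}"
    proof
      show "{(a, b), (b, c), (c, a)} \<subseteq> {d \<in> I. g d = t}"
        using pos t ne rot l(1) dartsI[OF t, of a b] dartsI[OF t, of b c] dartsI[OF t, of c a]
        by (simp add: I_def g_def n)
      show "{d \<in> I. g d = t} \<subseteq> {(a, b), (b, c), (c, a)}"
      proof
        fix d assume d: "d \<in> {d \<in> I. g d = t}"
        obtain p q where pq: "d = (p, q)" by (cases d)
        have dart: "(p, q) \<in> darts" and T': "{p, q, nxt p q} = t" and pos': "ar p q (nxt p q) > 0"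
          using d by (auto simp: pq I_def g_def)
        have "p \<noteq> q" using darts_neq[OF dart] .
        moreover have "p \<in> {a, b, c}" "q \<in> {a, b, c}" unfolding l(1)[symmetric] T'[symmetric] by auto
        \<comment> \<open>A dart against the orientation of \<open>t\<close> would see
          \<open>t\<close> with negative area, so \<open>t\<close> is not its left face.\<close>
        moreover have "\<not> ((p, q) = (v, u))" if "(u, v, k) \<in> {(a, b, c), (b, c, a), (c, a, b)}" for u v k
        proof
          assume e: "(p, q) = (v, u)"
          have uv: "ar u v k > 0" "{u, v, k} = t" "u \<noteq> v" "k \<noteq> u" "k \<noteq> v"
            using that pos rot l(1) ne by auto
          define m where "m = nxt p q"
          have "m \<noteq> p" "m \<noteq> q" using pos' by (auto simp: m_def area_self)
          moreover have "m \<in> t" unfolding T'[symmetric] m_def by simp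
          ultimately have "m = k" using e uv(2) by auto
          then have "ar v u k > 0" using pos' e by (simp add: m_def)
          then show False using uv(1) area_swap[of "z v" "z u" "z k"] by simp
        qed
        ultimately show "d \<in> {(a, b), (b, c), (c, a)}" unfolding pq by blast
      qed
    qed
    then have "sum h {d \<in> I. g d = t} = h (a, b) + (h (b, c) + h (c, a))"
      using ne by simp
    also have "\<dots> = face_form x y a b c"
      by (simp add: h_def n face_form_def insert_commute)
    finally show "sum h {d \<in> I. g d = t} = (case listing z t of (a, b, c) \<Rightarrow> face_form x y a b c)"
      by (simp add: abc)
  qed simp
  finally show ?thesis unfolding h_def .
qed

text \<open>The face on the left is nondegenerate, also when it is the exterior one, so
  \<open>Arg\<close> is evaluated off its branch cut.\<close>

lemma dart_ratio:
  assumes "(a, b) \<in> darts"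
  shows "Im ((z b - z (nxt a b)) / (z a - z (nxt a b))) \<noteq> 0"
proof -
  define c where "c = nxt a b"
  have "ar a b c \<noteq> 0" unfolding c_def by (rule is_face_area[OF nxt_face[OF assms]])
  then have "ar c a b \<noteq> 0" "ar c b a \<noteq> 0"
    using area_rotate[of "z a" "z b" "z c"] area_rotate[of "z c" "z a" "z b"] area_swap[of "z c" "z b" "z a"] area_rotate[of "z b" "z c" "z a"] by linarith+
  then consider "ar c a b > 0" | "ar c b a > 0"
    using area_swap[of "z c" "z b" "z a"] area_rotate[of "z c" "z a" "z b"] area_rotate[of "z b" "z c" "z a"] by linarith
  then have "Im ((z b - z c) / (z a - z c)) \<noteq> 0"
  proof cases
    case 1
    then show ?thesis using ccw_iff_Im_ratio[of "z c" "z a" "z b"] by (simp add: ccw_iff_area)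
  next
    case 2
    then have "Im ((z a - z c) / (z b - z c)) > 0"
      using ccw_iff_Im_ratio[of "z c" "z b" "z a"] by (simp add: ccw_iff_area)
    then have "Im (inverse ((z a - z c) / (z b - z c))) \<noteq> 0"
      by (auto simp: Im_inverse[of "(z a - z c) / (z b - z c)"] simp del: inverse_divide) 
    then show ?thesis by simp
  qed
  then show ?thesis by (simp add: c_def)
qed

end

theorem theorem6:
  fixes N :: nat and z :: "nat \<Rightarrow> complex" and T E0 :: "nat set set"
  defines "V \<equiv> {1..N+3}"
  assumes noncol: "\<not> collinear {z 1, z 2, z 3}"
    and inside: "\<forall>v\<in>{4..N+3}. z v \<in> interior (convex hull {z 1, z 2, z 3})"
    and distinct: "inj_on z V"
    and T_tri: "is_triangulation z V T" and T_del: "is_delaunay z V T"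
    and T_unique: "\<forall>T'. is_triangulation z V T' \<and> is_delaunay z V T' \<longrightarrow> T' = T"
    and E0_sub: "E0 \<subseteq> edges T" and E0_card: "card E0 = 2 * N"
    and crst: "is_crst V (edges T) (edges T - E0)"
    and odd: "has_odd_cycle (edges T - E0)"
  shows "complex_of_real (D_T_red N z T E0) = 2 ^ N * det (hess_AT N z T)"
proof -
  interpret triangulated_triangle N z T
    using noncol inside T_tri unfolding V_def by unfold_locales auto
  interpret dart_map_crst V darts nxt "edges T - E0"
    using dart_map_crst[OF E0_sub E0_card] crst odd unfolding V_def by blast
  have complement: "edge_set - (edges T - E0) = E0"
    unfolding edge_set_def edges_darts using E0_sub by blast
  \<comment> \<open>The same choice as in \<open>Jprime\<close>, so that the matrices agree entry by
    entry.\<close>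
  define es where "es = (SOME es. bij_betw es {..<2*N} E0)"
  have "finite E0" using E0_sub finite_edges finite_subset by blast
  then have "\<exists>es. bij_betw es {..<2*N} E0"
    using ex_bij_betw_nat_finite[of E0] E0_card by (simp add: lessThan_atLeast0)
  then have bij: "bij_betw es {..<2*N} E0" unfolding es_def by (rule someI_ex)
  define L where "L i = dlog_edge z (i + 4)" for i
  define M where "M = hess_AT N z T"
  define s where "s t i = face_ratio_deriv (listing z t) (i + 4) z" for t i
  have pos: "Im (face_ratio (listing z t) z) > 0" if "t \<in> T" for t
  proof -
    obtain a b c where abc: "listing z t = (a, b, c)" by (cases "listing z t")
    then have "ccw (z a) (z b) (z c)" using listing(2)[OF that] by (simp add: ccw_iff_area)
    then show ?thesis unfolding abc face_ratio_def prod.case ccw_iff_Im_ratio .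
  qed
  have M_eq: "M = mat N N (\<lambda>(i,j). \<Sum>t\<in>T. of_real (face_weight (listing z t) z) * s t i * cnj (s t j))"
    unfolding M_def hess_AT_def
  proof (rule cong_mat[OF refl refl])
    fix i j
    show "(case (i, j) of (i, j) \<Rightarrow> wirt_z (\<lambda>w. wirt_zbar (\<lambda>w'. complex_of_real (A_T z T w')) w (j + 4)) z (i + 4)) =
      (case (i, j) of (i, j) \<Rightarrow> \<Sum>t\<in>T. of_real (face_weight (listing z t) z) * s t i * cnj (s t j))"
      unfolding prod.case s_def by (rule hess_AT_entry[OF finite_T pos]) simp_all
  qed
  \<comment> \<open>Index i stands for the vertex i + 4; the points 1, 2, 3 do not move, so no edge
    between them contributes.\<close>
  have zero: "L i {a, b} = 0" if "a \<in> {1, 2, 3}" "b \<in> {1, 2, 3}" for i a b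
  proof -
    have "a \<noteq> i + 4" "b \<noteq> i + 4" using that by auto
    then show ?thesis by (simp add: L_def dlog_edge)
  qed
  have face: "z a \<noteq> z b \<and> z b \<noteq> z c \<and> z c \<noteq> z a" if "t \<in> T" "listing z t = (a, b, c)" for t a b c
  proof -
    have "ar a b c > 0" using listing(2)[OF that] .
    then show ?thesis using area_self[of "z a"] area_self[of "z b"] by (metis less_irrefl)
  qed
  have faces: "pairing (L i) y = (\<Sum>t\<in>T. case listing z t of (a, b, c) \<Rightarrow> face_form (L i) y a b c)" for i y
    unfolding pairing_corners by (rule sum_corners[of "L i" y]) (rule finite_D, rule zero)
  have LL: "pairing (L i) (L j) = 0" for i j
    unfolding faces
  proof (rule sum.neutral, rule ballI)
    fix t assume "t \<in> T"
    then show "(case listing z t of (a, b, c) \<Rightarrow> face_form (L i) (L j) a b c) = 0"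
      using face face_form_dlog_edge by (auto simp: L_def split: prod.split)
  qed
  have LcL: "pairing (L i) (\<lambda>e. cnj (L j e)) = - 4 * \<i> * M $$ (i,j)" if "i < N" "j < N" for i j
  proof -
    have "pairing (L i) (\<lambda>e. cnj (L j e)) =
      (\<Sum>t\<in>T. - 4 * \<i> * (of_real (face_weight (listing z t) z) * s t i * cnj (s t j)))"
      unfolding faces
    proof (rule sum.cong)
      fix t assume t: "t \<in> T"
      obtain a b c where abc: "listing z t = (a, b, c)" by (cases "listing z t")
      have "face_form (dlog_edge z (i + 4)) (\<lambda>e. cnj (dlog_edge z (j + 4) e)) a b c =
        - 4 * \<i> * (of_real (face_weight (a, b, c) z) * s t i * cnj (s t j))"
        unfolding s_def abc using face[OF t abc] by (intro face_form_dlog_edge_cnj) auto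
      then show "(case listing z t of (a, b, c) \<Rightarrow> face_form (L i) (\<lambda>e. cnj (L j e)) a b c) =
        - 4 * \<i> * (of_real (face_weight (listing z t) z) * s t i * cnj (s t j))"
        by (simp only: abc L_def prod.case)
    qed simp
    also have "\<dots> = - 4 * \<i> * M $$ (i,j)"
    proof -
      have "M $$ (i,j) = (\<Sum>t\<in>T. of_real (face_weight (listing z t) z) * s t i * cnj (s t j))"
        using that by (simp add: M_eq)
      then show ?thesis by (simp only: sum_distrib_left)
    qed
    finally show ?thesis .
  qed
  have theta: "wirt_z (\<lambda>w. complex_of_real (theta z T e w)) z v = \<i> / 2 * shear_edge (dlog_edge z v) e"
    "wirt_zbar (\<lambda>w. complex_of_real (theta z T e w)) z v = cnj (\<i> / 2 * shear_edge (dlog_edge z v) e)"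
    if "e \<in> E0" for e v
  proof -
    have "e \<in> {{a, b} | a b. (a, b) \<in> darts}" unfolding edges_darts using that E0_sub by blast
    then obtain a' b' where ab': "e = {a', b'}" "(a', b') \<in> darts" by blast
    define a b where "a = min a' b'" and "b = max a' b'"
    have ab: "e = {a, b}" "(a, b) \<in> darts" "a < b"
      using ab' darts_sym[OF ab'(2)] darts_neq[OF ab'(2)] unfolding a_def b_def
      by (cases "a' \<le> b'"; simp add: insert_commute)+
    have "has_wirt (\<lambda>w. complex_of_real (theta z T e w)) z v
        (\<i> / 2 * shear (dlog_edge z v) a b) (cnj (\<i> / 2 * shear (dlog_edge z v) a b))"
      unfolding shear_def
      by (rule has_wirt_theta[OF ab(1,3) refl refl dart_ratio[OF ab(2)] dart_ratio[OF darts_sym[OF ab(2)]]])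
    from has_wirt_imp_wirt_z[OF this] has_wirt_imp_wirt_zbar[OF this]
    show "wirt_z (\<lambda>w. complex_of_real (theta z T e w)) z v = \<i> / 2 * shear_edge (dlog_edge z v) e"
      "wirt_zbar (\<lambda>w. complex_of_real (theta z T e w)) z v = cnj (\<i> / 2 * shear_edge (dlog_edge z v) e)"
      unfolding ab(1) shear_edge by simp_all
  qed
  have esE0: "es j \<in> E0" if "j < 2*N" for j using bij that by (auto simp: bij_betw_def)
  have J: "Jprime N z T E0 = mat (2*N) (2*N) (\<lambda>(i,j). if i < N then \<i>/2 * shear_edge (L i) (es j)
       else cnj (\<i>/2 * shear_edge (L (i - N)) (es j)))"
    unfolding Jprime_def Let_def es_def[symmetric] L_def
  proof (rule cong_mat[OF refl refl])
    fix i j assume "j < 2 * N"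
    then show "(case (i, j) of (i, j) \<Rightarrow> if i < N then wirt_z (\<lambda>w. complex_of_real (theta z T (es j) w)) z (i + 4)
         else wirt_zbar (\<lambda>w. complex_of_real (theta z T (es j) w)) z (i - N + 4)) =
      (case (i, j) of (i, j) \<Rightarrow> if i < N then \<i>/2 * shear_edge (dlog_edge z (i + 4)) (es j)
         else cnj (\<i>/2 * shear_edge (dlog_edge z (i - N + 4)) (es j)))"
      unfolding prod.case using theta[OF esE0] by (simp only:)
  qed
  have "cmod (det (Jprime N z T E0)) = cmod (det M)"
    unfolding J
  proof (rule cmod_det_complement[OF _ LL LcL])
    show "bij_betw es {..<2*N} (edge_set - (edges T - E0))" unfolding complement by (rule bij)
    show "M \<in> carrier_mat N N" by (simp add: M_def hess_AT_def)
  qed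
  moreover have "\<exists>r\<ge>0. det M = of_real r"
    unfolding M_eq
  proof (rule det_gram_nonneg[OF finite_T])
    show "face_weight (listing z t) z \<ge> 0" if "t \<in> T" for t
      using pos[OF that] by (simp add: face_weight_def)
  qed
  then obtain r where r: "r \<ge> 0" "det M = of_real r" by blast
  then have "cmod (det M) = r" by simp
  ultimately have "cmod (det (Jprime N z T E0)) = r" by (simp only:)
  \<comment> \<open>The modulus of 2/i is 2, and the determinant, being real and nonnegative, equals
    its own modulus.\<close>
  then have "D_T_red N z T E0 = 2 ^ N * r"
    by (simp add: D_T_red_def norm_mult norm_power norm_divide)
  then show ?thesis using r(2) by (simp add: M_def)
qed

end
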